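(* Let $d>4$ and let $F:\mathbb{R}^d\to[0,\infty)$ be a continuous compactly supported function with $\int_{\mathbb{R}^d}F(x)\,dx=1$, invariant under each reflection $(x_1,\dots,x_i,\dots,x_d)\mapsto(x_1,\dots,-x_i,\dots,x_d)$, $1\le i\le d$. For $L\in\mathbb{N}$ large set $f_L(x)=F(x/L)\big/\sum_{y\in\mathbb{Z}^d}F(y/L)$ for $x\in\mathbb{Z}^d$, and let $p_c(d,L)$ and $p_c^{(2)}(d,L)$ be the thresholds $p_c$ and $p_c^{(2)}$ of the oriented percolation model on $\mathbb{N}\times\mathbb{Z}^d$ with $f=f_L$. Then for all $L$ large enough, $$p_c^{(2)}(d,L)>p_c(d,L).$$
   Context: Model. $\mathbb{N}=\{0,1,2,\dots\}$. Let $f:\mathbb{Z}^d\to[0,\infty)$ have finite support with $\sum_z f(z)=1$; put $p_{\max}:=\inf_{z}1/f(z)$ (with $1/0=\infty$) and let $p\in(0,p_{\max}]$. Under $\mathbb{P}_p$ (expectation $\mathbb{E}_p$), $(X_{(n,x),(n+1,y)})_{n\in\mathbb{N},\,x,y\in\mathbb{Z}^d}$ are independent Bernoulli variables with parameter $p f(y-x)$. The edge $((n,x),(n+1,y))$ is open if $X_{(n,x),(n+1,y)}=1$. A sequence $(S_n)$ in $\mathbb{Z}^d$ indexed by an interval of $\mathbb{N}$ is an open oriented path if all the edges $((n,S_n),(n+1,S_{n+1}))$ are open. Let $\mathcal{P}$ be the event that there is an infinite open path $(S_n)_{n\ge0}$ with $S_0=0$, and $p_c:=\inf\{p:\mathbb{P}_p(\mathcal{P})>0\}=\sup\{p:\mathbb{P}_p(\mathcal{P})=0\}$.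 Let $Z_N$ be the number of open paths $S:\{0,\dots,N\}\to\mathbb{Z}^d$ with $S_0=0$, so that $\mathbb{E}_p[Z_N]=p^N$. Growth rate. Let $\mathcal{X}:=\limsup_{N\to\infty}\frac1N\log Z_N$ (with $\log 0=-\infty$). On $\mathcal{P}$, $\mathcal{X}$ is almost surely constant. Let $\mathrm{f}(p)$ be this constant (i.e. $\mathcal{X}=\mathrm{f}(p)$, $\mathbb{P}_p(\cdot\mid\mathcal{P})$-a.s.) if $\mathbb{P}_p(\mathcal{P})>0$, and $\mathrm{f}(p):=-\infty$ if $\mathbb{P}_p(\mathcal{P})=0$. The function $p\mapsto \mathrm{f}(p)-\log p$ is non-decreasing and $\le 0$. Threshold. $p_c^{(2)}:=\inf\{p\in(0,p_{\max}]:\mathrm{f}(p)=\log p\}$, with the convention $p_c^{(2)}:=p_{\max}$ if this set is empty. *)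

theory Defs
  imports "HOL-Probability.Probability"
begin

text \<open>Oriented percolation on $\mathbb{N}\times\mathbb{Z}^d$ with step weights
  \<open>f\<close>. A configuration maps \<open>(n, x, y)\<close>, standing for the edge from
  $(n,x)$ to $(n+1,y)$, to \<open>True\<close> if that edge is open.\<close>

type_synonym 'd config = "nat \<times> (int ^ 'd) \<times> (int ^ 'd) \<Rightarrow> bool"

text \<open>The infimum of $1/f(z)$ with the convention $1/0=\infty$; points with
  \<open>f z = 0\<close> do not contribute and must be left out, because HOL has
  \<open>1 / 0 = 0\<close>.\<close>

definition p_max :: "((int ^ 'd) \<Rightarrow> real) \<Rightarrow> real" where
  "p_max f = (INF z\<in>{z. f z \<noteq> 0}. 1 / f z)"

text \<open>The product measure is completed because the percolation event need not be
  Borel: configurations with infinitely many open edges out of a vertex are not excluded.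
  These form a null set (\<open>f\<close> has finite support), so the event is measurable for
  the completion.\<close>

definition perc_measure :: "((int ^ 'd::finite) \<Rightarrow> real) \<Rightarrow> real \<Rightarrow> 'd config measure" where
  "perc_measure f p =
     completion (PiM UNIV (\<lambda>(n, x, y). measure_pmf (bernoulli_pmf (p * f (y - x)))))"

definition open_path :: "'d::finite config \<Rightarrow> nat set \<Rightarrow> (nat \<Rightarrow> int ^ 'd) \<Rightarrow> bool" where
  "open_path X I S \<longleftrightarrow> (\<forall>n. n \<in> I \<and> Suc n \<in> I \<longrightarrow> X (n, S n, S (Suc n)))"

definition percolation :: "'d::finite config set" where
  "percolation = {X. \<exists>S. S 0 = 0 \<and> open_path X UNIV S}"

definition p_crit :: "((int ^ 'd::finite) \<Rightarrow> real) \<Rightarrow> real" where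
  "p_crit f = Inf {p. 0 < p \<and> p \<le> p_max f \<and> measure (perc_measure f p) percolation > 0}"

text \<open>The set of paths below is almost surely finite, so that \<open>card\<close> returns its
  true cardinality outside a null set. Paths are extensional on \<open>{0..N}\<close> so that
  each is counted once.\<close>

definition num_paths :: "'d::finite config \<Rightarrow> nat \<Rightarrow> nat" where
  "num_paths X N = card {S \<in> {0..N} \<rightarrow>\<^sub>E UNIV. S 0 = 0 \<and> open_path X {0..N} S}"

definition log_nat :: "nat \<Rightarrow> ereal" where
  "log_nat k = (if k = 0 then -\<infinity> else ereal (ln (real k)))"

definition growth :: "'d::finite config \<Rightarrow> ereal" where
  "growth X = limsup (\<lambda>N. ereal (1 / real N) * log_nat (num_paths X N))"

text \<open>The conditional measure given percolation is \<open>uniform_measure\<close>.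
  \<open>growth\<close> is almost surely constant under it, which makes the description
  well defined.\<close>

definition growth_rate :: "((int ^ 'd::finite) \<Rightarrow> real) \<Rightarrow> real \<Rightarrow> ereal" where
  "growth_rate f p =
     (if measure (perc_measure f p) percolation > 0
      then (THE c. AE X in uniform_measure (perc_measure f p) percolation. growth X = c)
      else -\<infinity>)"

definition p_crit2 :: "((int ^ 'd::finite) \<Rightarrow> real) \<Rightarrow> real" where
  "p_crit2 f =
     (let A = {p. 0 < p \<and> p \<le> p_max f \<and> growth_rate f p = ereal (ln p)}
      in if A = {} then p_max f else Inf A)"

definition real_point :: "int ^ 'd \<Rightarrow> real ^ 'd" where
  "real_point x = (\<chi> i. real_of_int (x $ i))"

text \<open>For compactly supported \<open>F\<close> and \<open>L \<ge> 1\<close> the sum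
  has only finitely many nonzero terms.\<close>

definition spread_out :: "(real ^ 'd \<Rightarrow> real) \<Rightarrow> nat \<Rightarrow> (int ^ 'd) \<Rightarrow> real" where
  "spread_out F L x =
     F (real_point x /\<^sub>R real L) / (\<Sum>\<^sub>\<infinity>y. F (real_point y /\<^sub>R real L))"

definition reflect :: "'d \<Rightarrow> real ^ 'd \<Rightarrow> real ^ 'd" where
  "reflect i x = (\<chi> j. if j = i then - (x $ j) else x $ j)"

end

theory Submission
  imports Defs "HOL-Real_Asymp.Real_Asymp"
begin

text \<open>
  Write \<open>\<epsilon> ~ L^(-d)\<close> for the size of the kernel, fix a large block length
  \<open>m\<close>, and let \<open>t\<close>, of order \<open>m \<epsilon>\<close>, be the expected number of
  ordered pairs of distinct open \<open>m\<close>-step paths from the origin with a common endpoint, at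
  \<open>p = 1\<close>. As \<open>L\<close> tends to infinity with \<open>m\<close> fixed, almost all
  coincidences are pairs, so that \<open>t\<close> measures both thresholds to first order.

  Percolation only needs connections. Count chains of connected blocks, weighting each block
  displacement by its probability under the walk divided by its connection probability. This has
  mean one, and up to lower order its second moment stays bounded as soon as
  \<open>p^m > 1 + t/2\<close>, because a connection realised by two paths is counted once. Hence
  \<open>p_crit f \<le> 1 + 0.53 t/m\<close>.

  On the other hand, by concavity \<open>E sqrt(Z)\<close> summed over the endpoints of one block is
  about \<open>p^m - (1 - 2^(-1/2)) t\<close>, which is smaller than \<open>p^(m/2)\<close> while
  \<open>p^m < 1 + (2 - 2^(1/2)) t\<close>; iterating over blocks, the number of paths then grows
  strictly slower than \<open>p^N\<close>. Since \<open>2 - 2^(1/2) > 0.58\<close>, this gives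
  \<open>p_crit2 f \<ge> 1 + 0.56 t/m\<close>.
\<close>

section \<open>The difference walk\<close>

text \<open>The gap comes from strict concavity. With a moment of order s instead of the square
  root, the block bound would hold to first order while \<open>p^m - 1\<close> is below
  \<open>t\<close> times (1 - 2^(s-1)) / (1 - s). This ratio increases from 1/2 at s = 0, the
  percolation constant, to ln 2 at s = 1; the value s = 1/2 is a convenient choice. The second
  moment must not lose a fixed factor per block, since the number of blocks is unbounded. For chains
  at different vertices the error has to be proportional to their probability of meeting inside the
  block, which calls for a covariance inequality for connections. For chains at the same vertex one
  must add the pairs that part and meet again in a later block. Return probabilities decaying like
  1/n^2 make the Green tail beyond j steps at most \<epsilon>/j, so these pairs cost about
  \<epsilon> times the harmonic number of m, while t is at least of order m \<epsilon>. Hence m is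
  chosen first, large enough for m to beat log m, and \<epsilon> is sent to zero afterwards;
  constants such as 16^m, 48^m and 100^m then do no harm.\<close>

locale kernel =
  fixes f :: "(int ^ 'd::finite) \<Rightarrow> real" and R :: "(int ^ 'd) set"
  assumes finite_R: "finite R" and f_nonneg: "\<And>s. 0 \<le> f s"
    and f_outside: "\<And>s. s \<notin> R \<Longrightarrow> f s = 0" and f_sum: "sum f R = 1"
begin

definition Pop :: "((int ^ 'd) \<Rightarrow> real) \<Rightarrow> (int ^ 'd) \<Rightarrow> real" where
  "Pop h z = (\<Sum>a\<in>R. \<Sum>b\<in>R. f a * f b * h (z + a - b))"

definition Poff :: "((int ^ 'd) \<Rightarrow> real) \<Rightarrow> real" where
  "Poff h = (\<Sum>a\<in>R. \<Sum>b\<in>R. if a = b then 0 else f a * f b * h (a - b))"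

definition ker0 :: "(int ^ 'd) \<Rightarrow> real" where
  "ker0 z = of_bool (z = 0)"

definition ret :: "nat \<Rightarrow> (int ^ 'd) \<Rightarrow> real" where
  "ret n = (Pop ^^ n) ker0"

text \<open>\<open>Pop\<close> moves the difference of two paths. At difference zero
  the two paths may use the same edge, which then costs \<open>p\<close> once instead of twice.\<close>

definition Qop :: "real \<Rightarrow> ((int ^ 'd) \<Rightarrow> real) \<Rightarrow> (int ^ 'd) \<Rightarrow> real" where
  "Qop p h z = (if z = 0 then p * h 0 + p\<^sup>2 * Poff h else p\<^sup>2 * Pop h z)"

lemma ret_0: "ret 0 z = of_bool (z = 0)" by (simp add: ret_def ker0_def)
lemma ret_Suc: "ret (Suc n) = Pop (ret n)" by (simp add: ret_def)

lemma Pop_mono: "(\<And>z. h z \<le> h' z) \<Longrightarrow> Pop h z \<le> Pop h' z"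
  unfolding Pop_def by (intro sum_mono mult_left_mono) (auto simp: f_nonneg)

lemma Pop_nonneg: "(\<And>z. 0 \<le> h z) \<Longrightarrow> 0 \<le> Pop h z"
  unfolding Pop_def by (intro sum_nonneg mult_nonneg_nonneg) (auto simp: f_nonneg)

lemma Poff_mono: "(\<And>z. z \<noteq> 0 \<Longrightarrow> h z \<le> h' z) \<Longrightarrow> Poff h \<le> Poff h'"
  unfolding Poff_def by (intro sum_mono) (auto intro!: mult_left_mono simp: f_nonneg)

lemma Poff_nonneg: "(\<And>z. 0 \<le> h z) \<Longrightarrow> 0 \<le> Poff h"
  unfolding Poff_def by (intro sum_nonneg) (auto intro!: mult_nonneg_nonneg simp: f_nonneg)

lemma Pop_add: "Pop (\<lambda>z. h z + h' z) z = Pop h z + Pop h' z"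
  unfolding Pop_def by (simp add: algebra_simps sum.distrib)

lemma Pop_cmult: "Pop (\<lambda>z. c * h z) z = c * Pop h z"
  unfolding Pop_def by (simp add: sum_distrib_left mult.left_commute)

lemma Pop_const: "Pop (\<lambda>_. c) z = c"
proof -
  have "(\<Sum>b\<in>R. f a * f b * c) = f a * c" for a
    using sum_distrib_left[of "f a * c" f R] f_sum by (simp add: mult_ac)
  then show ?thesis using sum_distrib_left[of c f R] f_sum by (simp add: Pop_def mult_ac)
qed

lemma Pop_sum: "Pop (\<lambda>z. \<Sum>n\<in>N. h n z) z = (\<Sum>n\<in>N. Pop (h n) z)"
proof -
  have "Pop (\<lambda>z. \<Sum>n\<in>N. h n z) z = (\<Sum>a\<in>R. \<Sum>b\<in>R. \<Sum>n\<in>N. f a * f b * h n (z + a - b))"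
    by (simp add: Pop_def sum_distrib_left)
  also have "\<dots> = (\<Sum>a\<in>R. \<Sum>n\<in>N. \<Sum>b\<in>R. f a * f b * h n (z + a - b))"
    by (intro sum.cong refl sum.swap)
  also have "\<dots> = (\<Sum>n\<in>N. Pop (h n) z)"
    unfolding Pop_def by (rule sum.swap)
  finally show ?thesis .
qed

lemma Poff_eq: "Poff h = Pop h 0 - ret 1 0 * h 0"
proof -
  have r: "ret 1 0 = (\<Sum>a\<in>R. \<Sum>b\<in>R. if a = b then f a * f b else 0)"
    unfolding One_nat_def ret_Suc Pop_def ret_0 by (intro sum.cong refl) simp
  have "Pop h 0 - ret 1 0 * h 0 = (\<Sum>a\<in>R. \<Sum>b\<in>R. f a * f b * h (a - b) - (if a = b then f a * f b else 0) * h 0)"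
    unfolding r by (simp add: Pop_def sum_subtractf sum_distrib_right)
  also have "\<dots> = Poff h" unfolding Poff_def by (intro sum.cong refl) simp
  finally show ?thesis by simp
qed

lemma ret_nonneg: "0 \<le> ret n z"
  by (induction n arbitrary: z) (simp_all add: ret_0 ret_Suc Pop_nonneg)

lemma Poff_le: "0 \<le> h 0 \<Longrightarrow> Poff h \<le> Pop h 0"
  using ret_nonneg[of 1 0] by (simp add: Poff_eq)

lemma Qop_mono: "0 \<le> p \<Longrightarrow> (\<And>z. h z \<le> h' z) \<Longrightarrow> Qop p h z \<le> Qop p h' z"
  unfolding Qop_def by (auto intro!: add_mono mult_left_mono Pop_mono Poff_mono)

lemma Qop_nonneg: "0 \<le> p \<Longrightarrow> (\<And>z. 0 \<le> h z) \<Longrightarrow> 0 \<le> Qop p h z"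
  unfolding Qop_def by (auto intro!: add_nonneg_nonneg mult_nonneg_nonneg Pop_nonneg Poff_nonneg)

lemma Qop_pow_nonneg: "0 \<le> p \<Longrightarrow> (\<And>z. 0 \<le> h z) \<Longrightarrow> 0 \<le> (Qop p ^^ k) h z"
  by (induction k arbitrary: z) (simp_all add: Qop_nonneg)

text \<open>For \<open>1 \<le> p\<close> the price \<open>p\<close> of a shared edge is at most
  \<open>p^2\<close>. This pulls a factor \<open>p^2\<close> out of every step and leaves a walk
  with a unit source at the origin, so that iterates of \<open>Qop\<close> can be compared with sums
  of \<open>ret\<close>.\<close>

lemma Qop_le:
  assumes "1 \<le> p" "\<And>z. 0 \<le> h z"
  shows "Qop p h z \<le> p\<^sup>2 * (Pop h z + ker0 z * h 0)"
proof (cases "z = 0")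
  case True
  have "p * h 0 \<le> p\<^sup>2 * h 0" using assms by (intro mult_right_mono) (auto simp: power2_eq_square)
  moreover have "p\<^sup>2 * Poff h \<le> p\<^sup>2 * Pop h 0" using Poff_le[of h] assms by (intro mult_left_mono) auto
  ultimately show ?thesis using True by (simp add: Qop_def ker0_def algebra_simps)
qed (simp add: Qop_def ker0_def)

text \<open>The expected number of pairs of distinct open \<open>k\<close>-step paths
  that start at distance \<open>z\<close> and end at the same point.\<close>

fun excess :: "real \<Rightarrow> nat \<Rightarrow> (int ^ 'd) \<Rightarrow> real" where
  "excess p 0 z = 0"
| "excess p (Suc k) z = (if z = 0 then p * excess p k 0 + p\<^sup>2 * Poff (excess p k) else p\<^sup>2 * (Pop (excess p k) z + ret 1 z * p ^ k))"

text \<open>Splits the pairs that end at a common point into identical pairs, which exist only for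
  \<open>z = 0\<close> and have weight \<open>p^k\<close>, and pairs of distinct paths.\<close>

lemma Qop_pow_ker0: "(Qop p ^^ k) ker0 z = excess p k z + ker0 z * p ^ k"
proof (induction k arbitrary: z)
  case (Suc k)
  have IH: "(Qop p ^^ k) ker0 = (\<lambda>z. excess p k z + p ^ k * ker0 z)"
    by (auto simp: Suc.IH fun_eq_iff)
  have 1: "Pop ((Qop p ^^ k) ker0) z = Pop (excess p k) z + p ^ k * ret 1 z"
    unfolding IH Pop_add Pop_cmult by (simp add: ret_def)
  have 2: "Poff ((Qop p ^^ k) ker0) = Poff (excess p k)"
    unfolding Poff_def IH by (intro sum.cong refl) (auto simp: ker0_def)
  have 3: "(Qop p ^^ k) ker0 0 = excess p k 0 + p ^ k" unfolding Suc.IH by (simp add: ker0_def)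
  have "(Qop p ^^ Suc k) ker0 z = Qop p ((Qop p ^^ k) ker0) z" by simp
  also have "\<dots> = (if z = 0 then p * (excess p k 0 + p ^ k) + p\<^sup>2 * Poff (excess p k) else p\<^sup>2 * (Pop (excess p k) z + p ^ k * ret 1 z))"
    unfolding Qop_def 1 2 3 ..
  finally show ?case by (cases "z = 0") (simp_all add: ker0_def[of z] ker0_def[of 0] algebra_simps)
qed simp

lemma excess_nonneg: "0 \<le> p \<Longrightarrow> 0 \<le> excess p k z"
  by (induction k arbitrary: z) (auto intro!: add_nonneg_nonneg mult_nonneg_nonneg Pop_nonneg Poff_nonneg ret_nonneg)

text \<open>Together with \<open>excess_le\<close> this lets the one number
  \<open>excess 1 m 0\<close> serve at every density between 1 and 2: the lower bound is used for
  the fractional moment, the upper bound for survival.\<close>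

lemma excess_mono:
  assumes "1 \<le> p" shows "excess 1 k z \<le> excess p k z"
proof (induction k arbitrary: z)
  case (Suc k)
  have p2: "1 \<le> p\<^sup>2" "1 \<le> p ^ k" using assms by (simp_all add: one_le_power)
  have "ret 1 z * 1 \<le> ret 1 z * p ^ k" using p2 ret_nonneg by (intro mult_left_mono) auto
  then have "1 * (Pop (excess 1 k) z + ret 1 z) \<le> p\<^sup>2 * (Pop (excess p k) z + ret 1 z * p ^ k)"
    using p2 Pop_mono[OF Suc.IH] Pop_nonneg[of "excess 1 k" z] ret_nonneg[of 1 z] excess_nonneg[of 1 k]
    by (intro mult_mono add_mono) auto
  moreover have "1 * excess 1 k 0 + 1 * Poff (excess 1 k) \<le> p * excess p k 0 + p\<^sup>2 * Poff (excess p k)"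
    using p2 assms Suc.IH Poff_mono[of "excess 1 k" "excess p k"] Poff_nonneg[of "excess 1 k"] excess_nonneg[of 1 k]
    by (intro mult_mono add_mono) auto
  ultimately show ?case by simp
qed simp

lemma excess_le:
  assumes "1 \<le> p" shows "excess p k z \<le> p ^ (2 * k) * excess 1 k z"
proof (induction k arbitrary: z)
  case (Suc k)
  have a: "Pop (excess p k) z \<le> p ^ (2*k) * Pop (excess 1 k) z" for z
    using Pop_mono[OF Suc.IH] by (simp add: Pop_cmult)
  have b: "Poff (excess p k) \<le> p ^ (2*k) * Poff (excess 1 k)"
    using Poff_mono[OF Suc.IH] by (simp add: Poff_def sum_distrib_left if_distrib mult.left_commute cong: if_cong)
  have "p ^ k \<le> p ^ (2*k)" using assms by (intro power_increasing) auto
  then have c: "ret 1 z * p ^ k \<le> ret 1 z * p ^ (2*k)" using ret_nonneg by (intro mult_left_mono) auto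
  have pp: "p ^ (2 * Suc k) = p\<^sup>2 * p ^ (2*k)" by (simp add: power2_eq_square)
  have d: "p * excess p k 0 \<le> p\<^sup>2 * (p ^ (2*k) * excess 1 k 0)"
    using assms Suc.IH[of 0] excess_nonneg[of p k 0] self_le_power[of p 2] by (intro mult_mono) auto
  have e: "p\<^sup>2 * Poff (excess p k) \<le> p\<^sup>2 * (p ^ (2*k) * Poff (excess 1 k))" using b by (intro mult_left_mono) auto
  have "p\<^sup>2 * (Pop (excess p k) z + ret 1 z * p ^ k) \<le> p\<^sup>2 * (p ^ (2*k) * Pop (excess 1 k) z + ret 1 z * p ^ (2*k))"
    using add_mono[OF a[of z] c] by (intro mult_left_mono) auto
  then show ?case using d e unfolding pp by (simp add: algebra_simps)
qed simp

text \<open>Keeps only the pairs that share their first steps, part for one step, rejoin in the next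
  and then stay together. The difference \<open>ret 2 0 - (ret 1 0)\<^sup>2\<close> is the
  probability that two walks are apart after one step and together after two, and
  \<open>Suc k\<close> steps leave \<open>k\<close> places for such an excursion.\<close>

lemma excess_lower: "real k * (ret 2 0 - (ret 1 0)\<^sup>2) \<le> excess 1 (Suc k) 0"
proof (induction k)
  case 0 then show ?case using excess_nonneg[of 1 "Suc 0" 0] by (simp del: excess.simps)
next
  case (Suc k)
  have "ret 1 z \<le> excess 1 (Suc k) z" if "z \<noteq> 0" for z
    using that Pop_nonneg[of "excess 1 k" z] excess_nonneg[of 1 k] by simp
  then have "Poff (ret 1) \<le> Poff (excess 1 (Suc k))" by (intro Poff_mono)
  moreover have "Poff (ret 1) = ret 2 0 - (ret 1 0)\<^sup>2"
    by (simp add: Poff_eq power2_eq_square numeral_2_eq_2 ret_Suc)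
  ultimately have "ret 2 0 - (ret 1 0)\<^sup>2 \<le> Poff (excess 1 (Suc k))" by simp
  moreover have "excess 1 (Suc (Suc k)) 0 = excess 1 (Suc k) 0 + Poff (excess 1 (Suc k))"
    by (subst excess.simps(2)) simp
  ultimately show ?case using Suc.IH by (simp add: algebra_simps del: excess.simps)
qed

end

text \<open>The chord of a convex function over the unit interval. It makes error factors linear in
  \<open>x\<close>, with a constant that depends on the exponent only.\<close>

lemma one_plus_power_le:
  fixes x :: real assumes "0 \<le> x" "x \<le> 1"
  shows "(1 + x) ^ n \<le> 1 + (2 ^ n - 1) * x"
proof (induction n)
  case (Suc n)
  have "(1 + x) ^ Suc n \<le> (1 + (2 ^ n - 1) * x) * (1 + x)"
    using Suc assms by (simp add: mult.commute mult_right_mono)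
  also have "\<dots> = 1 + (2 ^ n - 1) * x + x + (2 ^ n - 1) * (x * x)" by (simp add: algebra_simps)
  also have "\<dots> \<le> 1 + (2 ^ n - 1) * x + x + (2 ^ n - 1) * (x * 1)"
    using assms by (intro add_left_mono mult_left_mono) auto
  finally show ?case by (simp add: algebra_simps)
qed simp

section \<open>Green function and iterates of the two-path operator\<close>

locale transient_kernel = kernel f R for f :: "(int ^ 'd::finite) \<Rightarrow> real" and R +
  fixes \<epsilon> :: real
  assumes eps: "0 < \<epsilon>" "4 * \<epsilon> \<le> 1" and f_le: "\<And>s. f s \<le> \<epsilon>"
    and ret_le: "\<And>n z. 1 \<le> n \<Longrightarrow> ret n z \<le> \<epsilon> / (real n)\<^sup>2"
begin

text \<open>The Green function of the difference of two independent walks. The assumed decay of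
  \<open>ret\<close> is that of dimension four and makes the tail beyond \<open>k\<close> steps at
  most \<open>\<epsilon> / k\<close>.\<close>

definition green :: "(int ^ 'd) \<Rightarrow> real" where
  "green z = (\<Sum>n. ret n z)"

text \<open>Starting at time \<open>n + Suc k\<close> lets the comparison of
  \<open>1 / (y + 1)^2\<close> with \<open>1 / y - 1 / (y + 1)\<close> telescope exactly to
  \<open>\<epsilon> / k\<close>.\<close>

lemma ret_tail_bound:
  assumes "1 \<le> k"
  shows "ret (n + Suc k) z \<le> \<epsilon> * (1 / real (n + k) - 1 / real (Suc n + k))"
proof -
  let ?y = "real (n + k)"
  have y: "1 \<le> ?y" using assms by simp
  have "ret (n + Suc k) z \<le> \<epsilon> / (?y + 1)\<^sup>2" using ret_le[of "n + Suc k" z] by (simp add: add_ac)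
  also have "\<dots> = \<epsilon> * (1 / (?y + 1)\<^sup>2)" by simp
  also have "\<dots> \<le> \<epsilon> * (1 / (?y * (?y + 1)))"
    using y eps by (intro mult_left_mono divide_left_mono) (auto simp: power2_eq_square)
  also have "1 / (?y * (?y + 1)) = 1 / ?y - 1 / (?y + 1)" using y by (simp add: field_simps)
  finally show ?thesis by (simp add: add_ac)
qed

lemma tail_sums: "1 \<le> k \<Longrightarrow> (\<lambda>n. \<epsilon> * (1 / real (n + k) - 1 / real (Suc n + k))) sums (\<epsilon> / real k)"
proof -
  assume "1 \<le> k"
  have "(\<lambda>n. 1 / real (n + k)) \<longlonglongrightarrow> 0"
    using LIMSEQ_ignore_initial_segment[OF lim_1_over_n, of k] by simp
  from sums_mult[OF telescope_sums'[OF this], of \<epsilon>] show ?thesis by simp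
qed

lemma summable_ret: "summable (\<lambda>n. ret n z)"
proof -
  have "summable (\<lambda>n. ret (n + Suc 1) z)"
    using ret_tail_bound[of 1] ret_nonneg by (intro summable_comparison_test'[OF sums_summable[OF tail_sums[of 1]], of 0]) auto
  then show ?thesis by (subst (asm) summable_iff_shift)
qed

lemma green_tail: "1 \<le> k \<Longrightarrow> green z \<le> (\<Sum>n\<le>k. ret n z) + \<epsilon> / real k"
proof -
  assume k: "1 \<le> k"
  have "green z = (\<Sum>n. ret (n + Suc k) z) + (\<Sum>n<Suc k. ret n z)"
    unfolding green_def by (rule suminf_split_initial_segment[OF summable_ret])
  moreover have "(\<Sum>n. ret (n + Suc k) z) \<le> (\<Sum>n. \<epsilon> * (1 / real (n + k) - 1 / real (Suc n + k)))"
    by (intro suminf_le ret_tail_bound k summable_ignore_initial_segment summable_ret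
        sums_summable[OF tail_sums[OF k]])
  ultimately show ?thesis using sums_unique[OF tail_sums[OF k]] by (simp add: lessThan_Suc_atMost)
qed

lemma sum_ret_le_green: "(\<Sum>n\<in>N. ret n z) \<le> green z" if "finite N"
  unfolding green_def using that by (intro sum_le_suminf summable_ret ret_nonneg)

lemma green_nonneg: "0 \<le> green z"
  using sum_ret_le_green[of "{}" z] by simp

lemma green_le: "green z \<le> ker0 z + 2 * \<epsilon>"
  using green_tail[of 1 z] ret_le[of 1 z] by (simp add: ret_0 ker0_def)

lemma Pop_green: "Pop green z = green z - ker0 z"
proof -
  have "(\<lambda>n. Pop (ret n) z) sums Pop green z"
    unfolding Pop_def green_def by (intro sums_sum sums_mult summable_sums summable_ret)
  then have "Pop green z = (\<Sum>n. ret (Suc n) z)" by (simp add: ret_Suc sums_iff)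
  also have "\<dots> = green z - ret 0 z" unfolding green_def using suminf_split_head[OF summable_ret] .
  finally show ?thesis by (simp add: ret_0 ker0_def)
qed

text \<open>The Green function counts all visits to the origin; after \<open>k\<close> free steps
  those at the first \<open>k\<close> times have been spent. This drop later pays for the errors in
  the Lyapunov argument.\<close>

lemma Pop_pow_green: "(Pop ^^ k) green z = green z - (\<Sum>n<k. ret n z)"
proof (induction k arbitrary: z)
  case (Suc k)
  have "(Pop ^^ k) green = (\<lambda>z. green z + (-1) * (\<Sum>n<k. ret n z))" by (simp add: Suc.IH fun_eq_iff)
  then have "(Pop ^^ Suc k) green z = Pop (\<lambda>z. green z + (-1) * (\<Sum>n<k. ret n z)) z" by simp
  also have "\<dots> = green z - ker0 z - (\<Sum>n<k. ret (Suc n) z)"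
    by (simp only: Pop_add Pop_cmult Pop_sum Pop_green ret_Suc)
  also have "\<dots> = green z - (\<Sum>n<Suc k. ret n z)"
    unfolding sum.lessThan_Suc_shift by (simp add: ret_0 ker0_def)
  finally show ?case .
qed simp

lemma Pop_pow_affine: "(Pop ^^ k) (\<lambda>z. a + b * green z) z = a + b * (Pop ^^ k) green z"
proof (induction k arbitrary: z)
  case (Suc k)
  have "(Pop ^^ Suc k) (\<lambda>z. a + b * green z) z = Pop (\<lambda>z. a + b * (Pop ^^ k) green z) z" by (simp add: Suc.IH[abs_def])
  then show ?case by (simp add: Pop_add Pop_cmult Pop_const)
qed simp

lemma sum_ret_0_le: "(\<Sum>n<k. ret n 0) \<le> 1 + 2 * \<epsilon>" "(\<Sum>n\<le>k. ret n 0) \<le> 1 + 2 * \<epsilon>"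
  using sum_ret_le_green[of "{..<k}" 0] sum_ret_le_green[of "{..k}" 0] green_le[of 0] by (auto simp: ker0_def)

text \<open>\<open>Pop\<close> shifts the partial sums of \<open>ret\<close> by one, and the source
  at the origin restores the missing term \<open>ret 0 z\<close>. The relative strength of the
  source is at most \<open>1 + 2 * \<epsilon>\<close>, the bound on the visits to the origin, and
  this costs a factor of at most \<open>1 + 4 * \<epsilon>\<close> per step.\<close>

lemma Qop_pow_ker0_le:
  assumes p: "1 \<le> p"
  shows "(Qop p ^^ k) ker0 z \<le> p ^ (2 * k) * ((1 + 4 * \<epsilon>) ^ k * (\<Sum>n\<le>k. ret n z))"
proof (induction k arbitrary: z)
  case 0 then show ?case by (simp add: ret_0 ker0_def)
next
  case (Suc k)
  let ?h = "(Qop p ^^ k) ker0" and ?a = "(1 + 4 * \<epsilon>) ^ k"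
  have h0: "0 \<le> ?h z" for z using p by (intro Qop_pow_nonneg) (auto simp: ker0_def)
  have a1: "1 \<le> ?a" using eps by (intro one_le_power) auto
  have split: "(\<Sum>n\<le>Suc k. ret n z) = ker0 z + (\<Sum>n\<le>k. ret (Suc n) z)"
    by (subst sum.atMost_Suc_shift) (simp add: ret_0 ker0_def)
  have P: "Pop ?h z \<le> p ^ (2*k) * (?a * (\<Sum>n\<le>k. ret (Suc n) z))"
  proof -
    have "Pop ?h z \<le> Pop (\<lambda>z. p ^ (2*k) * ?a * (\<Sum>n\<le>k. ret n z)) z"
      by (intro Pop_mono) (use Suc.IH in \<open>simp add: mult_ac\<close>)
    then show ?thesis unfolding Pop_cmult Pop_sum ret_Suc by (simp add: mult_ac)
  qed
  have "(Qop p ^^ Suc k) ker0 z \<le> p\<^sup>2 * (Pop ?h z + ker0 z * ?h 0)"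
    using Qop_le[OF p h0] by simp
  also have "\<dots> \<le> p\<^sup>2 * (p ^ (2*k) * (?a * (\<Sum>n\<le>k. ret (Suc n) z)) + ker0 z * (p ^ (2*k) * (?a * (1 + 2 * \<epsilon>))))"
  proof (intro mult_left_mono add_mono P)
    have "?h 0 \<le> p ^ (2*k) * (?a * (\<Sum>n\<le>k. ret n 0))" by (rule Suc.IH)
    also have "\<dots> \<le> p ^ (2*k) * (?a * (1 + 2 * \<epsilon>))"
      using p a1 sum_ret_0_le(2)[of k] by (intro mult_left_mono) auto
    finally show "?h 0 \<le> p ^ (2*k) * (?a * (1 + 2 * \<epsilon>))" .
  qed (auto simp: ker0_def)
  also have "\<dots> = p ^ (2 * Suc k) * (?a * ((\<Sum>n\<le>k. ret (Suc n) z) + ker0 z * (1 + 2 * \<epsilon>)))"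
    by (simp add: algebra_simps power2_eq_square)
  also have "\<dots> \<le> p ^ (2 * Suc k) * (?a * ((1 + 4 * \<epsilon>) * (\<Sum>n\<le>Suc k. ret n z)))"
  proof (intro mult_left_mono)
    have "0 \<le> (\<Sum>n\<le>k. ret (Suc n) z)" by (intro sum_nonneg ret_nonneg)
    then show "(\<Sum>n\<le>k. ret (Suc n) z) + ker0 z * (1 + 2 * \<epsilon>) \<le> (1 + 4 * \<epsilon>) * (\<Sum>n\<le>Suc k. ret n z)"
      unfolding split using eps by (auto simp: ker0_def algebra_simps)
  qed (use a1 p in auto)
  finally show ?case by (simp add: mult_ac)
qed

lemma excess_upper: "excess 1 k 0 \<le> 8 * 2 ^ k * \<epsilon>"
proof -
  have "excess 1 k 0 + 1 \<le> (1 + 4 * \<epsilon>) ^ k * (\<Sum>n\<le>k. ret n 0)"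
    using Qop_pow_ker0_le[of 1 k 0] by (simp add: Qop_pow_ker0 ker0_def)
  also have "\<dots> \<le> (1 + 4 * \<epsilon>) ^ k * (1 + 4 * \<epsilon>)"
    using sum_ret_0_le(2)[of k] eps by (intro mult_left_mono) auto
  also have "\<dots> = (1 + 4 * \<epsilon>) ^ Suc k" by simp
  also have "\<dots> \<le> 1 + (2 ^ Suc k - 1) * (4 * \<epsilon>)" using eps by (intro one_plus_power_le) auto
  finally have "excess 1 k 0 \<le> (2 ^ Suc k - 1) * (4 * \<epsilon>)" by simp
  also have "\<dots> \<le> 8 * 2 ^ k * \<epsilon>" using eps by (simp add: algebra_simps)
  finally show ?thesis .
qed

text \<open>The weight \<open>1 + B green\<close> is restricted to pairs that are apart at the
  end of the block; paths that stay together until time \<open>i\<close> and then part pay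
  only the Green tail beyond \<open>m - i\<close>.\<close>

lemma Qop_pow_off_le:
  assumes p: "1 \<le> p" and B: "0 \<le> B"
  defines "v \<equiv> (\<lambda>z. if z = 0 then 0 else 1 + B * green z)"
  shows "(Qop p ^^ k) v 0 \<le> p ^ (2 * k) * ((1 + 2 * \<epsilon>) ^ Suc k * (\<Sum>j=1..k. 1 + B * (\<epsilon> / real j)))"
proof -
  \<comment> \<open>Up to powers of \<open>p\<close>, \<open>?\<beta> k\<close> bounds the values at
    the origin of all iterates before the \<open>k\<close>-th; \<open>?b\<close> is the same
    expression with the last summand included.\<close>
  let ?\<beta> = "\<lambda>k. (1 + 2 * \<epsilon>) ^ k * (\<Sum>j=1..<k. 1 + B * (\<epsilon> / real j))"
  let ?b = "\<lambda>k. (1 + 2 * \<epsilon>) ^ k * (\<Sum>j=1..k. 1 + B * (\<epsilon> / real j))"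
  have v0: "0 \<le> v z" for z using B green_nonneg by (simp add: v_def)
  have Pv0: "0 \<le> (Pop ^^ k) v z" for k z
    by (induction k arbitrary: z) (simp_all add: v0 Pop_nonneg)
  have sj: "0 \<le> (\<Sum>j\<in>J. 1 + B * (\<epsilon> / real j))" for J using B eps by (intro sum_nonneg) auto
  have Pv: "(Pop ^^ k) v 0 \<le> 1 + B * (\<epsilon> / real k)" if "1 \<le> k" for k
  proof -
    have veq: "v = (\<lambda>z. (1 + B * green z) + (- (1 + B * green 0)) * ker0 z)"
      by (auto simp: v_def ker0_def fun_eq_iff)
    have "(Pop ^^ k) v z = (1 + B * (Pop ^^ k) green z) + (- (1 + B * green 0)) * ret k z" for z
    proof (induction k arbitrary: z)
      case 0 then show ?case by (subst veq) (simp add: ret_0 ker0_def)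
    next
      case (Suc k)
      have "(Pop ^^ Suc k) v z = Pop (\<lambda>z. (1 + B * (Pop ^^ k) green z) + (- (1 + B * green 0)) * ret k z) z"
        by (simp add: Suc.IH[abs_def])
      then show ?case by (simp only: Pop_add Pop_cmult Pop_const ret_Suc) simp
    qed
    then have "(Pop ^^ k) v 0 = 1 + B * (green 0 - (\<Sum>n<k. ret n 0)) - (1 + B * green 0) * ret k 0"
      by (simp add: Pop_pow_green algebra_simps)
    \<comment> \<open>Since \<open>green 0\<close> is at least 1, the mass removed at the origin
      supplies the missing term \<open>ret k 0\<close>, so that the tail estimate applies beyond
      \<open>k\<close>.\<close>
    also have "\<dots> \<le> 1 + B * (green 0 - (\<Sum>n<k. ret n 0)) - B * ret k 0"
    proof -
      have "1 \<le> green 0" using sum_ret_le_green[of "{0}" 0] by (simp add: ret_0)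
      then have "B * 1 * ret k 0 \<le> (1 + B * green 0) * ret k 0"
        using B ret_nonneg[of k 0] mult_left_mono[of 1 "green 0" B] by (intro mult_right_mono) auto
      then show ?thesis by simp
    qed
    also have "\<dots> = 1 + B * (green 0 - (\<Sum>n\<le>k. ret n 0))"
      by (simp add: algebra_simps lessThan_Suc_atMost[symmetric])
    also have "\<dots> \<le> 1 + B * (\<epsilon> / real k)"
      using green_tail[OF that, of 0] B by (intro add_left_mono mult_left_mono) auto
    finally show ?thesis .
  qed
  have b_le: "(Pop ^^ k) v 0 + ?\<beta> k * (\<Sum>n<k. ret n 0) \<le> ?b k * (if k = 0 then 1 else 1 + 2 * \<epsilon>)" for k
  proof (cases "k = 0")
    case False
    have 1: "1 \<le> (1 + 2 * \<epsilon>) ^ Suc k" using eps by (intro one_le_power) auto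
    have "(Pop ^^ k) v 0 + ?\<beta> k * (\<Sum>n<k. ret n 0) \<le> (1 + B * (\<epsilon> / real k)) * 1 + ?\<beta> k * (1 + 2 * \<epsilon>)"
      using Pv[of k] False sum_ret_0_le(1)[of k] eps
      by (intro add_mono mult_left_mono mult_nonneg_nonneg sj) auto
    also have "\<dots> \<le> (1 + B * (\<epsilon> / real k)) * (1 + 2 * \<epsilon>) ^ Suc k + ?\<beta> k * (1 + 2 * \<epsilon>)"
      using 1 B eps by (intro add_mono mult_left_mono order_refl add_nonneg_nonneg mult_nonneg_nonneg) auto
    also have "\<dots> = ?b k * (1 + 2 * \<epsilon>)"
    proof -
      define c where "c = 1 + B * (\<epsilon> / real k)"
      have "(\<Sum>j=1..k. 1 + B * (\<epsilon> / real j)) = (\<Sum>j=1..<k. 1 + B * (\<epsilon> / real j)) + c"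
        using False by (simp add: atLeastLessThanSuc_atLeastAtMost[symmetric] c_def)
      then show ?thesis unfolding c_def[symmetric] power_Suc by (simp only:) (simp only: ring_distribs mult_ac add_ac)
    qed
    finally show ?thesis using False by simp
  qed (simp add: v_def)
  \<comment> \<open>Variation of constants: the free evolution of \<open>v\<close>, plus everything
    emitted by the source at the origin, whose strength so far is at most
    \<open>?\<beta> k\<close>.\<close>
  have "(Qop p ^^ k) v z \<le> p ^ (2*k) * ((Pop ^^ k) v z + ?\<beta> k * (\<Sum>n<k. ret n z))" for z k
  proof (induction k arbitrary: z)
    case (Suc k)
    let ?h = "(Qop p ^^ k) v"
    have h0: "0 \<le> ?h z" for z using p by (intro Qop_pow_nonneg v0) auto
    have split: "(\<Sum>n<Suc k. ret n z) = ker0 z + (\<Sum>n<k. ret (Suc n) z)"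
      by (subst sum.lessThan_Suc_shift) (simp add: ret_0 ker0_def)
    have \<beta>Suc: "?\<beta> (Suc k) = ?b k * (1 + 2 * \<epsilon>)"
      by (simp add: atLeastLessThanSuc_atLeastAtMost mult_ac)
    have \<beta>_le: "?\<beta> k \<le> ?\<beta> (Suc k)"
    proof (rule mult_mono)
      show "(\<Sum>j=1..<k. 1 + B * (\<epsilon> / real j)) \<le> (\<Sum>j=1..<Suc k. 1 + B * (\<epsilon> / real j))"
        using B eps by (intro sum_mono2) auto
    qed (use eps sj in \<open>auto intro!: power_increasing\<close>)
    have P: "Pop ?h z \<le> p ^ (2*k) * ((Pop ^^ Suc k) v z + ?\<beta> k * (\<Sum>n<k. ret (Suc n) z))"
    proof -
      have "Pop ?h z \<le> Pop (\<lambda>z. p ^ (2*k) * ((Pop ^^ k) v z + ?\<beta> k * (\<Sum>n<k. ret n z))) z"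
        by (intro Pop_mono Suc.IH)
      then show ?thesis unfolding Pop_cmult Pop_add Pop_sum ret_Suc by simp
    qed
    have H: "?h 0 \<le> p ^ (2*k) * ?\<beta> (Suc k)"
    proof -
      have "?h 0 \<le> p ^ (2*k) * (?b k * (if k = 0 then 1 else 1 + 2 * \<epsilon>))"
        by (rule order_trans[OF Suc.IH mult_left_mono[OF b_le]]) (use p in simp)
      also have "\<dots> \<le> p ^ (2*k) * ?\<beta> (Suc k)"
        unfolding \<beta>Suc using p sj eps by (intro mult_left_mono) auto
      finally show ?thesis .
    qed
    have "(Qop p ^^ Suc k) v z \<le> p\<^sup>2 * (Pop ?h z + ker0 z * ?h 0)"
      using Qop_le[OF p h0] by simp
    also have "\<dots> \<le> p\<^sup>2 * (p ^ (2*k) * ((Pop ^^ Suc k) v z + ?\<beta> (Suc k) * (\<Sum>n<k. ret (Suc n) z)) + ker0 z * (p ^ (2*k) * ?\<beta> (Suc k)))"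
    proof (intro mult_left_mono add_mono H)
      have "Pop ?h z \<le> p ^ (2*k) * ((Pop ^^ Suc k) v z + ?\<beta> k * (\<Sum>n<k. ret (Suc n) z))" by (rule P)
      also have "\<dots> \<le> p ^ (2*k) * ((Pop ^^ Suc k) v z + ?\<beta> (Suc k) * (\<Sum>n<k. ret (Suc n) z))"
        using \<beta>_le p by (intro mult_left_mono add_left_mono mult_right_mono sum_nonneg ret_nonneg) auto
      finally show "Pop ?h z \<le> p ^ (2*k) * ((Pop ^^ Suc k) v z + ?\<beta> (Suc k) * (\<Sum>n<k. ret (Suc n) z))" .
    qed (auto simp: ker0_def)
    also have "\<dots> = p ^ (2 * Suc k) * ((Pop ^^ Suc k) v z + ?\<beta> (Suc k) * (\<Sum>n<Suc k. ret n z))"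
      unfolding split by (simp add: algebra_simps power2_eq_square)
    finally show ?case .
  qed (simp add: v_def)
  from this[of k 0] have "(Qop p ^^ k) v 0 \<le> p ^ (2*k) * (?b k * (if k = 0 then 1 else 1 + 2 * \<epsilon>))"
    by (rule order_trans[OF _ mult_left_mono[OF b_le]]) (use p in simp)
  also have "\<dots> \<le> p ^ (2*k) * (?b k * (1 + 2 * \<epsilon>))"
    using p sj eps by (intro mult_left_mono) auto
  finally show ?thesis by (simp add: mult_ac)
qed

end

section \<open>Product Bernoulli measures\<close>

definition bern :: "('i \<Rightarrow> real) \<Rightarrow> ('i \<Rightarrow> bool) measure" where
  "bern q = PiM UNIV (\<lambda>i. measure_pmf (bernoulli_pmf (q i)))"

text \<open>Local functions are described by their coordinates instead of by sub-sigma-algebras. The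
  expectation identities and inequalities below are inductions over the finite set, conditioning on
  one coordinate at a time by \<open>Ev_decouple\<close>.\<close>

definition depends_on :: "'i set \<Rightarrow> (('i \<Rightarrow> bool) \<Rightarrow> 'a) \<Rightarrow> bool" where
  "depends_on A g \<longleftrightarrow> (\<forall>X Y. (\<forall>e\<in>A. X e = Y e) \<longrightarrow> g X = g Y)"

lemma depends_onI: "(\<And>X Y. (\<And>e. e \<in> A \<Longrightarrow> X e = Y e) \<Longrightarrow> g X = g Y) \<Longrightarrow> depends_on A g"
  unfolding depends_on_def by blast

lemma depends_onD: "depends_on A g \<Longrightarrow> (\<And>e. e \<in> A \<Longrightarrow> X e = Y e) \<Longrightarrow> g X = g Y"
  unfolding depends_on_def by blast

lemma depends_on_upd:
  "depends_on (insert e A) g \<Longrightarrow> depends_on A (\<lambda>X. g (X(e := b)))"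
  unfolding depends_on_def by (simp add: fun_upd_def)

lemma depends_on_upd_irrel: "depends_on A g \<Longrightarrow> e \<notin> A \<Longrightarrow> g (X(e := b)) = g X"
  by (rule depends_onD) auto

lemma depends_on_empty: "depends_on {} g \<Longrightarrow> g X = g Y"
  by (rule depends_onD) auto

lemma depends_on_mono: "depends_on A g \<Longrightarrow> A \<subseteq> B \<Longrightarrow> depends_on B g"
  unfolding depends_on_def by blast

lemma depends_on_mult:
  "depends_on A g \<Longrightarrow> depends_on A h \<Longrightarrow> depends_on A (\<lambda>X. g X * h X)"
  unfolding depends_on_def by metis

interpretation bern: prob_space "bern q" for q
  unfolding bern_def by (intro prob_space_PiM measure_pmf.prob_space_axioms)

lemma space_bern [simp]: "space (bern q) = UNIV"
  by (simp add: bern_def space_PiM)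

lemma measurable_coord [measurable]: "(\<lambda>X. X e) \<in> measurable (bern q) (count_space UNIV)"
proof -
  have "(\<lambda>X. X e) \<in> measurable (bern q) (measure_pmf (bernoulli_pmf (q e)))"
    unfolding bern_def by (rule measurable_component_singleton) simp
  then show ?thesis by (simp add: measurable_cong_sets)
qed

lemma depends_on_measurable:
  fixes g :: "('i \<Rightarrow> bool) \<Rightarrow> real"
  assumes "finite A" "depends_on A g"
  shows "g \<in> borel_measurable (bern q)"
  using assms
proof (induction A arbitrary: g rule: finite_induct)
  case empty
  then have "g = (\<lambda>X. g (\<lambda>_. True))" using depends_on_empty by blast
  then show ?case by (metis borel_measurable_const)
next
  case (insert e A)
  have eq: "g = (\<lambda>X. if X e then g (X(e := True)) else g (X(e := False)))"
    by (auto simp: fun_upd_idem fun_eq_iff)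
  have [measurable]: "(\<lambda>X. g (X(e := b))) \<in> borel_measurable (bern q)" for b
    by (rule insert.IH) (rule depends_on_upd[OF insert.prems])
  show ?case by (subst eq) measurable
qed

lemma depends_on_bounded:
  fixes g :: "('i \<Rightarrow> bool) \<Rightarrow> real"
  assumes "finite A" "depends_on A g"
  shows "\<exists>B. \<forall>X. \<bar>g X\<bar> \<le> B"
  using assms
proof (induction A arbitrary: g rule: finite_induct)
  case empty
  then have "\<bar>g X\<bar> \<le> \<bar>g (\<lambda>_. True)\<bar>" for X using depends_on_empty[of g X "\<lambda>_. True"] by simp
  then show ?case by blast
next
  case (insert e A)
  obtain B1 where B1: "\<And>X. \<bar>g (X(e := True))\<bar> \<le> B1"
    using insert.IH[OF depends_on_upd[OF insert.prems, of True]] by blast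
  obtain B2 where B2: "\<And>X. \<bar>g (X(e := False))\<bar> \<le> B2"
    using insert.IH[OF depends_on_upd[OF insert.prems, of False]] by blast
  have "\<bar>g X\<bar> \<le> max B1 B2" for X
    using B1[of X] B2[of X] by (cases "X e") (auto simp: fun_upd_idem)
  then show ?case by blast
qed

lemma depends_on_integrable:
  fixes g :: "('i \<Rightarrow> bool) \<Rightarrow> real"
  assumes "finite A" "depends_on A g"
  shows "integrable (bern q) g"
proof -
  obtain B where "\<And>X. \<bar>g X\<bar> \<le> B" using depends_on_bounded[OF assms] by blast
  then show ?thesis
    by (intro bern.integrable_const_bound[of _ B] depends_on_measurable[OF assms]) auto
qed

abbreviation Ev :: "('i \<Rightarrow> real) \<Rightarrow> (('i \<Rightarrow> bool) \<Rightarrow> real) \<Rightarrow> real" where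
  "Ev q g \<equiv> integral\<^sup>L (bern q) g"

text \<open>The product measure is the law of coordinate \<open>e\<close> times the product over all
  other coordinates.\<close>

lemma Ev_decouple:
  assumes A: "finite A" "depends_on A g" and q: "0 \<le> q e" "q e \<le> 1"
  shows "Ev q g = q e * Ev q (\<lambda>X. g (X(e := True))) + (1 - q e) * Ev q (\<lambda>X. g (X(e := False)))"
proof -
  let ?M = "\<lambda>i. measure_pmf (bernoulli_pmf (q i))"
  let ?P = "PiM (UNIV - {e}) ?M"
  have gm: "h \<in> borel_measurable (bern q)" "\<exists>B. \<forall>X. \<bar>h X\<bar> \<le> B" if "depends_on (insert e A) h" for h :: "_ \<Rightarrow> real"
    using depends_on_measurable[of "insert e A"] depends_on_bounded[of "insert e A"] that A(1) by auto
  interpret P: prob_space ?P by (intro prob_space_PiM measure_pmf.prob_space_axioms)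
  interpret PP: pair_prob_space "?M e" ?P ..
  have eq: "bern q = distr (?M e \<Otimes>\<^sub>M ?P) (bern q) (\<lambda>(x, X). X(e := x))"
    unfolding bern_def
    using distr_pair_PiM_eq_PiM[of "UNIV - {e}" ?M e, symmetric]
    by (simp add: insert_absorb measure_pmf.prob_space_axioms insert_UNIV)
  have mp: "(\<lambda>(x, X). X(e := x)) \<in> measurable (?M e \<Otimes>\<^sub>M ?P) (bern q)"
    unfolding bern_def using measurable_pair_swap[OF measurable_add_dim[of e "UNIV - {e}" ?M]]
    by (simp add: insert_UNIV)
  have main: "Ev q h = q e * (\<integral>X. h (X(e := True)) \<partial>?P) + (1 - q e) * (\<integral>X. h (X(e := False)) \<partial>?P)"
    if h: "depends_on (insert e A) h" for h :: "_ \<Rightarrow> real"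
  proof -
    note m = gm(1)[OF h]
    obtain B where B: "\<And>X. \<bar>h X\<bar> \<le> B" using gm(2)[OF h] by blast
    have m2: "(\<lambda>(x, X). h (X(e := x))) \<in> borel_measurable (?M e \<Otimes>\<^sub>M ?P)"
      using measurable_comp[OF mp m] by (simp add: comp_def case_prod_beta')
    have i: "integrable (?M e \<Otimes>\<^sub>M ?P) (\<lambda>(x, X). h (X(e := x)))"
      by (rule PP.P.integrable_const_bound[of _ B]) (use B m2 in auto)
    have "Ev q h = (\<integral>z. h ((\<lambda>(x, X). X(e := x)) z) \<partial>(?M e \<Otimes>\<^sub>M ?P))"
      by (subst eq) (rule integral_distr[OF mp m])
    also have "\<dots> = (\<integral>x. \<integral>X. h (X(e := x)) \<partial>?P \<partial>?M e)"
      using PP.integral_fst[OF i] by (simp add: case_prod_beta')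
    finally show ?thesis using q by simp
  qed
  have "depends_on (insert e A) g" using A(2) by (rule depends_on_mono) auto
  have d: "depends_on (insert e A) (\<lambda>X. g (X(e := b)))" for b
    using depends_on_mono[OF depends_on_upd[OF \<open>depends_on (insert e A) g\<close>]] by blast
  \<comment> \<open>For a function with coordinate \<open>e\<close> frozen both branches of
    \<open>main\<close> agree, so its integral over the remaining coordinates equals its expectation
    under the full measure.\<close>
  show ?thesis
    using main[OF \<open>depends_on (insert e A) g\<close>] main[OF d[of True]] main[OF d[of False]]
    by (simp add: algebra_simps)
qed

lemma bern_prob_UNIV [simp]: "measure (bern q) UNIV = 1"
  using bern.prob_space[of q] by simp

lemma Ev_const [simp]: "Ev q (\<lambda>_. c) = c"
  by simp

lemma Ev_indep:
  fixes g h :: "('i \<Rightarrow> bool) \<Rightarrow> real"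
  assumes q: "\<And>e. 0 \<le> q e \<and> q e \<le> 1"
    and "finite A" "depends_on A g" "finite B" "depends_on B h" "A \<inter> B = {}"
  shows "Ev q (\<lambda>X. g X * h X) = Ev q g * Ev q h"
  using assms(2-)
proof (induction A arbitrary: g rule: finite_induct)
  case empty
  then have "g = (\<lambda>X. g (\<lambda>_. True))" using depends_on_empty by blast
  then obtain c where "g = (\<lambda>_. c)" by blast
  then show ?case by simp
next
  case (insert e A)
  have eB: "h (X(e := b)) = h X" for X b
    using insert.prems by (intro depends_on_upd_irrel[of B]) auto
  have d: "depends_on (insert e A \<union> B) (\<lambda>X. g X * h X)"
    by (intro depends_on_mult depends_on_mono[OF insert.prems(1)] depends_on_mono[OF insert.prems(3)]) auto
  have "Ev q (\<lambda>X. g X * h X) = q e * Ev q (\<lambda>X. g (X(e := True)) * h X) + (1 - q e) * Ev q (\<lambda>X. g (X(e := False)) * h X)"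
    using Ev_decouple[OF _ d, of q e] insert q by (simp add: eB)
  also have "\<dots> = q e * (Ev q (\<lambda>X. g (X(e := True))) * Ev q h) + (1 - q e) * (Ev q (\<lambda>X. g (X(e := False))) * Ev q h)"
    using insert.IH[OF depends_on_upd[OF insert.prems(1)] insert.prems(2,3)] insert.prems(4)
    by (simp del: fun_upd_apply)
  also have "\<dots> = Ev q g * Ev q h"
    using Ev_decouple[of "insert e A" g q e] insert.hyps(1) insert.prems(1) q[of e]
    by (simp add: distrib_right mult.assoc del: fun_upd_apply)
  finally show ?case .
qed

text \<open>Gives invariance under lattice translations. Shifts forward in time are injective but
  not onto, hence \<open>inj\<close> instead of a bijection.\<close>

lemma Ev_reindex:
  fixes g :: "('i \<Rightarrow> bool) \<Rightarrow> real"
  assumes q: "\<And>e. 0 \<le> q e \<and> q e \<le> 1" and T: "inj T" "\<And>e. q (T e) = q e"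
    and "finite A" "depends_on A g"
  shows "Ev q (\<lambda>X. g (\<lambda>e. X (T e))) = Ev q g"
  using assms(4-)
proof (induction A arbitrary: g rule: finite_induct)
  case empty
  then have "g = (\<lambda>X. g (\<lambda>_. True))" using depends_on_empty by blast
  then obtain c where "g = (\<lambda>_. c)" by blast
  then show ?case by simp
next
  case (insert e A)
  have d: "depends_on (T ` insert e A) (\<lambda>X. g (\<lambda>e. X (T e)))"
    using insert.prems by (fastforce simp: depends_on_def)
  have u: "(\<lambda>e'. (X(T e := b)) (T e')) = (\<lambda>e. X (T e))(e := b)" for X b
    using T(1) by (auto simp: fun_eq_iff inj_eq)
  have "Ev q (\<lambda>X. g (\<lambda>e. X (T e))) = q e * Ev q (\<lambda>X. g ((\<lambda>e. X (T e))(e := True))) + (1 - q e) * Ev q (\<lambda>X. g ((\<lambda>e. X (T e))(e := False)))"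
    using Ev_decouple[OF _ d, of q "T e"] insert.hyps q by (simp add: u T(2) del: fun_upd_apply)
  also have "\<dots> = Ev q g"
    using insert.IH[OF depends_on_upd[OF insert.prems(1), of True]] insert.IH[OF depends_on_upd[OF insert.prems(1), of False]]
      Ev_decouple[OF _ insert.prems(1), of q e] insert.hyps q by (simp del: fun_upd_apply)
  finally show ?case .
qed

section \<open>Harris inequality and a covariance bound\<close>

definition incr :: "(('i \<Rightarrow> bool) \<Rightarrow> real) \<Rightarrow> bool" where
  "incr g \<longleftrightarrow> (\<forall>e X. g (X(e := False)) \<le> g (X(e := True)))"

lemma incr_upd: "incr g \<Longrightarrow> incr (\<lambda>X. g (X(e := b)))"
proof -
  assume g: "incr g"
  have tw: "X(e' := b', e := b) = (if e' = e then X(e := b) else X(e := b, e' := b'))" for X :: "'a \<Rightarrow> bool" and e' b'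
    by (auto simp: fun_eq_iff)
  show ?thesis using g by (auto simp: incr_def tw)
qed

lemma Ev_mono_dep:
  assumes "finite A" "depends_on A g" "depends_on A h" "\<And>X. g X \<le> h X"
  shows "Ev q g \<le> Ev q h"
  using assms by (intro integral_mono depends_on_integrable) auto

text \<open>Conditioning on one coordinate splits a covariance into the average of the two
  conditional covariances and \<open>q e * (1 - q e)\<close> times the product of the two mean
  increments; all of these are nonnegative.\<close>

lemma Ev_harris:
  fixes g h :: "('i \<Rightarrow> bool) \<Rightarrow> real"
  assumes q: "\<And>e. 0 \<le> q e \<and> q e \<le> 1"
    and "finite A" "depends_on A g" "depends_on A h" "incr g" "incr h"
  shows "Ev q g * Ev q h \<le> Ev q (\<lambda>X. g X * h X)"
  using assms(2-)
proof (induction A arbitrary: g h rule: finite_induct)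
  case empty
  then have "g = (\<lambda>X. g (\<lambda>_. True))" using depends_on_empty by blast
  then obtain c where "g = (\<lambda>_. c)" by blast
  then show ?case by simp
next
  case (insert e A)
  have d: "depends_on (insert e A) (\<lambda>X. g X * h X)"
    by (intro depends_on_mult insert.prems)
  define g1 g0 h1 h0 where "g1 = Ev q (\<lambda>X. g (X(e := True)))" and "g0 = Ev q (\<lambda>X. g (X(e := False)))"
    and "h1 = Ev q (\<lambda>X. h (X(e := True)))" and "h0 = Ev q (\<lambda>X. h (X(e := False)))"
  note gd = depends_on_upd[OF insert.prems(1)] and hd = depends_on_upd[OF insert.prems(2)]
  have le: "g0 \<le> g1" "h0 \<le> h1" unfolding g0_def g1_def h0_def h1_def
    using insert.prems by (auto intro!: Ev_mono_dep[OF insert.hyps(1)] gd hd simp: incr_def)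
  have eg: "Ev q g = q e * g1 + (1 - q e) * g0" and eh: "Ev q h = q e * h1 + (1 - q e) * h0"
    unfolding g1_def g0_def h1_def h0_def
    using Ev_decouple[OF _ insert.prems(1), of q e] Ev_decouple[OF _ insert.prems(2), of q e] insert.hyps q
    by (simp_all del: fun_upd_apply)
  have "q e * (g1 * h1) + (1 - q e) * (g0 * h0)
      = Ev q g * Ev q h + q e * (1 - q e) * ((g1 - g0) * (h1 - h0))"
    unfolding eg eh by (simp add: algebra_simps)
  moreover have "0 \<le> q e * (1 - q e) * ((g1 - g0) * (h1 - h0))"
    using le q[of e] by simp
  moreover have "q e * (g1 * h1) + (1 - q e) * (g0 * h0) \<le> Ev q (\<lambda>X. g X * h X)"
    using Ev_decouple[OF _ d, of q e] insert.hyps q[of e]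
      insert.IH[OF gd[of True] hd[of True] incr_upd incr_upd, OF insert.prems(3,4)]
      insert.IH[OF gd[of False] hd[of False] incr_upd incr_upd, OF insert.prems(3,4)]
    unfolding g1_def g0_def h1_def h0_def
    by (simp add: add_mono mult_left_mono del: fun_upd_apply)
  ultimately show ?case by linarith
qed

text \<open>The increments \<open>G\<close>, \<open>H\<close> are kept as majorants
  because for path counts they factor at the edge \<open>e\<close>.\<close>

lemma Ev_cov_le:
  fixes g h :: "('i \<Rightarrow> bool) \<Rightarrow> real" and G H :: "'i \<Rightarrow> ('i \<Rightarrow> bool) \<Rightarrow> real"
  assumes q: "\<And>e. 0 \<le> q e \<and> q e \<le> 1"
    and "finite A" "depends_on A g" "depends_on A h"
    and "\<And>e. finite (B e)" "\<And>e. depends_on (B e) (G e)" "\<And>e. depends_on (B e) (H e)"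
    and "\<And>e. incr (G e)" "\<And>e. incr (H e)"
    and "\<And>e X. 0 \<le> g (X(e := True)) - g (X(e := False)) \<and> g (X(e := True)) - g (X(e := False)) \<le> G e X"
    and "\<And>e X. 0 \<le> h (X(e := True)) - h (X(e := False)) \<and> h (X(e := True)) - h (X(e := False)) \<le> H e X"
  shows "Ev q (\<lambda>X. g X * h X) \<le> Ev q g * Ev q h + (\<Sum>e\<in>A. q e * Ev q (\<lambda>X. G e X * H e X))"
  using assms(2-)
proof (induction A arbitrary: g h G H rule: finite_induct)
  case empty
  then have "g = (\<lambda>X. g (\<lambda>_. True))" using depends_on_empty by blast
  then obtain c where "g = (\<lambda>_. c)" by blast
  then show ?case by simp
next
  case (insert e A)
  have d: "depends_on (insert e A) (\<lambda>X. g X * h X)"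
    by (intro depends_on_mult insert.prems)
  have dGH: "depends_on (B e') (\<lambda>X. G e' X * H e' X)" for e'
    by (intro depends_on_mult insert.prems)
  have upd: "depends_on C (\<lambda>X. k (X(e := b)))" if "depends_on C k" for k :: "('i \<Rightarrow> bool) \<Rightarrow> real" and b C
    by (rule depends_on_upd, rule depends_on_mono[OF that]) auto
  define g1 g0 h1 h0 where "g1 = Ev q (\<lambda>X. g (X(e := True)))" and "g0 = Ev q (\<lambda>X. g (X(e := False)))"
    and "h1 = Ev q (\<lambda>X. h (X(e := True)))" and "h0 = Ev q (\<lambda>X. h (X(e := False)))"
  note gd = depends_on_upd[OF insert.prems(1)] and hd = depends_on_upd[OF insert.prems(2)]
  have ig: "integrable (bern q) (\<lambda>X. g (X(e := b)))" "integrable (bern q) (\<lambda>X. h (X(e := b)))" for b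
    by (rule depends_on_integrable[OF insert.hyps(1)], rule gd hd)+
  have "g1 - g0 = Ev q (\<lambda>X. g (X(e := True)) - g (X(e := False)))"
    unfolding g1_def g0_def by (rule Bochner_Integration.integral_diff[symmetric]) (rule ig)+
  then have g10: "0 \<le> g1 - g0" "g1 - g0 \<le> Ev q (G e)"
    using insert.prems(8)
    by (simp_all only:) (auto intro!: Bochner_Integration.integral_nonneg integral_mono ig Bochner_Integration.integrable_diff
        depends_on_integrable[OF insert.prems(3) insert.prems(4)] simp del: fun_upd_apply)
  have "h1 - h0 = Ev q (\<lambda>X. h (X(e := True)) - h (X(e := False)))"
    unfolding h1_def h0_def by (rule Bochner_Integration.integral_diff[symmetric]) (rule ig)+
  then have h10: "0 \<le> h1 - h0" "h1 - h0 \<le> Ev q (H e)"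
    using insert.prems(9)
    by (simp_all only:) (auto intro!: Bochner_Integration.integral_nonneg integral_mono ig Bochner_Integration.integrable_diff
        depends_on_integrable[OF insert.prems(3) insert.prems(5)] simp del: fun_upd_apply)
  have eg: "Ev q g = q e * g1 + (1 - q e) * g0" and eh: "Ev q h = q e * h1 + (1 - q e) * h0"
    unfolding g1_def g0_def h1_def h0_def
    using Ev_decouple[OF _ insert.prems(1), of q e] Ev_decouple[OF _ insert.prems(2), of q e] insert.hyps q
    by (simp_all del: fun_upd_apply)
  have step: "Ev q (\<lambda>X. g (X(e := b)) * h (X(e := b)))
    \<le> Ev q (\<lambda>X. g (X(e := b))) * Ev q (\<lambda>X. h (X(e := b)))
      + (\<Sum>e'\<in>A. q e' * Ev q (\<lambda>X. G e' (X(e := b)) * H e' (X(e := b))))" for b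
  proof (rule insert.IH[OF gd hd insert.prems(3)])
    show "depends_on (B e') (\<lambda>X. G e' (X(e := b)))" "depends_on (B e') (\<lambda>X. H e' (X(e := b)))" for e'
      by (rule upd, rule insert.prems)+
    show "incr (\<lambda>X. G e' (X(e := b)))" "incr (\<lambda>X. H e' (X(e := b)))" for e'
      by (rule incr_upd, rule insert.prems)+
    have tw: "X(e' := b', e := b) = (if e' = e then X(e := b) else X(e := b, e' := b'))" for X :: "'i \<Rightarrow> bool" and e' b'
      by (auto simp: fun_eq_iff)
    fix e' X
    have G0: "0 \<le> G e' Y" "0 \<le> H e' Y" for e' Y
      using order_trans insert.prems(8,9) by metis+
    show "0 \<le> g (X(e' := True, e := b)) - g (X(e' := False, e := b)) \<and>
      g (X(e' := True, e := b)) - g (X(e' := False, e := b)) \<le> G e' (X(e := b))"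
      using insert.prems(8)[of "X(e := b)" e'] G0 by (simp add: tw del: fun_upd_apply)
    show "0 \<le> h (X(e' := True, e := b)) - h (X(e' := False, e := b)) \<and>
      h (X(e' := True, e := b)) - h (X(e' := False, e := b)) \<le> H e' (X(e := b))"
      using insert.prems(9)[of "X(e := b)" e'] G0 by (simp add: tw del: fun_upd_apply)
  qed
  \<comment> \<open>Averaging separates the two increments; the Harris inequality puts their
    majorants back under one expectation, which is why these are assumed increasing.\<close>
  have "(g1 - g0) * (h1 - h0) \<le> Ev q (G e) * Ev q (H e)"
    using g10 h10 by (intro mult_mono) auto
  also have "\<dots> \<le> Ev q (\<lambda>X. G e X * H e X)"
    by (rule Ev_harris[OF q insert.prems(3)]) (rule insert.prems)+
  finally have gh: "(g1 - g0) * (h1 - h0) \<le> Ev q (\<lambda>X. G e X * H e X)" .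
  moreover have "0 \<le> (g1 - g0) * (h1 - h0)" using g10 h10 by simp
  ultimately have gh': "q e * (1 - q e) * ((g1 - g0) * (h1 - h0)) \<le> q e * Ev q (\<lambda>X. G e X * H e X)"
    using q[of e] by (simp add: mult.assoc mult_left_mono mult_left_le_one_le order_trans[OF _ gh])
  have GH: "Ev q (\<lambda>X. G e' X * H e' X) = q e * Ev q (\<lambda>X. G e' (X(e := True)) * H e' (X(e := True)))
      + (1 - q e) * Ev q (\<lambda>X. G e' (X(e := False)) * H e' (X(e := False)))" for e'
    using Ev_decouple[OF insert.prems(3) dGH, of q e] q by auto
  have "Ev q (\<lambda>X. g X * h X) = q e * Ev q (\<lambda>X. g (X(e := True)) * h (X(e := True)))
      + (1 - q e) * Ev q (\<lambda>X. g (X(e := False)) * h (X(e := False)))"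
    using Ev_decouple[OF _ d, of q e] insert.hyps q[of e] by auto
  also have "\<dots> \<le> q e * (g1 * h1 + (\<Sum>e'\<in>A. q e' * Ev q (\<lambda>X. G e' (X(e := True)) * H e' (X(e := True)))))
      + (1 - q e) * (g0 * h0 + (\<Sum>e'\<in>A. q e' * Ev q (\<lambda>X. G e' (X(e := False)) * H e' (X(e := False)))))"
    using step[of True] step[of False] q[of e] unfolding g1_def g0_def h1_def h0_def
    by (intro add_mono mult_left_mono) auto
  also have "\<dots> = q e * (g1 * h1) + (1 - q e) * (g0 * h0) + (\<Sum>e'\<in>A. q e' * Ev q (\<lambda>X. G e' X * H e' X))"
    unfolding GH by (simp add: algebra_simps sum.distrib sum_distrib_left sum_subtractf)
  also have "q e * (g1 * h1) + (1 - q e) * (g0 * h0)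
      = Ev q g * Ev q h + q e * (1 - q e) * ((g1 - g0) * (h1 - h0))"
    unfolding eg eh by (simp add: algebra_simps)
  finally show ?case using gh' insert.hyps by simp
qed

lemma sum_swap4:
  "(\<Sum>y\<in>Y. \<Sum>y'\<in>Y'. \<Sum>s\<in>S. \<Sum>s'\<in>S'. F y y' s s') = (\<Sum>s\<in>S. \<Sum>s'\<in>S'. \<Sum>y\<in>Y. \<Sum>y'\<in>Y'. F y y' s s')"
  by (simp only: sum.swap[of _ S Y'] sum.swap[of _ S Y] sum.swap[of _ S' Y'] sum.swap[of _ S' Y])

lemma sum_offdiag:
  fixes x y :: "'i \<Rightarrow> real"
  assumes "finite S"
  shows "(\<Sum>s\<in>S. \<Sum>t\<in>S. if s = t then 0 else x s * y t) = sum x S * sum y S - (\<Sum>s\<in>S. x s * y s)"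
proof -
  have "(\<Sum>t\<in>S. if s = t then 0 else x s * y t) = x s * sum y S - x s * y s" if "s \<in> S" for s
  proof -
    have "(\<Sum>t\<in>S. if s = t then 0 else x s * y t) = (\<Sum>t\<in>S - {s}. x s * y t)"
      using assms by (intro sum.mono_neutral_cong_right) auto
    then show ?thesis using sum.remove[OF assms that, of y] by (simp add: sum_distrib_left[symmetric] algebra_simps)
  qed
  then show ?thesis by (simp add: sum_subtractf sum_distrib_right)
qed

section \<open>Open paths\<close>

text \<open>At a number of paths, \<open>fall2\<close> and \<open>fall3\<close> count the ordered
  pairs and triples of distinct paths, so their expectations are factorial moments.\<close>

definition fall2 :: "real \<Rightarrow> real" where "fall2 z = z * (z - 1)"
definition fall3 :: "real \<Rightarrow> real" where "fall3 z = z * (z - 1) * (z - 2)"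

lemma fall2_sum:
  fixes g :: "'i \<Rightarrow> real"
  assumes "finite S"
  shows "fall2 (sum g S) = (\<Sum>s\<in>S. fall2 (g s)) + (\<Sum>s\<in>S. \<Sum>t\<in>S. if s = t then 0 else g s * g t)"
  by (simp add: sum_offdiag[OF assms] fall2_def algebra_simps sum_subtractf)

text \<open>Ordered triples of distinct objects in a disjoint union: all in one class, two in one
  class with three choices for the odd one out, or in three different classes.\<close>

lemma fall3_sum:
  fixes g :: "'i \<Rightarrow> real"
  assumes "finite S"
  shows "fall3 (sum g S) = (\<Sum>s\<in>S. fall3 (g s)) + 3 * (\<Sum>s\<in>S. \<Sum>t\<in>S. if s = t then 0 else fall2 (g s) * g t)
    + (\<Sum>s\<in>S. \<Sum>t\<in>S. if s = t then 0 else g s * g t * (\<Sum>r\<in>S. if r = s \<or> r = t then 0 else g r))"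
proof -
  let ?a = "sum g S" and ?G2 = "\<Sum>s\<in>S. (g s)\<^sup>2" and ?G3 = "\<Sum>s\<in>S. (g s) ^ 3"
  have r: "(\<Sum>r\<in>S. if r = s \<or> r = t then 0 else g r) = ?a - g s - g t" if "s \<in> S" "t \<in> S" "s \<noteq> t" for s t
  proof -
    have "(\<Sum>r\<in>S. if r = s \<or> r = t then 0 else g r) = (\<Sum>r\<in>S - {s} - {t}. g r)"
      using assms by (intro sum.mono_neutral_cong_right) auto
    then show ?thesis using that assms by (simp add: sum_diff1)
  qed
  have "(\<Sum>s\<in>S. \<Sum>t\<in>S. if s = t then 0 else g s * g t * (\<Sum>r\<in>S. if r = s \<or> r = t then 0 else g r))
     = (\<Sum>s\<in>S. \<Sum>t\<in>S. ?a * (if s = t then 0 else g s * g t) - (if s = t then 0 else (g s)\<^sup>2 * g t) - (if s = t then 0 else g s * (g t)\<^sup>2))"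
    by (intro sum.cong refl) (auto simp: r algebra_simps power2_eq_square)
  also have "\<dots> = ?a * (?a * ?a - ?G2) - (?G2 * ?a - ?G3) - (?a * ?G2 - ?G3)"
    by (simp add: sum_subtractf sum_distrib_left[symmetric] sum_offdiag[OF assms] power2_eq_square power3_eq_cube mult.assoc)
  finally have 1: "(\<Sum>s\<in>S. \<Sum>t\<in>S. if s = t then 0 else g s * g t * (\<Sum>r\<in>S. if r = s \<or> r = t then 0 else g r))
     = ?a * (?a * ?a - ?G2) - (?G2 * ?a - ?G3) - (?a * ?G2 - ?G3)" .
  have "(\<Sum>s\<in>S. fall3 (g s)) = (\<Sum>s\<in>S. (g s) ^ 3 - 3 * (g s)\<^sup>2 + 2 * g s)"
    by (simp add: fall3_def algebra_simps power2_eq_square power3_eq_cube)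
  then have 2: "(\<Sum>s\<in>S. fall3 (g s)) = ?G3 - 3 * ?G2 + 2 * ?a"
    by (simp add: sum.distrib sum_subtractf sum_distrib_left)
  have "(\<Sum>s\<in>S. fall2 (g s)) = (\<Sum>s\<in>S. (g s)\<^sup>2 - g s)"
    by (simp add: fall2_def algebra_simps power2_eq_square)
  then have 3: "(\<Sum>s\<in>S. fall2 (g s)) = ?G2 - ?a" by (simp add: sum_subtractf)
  have "(\<Sum>s\<in>S. fall2 (g s) * g s) = (\<Sum>s\<in>S. (g s) ^ 3 - (g s)\<^sup>2)"
    by (simp add: fall2_def algebra_simps power2_eq_square power3_eq_cube)
  then have 4: "(\<Sum>s\<in>S. fall2 (g s) * g s) = ?G3 - ?G2" by (simp add: sum_subtractf)
  show ?thesis unfolding 1 2 sum_offdiag[OF assms] 3 4 by (simp add: fall3_def algebra_simps)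
qed

text \<open>Levels are recorded because functions of adjacent time slabs are independent
  (\<open>E_mult\<close>); this is the Markov property behind all first-step recursions.\<close>

definition cyl :: "nat \<Rightarrow> nat \<Rightarrow> ('d::finite config \<Rightarrow> 'a) \<Rightarrow> bool" where
  "cyl a b g \<longleftrightarrow> (\<exists>A. finite A \<and> (\<forall>e\<in>A. a \<le> fst e \<and> fst e < b) \<and> depends_on A g)"

lemma cyl_const [intro, simp]: "cyl a b (\<lambda>_. c)"
  unfolding cyl_def depends_on_def by (rule exI[of _ "{}"]) auto

lemma cyl_comp: "cyl a b g \<Longrightarrow> cyl a b (\<lambda>X. F (g X))"
  unfolding cyl_def depends_on_def by metis

lemma cyl_comp2: "cyl a b g \<Longrightarrow> cyl a b h \<Longrightarrow> cyl a b (\<lambda>X. F (g X) (h X))"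
proof -
  assume "cyl a b g" "cyl a b h"
  then obtain A B where "finite A" "\<forall>e\<in>A. a \<le> fst e \<and> fst e < b" "depends_on A g"
    "finite B" "\<forall>e\<in>B. a \<le> fst e \<and> fst e < b" "depends_on B h" unfolding cyl_def by blast
  then show ?thesis unfolding cyl_def depends_on_def
    by (intro exI[of _ "A \<union> B"]) (metis UnCI UnE finite_UnI)
qed

lemma cyl_mult [intro]: "cyl a b g \<Longrightarrow> cyl a b h \<Longrightarrow> cyl a b (\<lambda>X. g X * h X :: real)"
  by (rule cyl_comp2)

lemma cyl_add [intro]: "cyl a b g \<Longrightarrow> cyl a b h \<Longrightarrow> cyl a b (\<lambda>X. g X + h X :: real)"
  by (rule cyl_comp2)

lemma cyl_sum [intro]: "(\<And>i. i \<in> I \<Longrightarrow> cyl a b (g i)) \<Longrightarrow> cyl a b (\<lambda>X. \<Sum>i\<in>I. g i X :: real)"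
  by (induction I rule: infinite_finite_induct) (auto intro: cyl_add)

lemma cyl_mono: "cyl a b g \<Longrightarrow> a' \<le> a \<Longrightarrow> b \<le> b' \<Longrightarrow> cyl a' b' g"
  unfolding cyl_def by (meson order_trans less_le_trans)

lemma cyl_bit: "cyl n (Suc n) (\<lambda>X. F (X (n, x, y)))"
  unfolding cyl_def depends_on_def by (rule exI[of _ "{(n, x, y)}"]) auto

lemma cyl_integrable [intro]: "cyl a b g \<Longrightarrow> integrable (bern q) (g :: _ \<Rightarrow> real)"
  unfolding cyl_def using depends_on_integrable by blast

lemma cyl_measurable: "cyl a b g \<Longrightarrow> (g :: _ \<Rightarrow> real) \<in> borel_measurable (bern q)"
  by (rule borel_measurable_integrable) (rule cyl_integrable)

lemma Ev_sum:
  "(\<And>i. i \<in> I \<Longrightarrow> cyl a b (g i)) \<Longrightarrow> Ev q (\<lambda>X. \<Sum>i\<in>I. g i X) = (\<Sum>i\<in>I. Ev q (g i))"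
  by (intro Bochner_Integration.integral_sum cyl_integrable)

lemma Ev_add: "cyl a b g \<Longrightarrow> cyl c d h \<Longrightarrow> Ev q (\<lambda>X. g X + h X) = Ev q g + Ev q h"
  by (intro Bochner_Integration.integral_add cyl_integrable)

lemma Ev_diff: "cyl a b g \<Longrightarrow> cyl c d h \<Longrightarrow> Ev q (\<lambda>X. g X - h X) = Ev q g - Ev q h"
  by (intro Bochner_Integration.integral_diff cyl_integrable)

lemma Ev_mono: "cyl a b g \<Longrightarrow> cyl c d h \<Longrightarrow> (\<And>X. g X \<le> h X) \<Longrightarrow> Ev q g \<le> Ev q h"
  by (intro integral_mono cyl_integrable)

lemma Ev_nonneg: "(\<And>X. 0 \<le> g X) \<Longrightarrow> 0 \<le> Ev q g"
  by (intro Bochner_Integration.integral_nonneg)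

lemma Nats_sum: "(\<And>i. i \<in> I \<Longrightarrow> g i \<in> \<nat>) \<Longrightarrow> (\<Sum>i\<in>I. g i :: real) \<in> \<nat>"
  by (induction I rule: infinite_finite_induct) auto

locale percolation_kernel = kernel f R for f :: "(int ^ 'd::finite) \<Rightarrow> real" and R +
  fixes p :: real
  assumes p_nonneg: "0 \<le> p" and pf_le: "\<And>s. p * f s \<le> 1"
begin

definition pe :: "nat \<times> (int ^ 'd) \<times> (int ^ 'd) \<Rightarrow> real" where
  "pe = (\<lambda>(n, x, y). p * f (y - x))"

lemma pe: "0 \<le> pe e \<and> pe e \<le> 1"
  using p_nonneg pf_le f_nonneg by (auto simp: pe_def split: prod.splits)

abbreviation E :: "('d config \<Rightarrow> real) \<Rightarrow> real" where "E \<equiv> Ev pe"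

lemma E_mult: "cyl a b g \<Longrightarrow> cyl b c h \<Longrightarrow> E (\<lambda>X. g X * h X) = E g * E h"
proof -
  assume "cyl a b g" "cyl b c h"
  then obtain A B where "finite A" "\<forall>e\<in>A. a \<le> fst e \<and> fst e < b" "depends_on A g"
    "finite B" "\<forall>e\<in>B. b \<le> fst e \<and> fst e < c" "depends_on B h" unfolding cyl_def by blast
  then show ?thesis by (intro Ev_indep[OF pe, of A g B h]) force+
qed

definition bit :: "nat \<Rightarrow> (int ^ 'd) \<Rightarrow> (int ^ 'd) \<Rightarrow> 'd config \<Rightarrow> real" where
  "bit n x s X = of_bool (X (n, x, x + s))"

lemma bit_01: "bit n x s X = 0 \<or> bit n x s X = 1" by (simp add: bit_def)
lemma bit_idem: "bit n x s X * bit n x s X = bit n x s X" by (simp add: bit_def)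
lemma bit_nonneg: "0 \<le> bit n x s X" by (simp add: bit_def)
lemma cyl_bit': "cyl n (Suc n) (bit n x s)" unfolding bit_def[abs_def] by (rule cyl_bit)

lemma bit_dep: "depends_on {(n, x, x + s)} (bit n x s)"
  by (rule depends_onI) (simp add: bit_def)

lemma E_bit: "E (bit n x s) = p * f s"
proof -
  have "E (bit n x s) = pe (n, x, x + s) * E (\<lambda>X. bit n x s (X((n, x, x + s) := True)))
      + (1 - pe (n, x, x + s)) * E (\<lambda>X. bit n x s (X((n, x, x + s) := False)))"
    by (rule Ev_decouple[OF _ bit_dep]) (use pe in auto)
  then show ?thesis by (simp add: bit_def pe_def)
qed

lemma E_bit2:
  "E (\<lambda>X. bit n x s X * bit n x' s' X) = (if x = x' \<and> s = s' then p * f s else p\<^sup>2 * f s * f s')"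
proof (cases "x = x' \<and> s = s'")
  case True then show ?thesis using E_bit by (simp add: bit_idem)
next
  case False
  then have "{(n, x, x + s)} \<inter> {(n, x', x' + s')} = {}" by auto
  then have "E (\<lambda>X. bit n x s X * bit n x' s' X) = E (bit n x s) * E (bit n x' s')"
    by (intro Ev_indep[OF pe _ bit_dep _ bit_dep]) auto
  then show ?thesis unfolding E_bit using False by (auto simp: power2_eq_square)
qed

lemma E_bit3:
  assumes "(x1, s1) \<noteq> (x2, s2)" "(x1, s1) \<noteq> (x3, s3)" "(x2, s2) \<noteq> (x3, s3)"
  shows "E (\<lambda>X. bit n x1 s1 X * (bit n x2 s2 X * bit n x3 s3 X)) = p ^ 3 * (f s1 * (f s2 * f s3))"
proof -
  have "E (\<lambda>X. bit n x1 s1 X * (bit n x2 s2 X * bit n x3 s3 X)) = E (bit n x1 s1) * E (\<lambda>X. bit n x2 s2 X * bit n x3 s3 X)"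
    by (rule Ev_indep[OF pe _ bit_dep, where B = "{(n, x2, x2 + s2), (n, x3, x3 + s3)}"])
      (use assms in \<open>auto intro!: depends_on_mult intro: depends_on_mono[OF bit_dep]\<close>)
  moreover have "\<not> (x2 = x3 \<and> s2 = s3)" using assms(3) by simp
  ultimately show ?thesis unfolding E_bit E_bit2 by (simp only: if_False) (simp add: power2_eq_square power3_eq_cube mult_ac)
qed

text \<open>The sum of \<open>\<phi>\<close> over the endpoints of the open
  \<open>k\<close>-step paths from \<open>(n, x)\<close>. Recursion on the first
  step avoids sets of paths.\<close>

primrec path_sum :: "nat \<Rightarrow> ((int ^ 'd) \<Rightarrow> real) \<Rightarrow> nat \<Rightarrow> (int ^ 'd) \<Rightarrow> 'd config \<Rightarrow> real" where
  "path_sum 0 \<phi> n x X = \<phi> x"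
| "path_sum (Suc k) \<phi> n x X = (\<Sum>s\<in>R. bit n x s X * path_sum k \<phi> (Suc n) (x + s) X)"

definition npaths :: "nat \<Rightarrow> nat \<Rightarrow> (int ^ 'd) \<Rightarrow> (int ^ 'd) \<Rightarrow> 'd config \<Rightarrow> real" where
  "npaths k n x y = path_sum k (\<lambda>v. of_bool (v = y)) n x"

lemma npaths_0: "npaths 0 n x y X = of_bool (x = y)" by (simp add: npaths_def)
lemma npaths_Suc: "npaths (Suc k) n x y X = (\<Sum>s\<in>R. bit n x s X * npaths k (Suc n) (x + s) y X)"
  by (simp add: npaths_def)

lemma cyl_path_sum: "cyl n (n + k) (path_sum k \<phi> n x)"
proof (induction k arbitrary: n x)
  case (Suc k)
  have "cyl n (n + Suc k) (path_sum k \<phi> (Suc n) (x + s))" for s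
    by (rule cyl_mono[OF Suc]) auto
  moreover have "cyl n (n + Suc k) (bit n x s)" for s by (rule cyl_mono[OF cyl_bit']) auto
  ultimately have "cyl n (n + Suc k) (\<lambda>X. \<Sum>s\<in>R. bit n x s X * path_sum k \<phi> (Suc n) (x + s) X)"
    by (intro cyl_sum cyl_mult)
  then show ?case by (subst path_sum.simps(2)[abs_def])
next
  case 0
  have "path_sum 0 \<phi> n x = (\<lambda>X. \<phi> x)" by (simp add: fun_eq_iff)
  then show ?case by simp
qed

lemma cyl_npaths: "cyl n (n + k) (npaths k n x y)" unfolding npaths_def by (rule cyl_path_sum)

lemma path_sum_nonneg: "(\<And>y. 0 \<le> \<phi> y) \<Longrightarrow> 0 \<le> path_sum k \<phi> n x X"
  by (induction k arbitrary: n x) (auto intro!: sum_nonneg mult_nonneg_nonneg bit_nonneg)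

lemma npaths_nonneg: "0 \<le> npaths k n x y X" unfolding npaths_def by (rule path_sum_nonneg) simp

lemma path_sum_Nats: "(\<And>y. \<phi> y \<in> \<nat>) \<Longrightarrow> path_sum k \<phi> n x X \<in> \<nat>"
proof (induction k arbitrary: n x)
  case (Suc k)
  show ?case unfolding path_sum.simps by (intro Nats_sum Nats_mult Suc) (use bit_01[of n x _ X] in \<open>metis Nats_0 Nats_1\<close>)
qed simp

lemma npaths_Nats: "npaths k n x y X \<in> \<nat>" unfolding npaths_def by (rule path_sum_Nats) simp

fun reach :: "nat \<Rightarrow> (int ^ 'd) \<Rightarrow> (int ^ 'd) set" where
  "reach 0 x = {x}"
| "reach (Suc k) x = (\<Union>s\<in>R. reach k (x + s))"

lemma finite_reach: "finite (reach k x)"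
  by (induction k arbitrary: x) (auto simp: finite_R)

lemma reach_shift: "reach k (x + v) = (\<lambda>u. u + v) ` reach k x"
proof (induction k arbitrary: x)
  case (Suc k)
  have "reach k (x + v + s) = (\<lambda>u. u + v) ` reach k (x + s)" for s
    using Suc[of "x + s"] by (simp add: add_ac)
  then show ?case by (simp add: image_UN)
qed simp

lemma npaths_outside: "y \<notin> reach k x \<Longrightarrow> npaths k n x y X = 0"
  by (induction k arbitrary: n x) (auto simp: npaths_0 npaths_Suc intro!: sum.neutral)

lemma path_sum_sum: "finite Y \<Longrightarrow> reach k x \<subseteq> Y \<Longrightarrow> path_sum k \<phi> n x X = (\<Sum>y\<in>Y. npaths k n x y X * \<phi> y)"
proof (induction k arbitrary: n x)
  case 0 then show ?case by (simp add: npaths_0 if_distrib[of "\<lambda>x. x * _"] of_bool_def cong: if_cong)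
next
  case (Suc k)
  have "path_sum (Suc k) \<phi> n x X = (\<Sum>s\<in>R. bit n x s X * (\<Sum>y\<in>Y. npaths k (Suc n) (x + s) y X * \<phi> y))"
    unfolding path_sum.simps by (intro sum.cong refl arg_cong2[of _ _ _ _ "(*)"] Suc.IH) (use Suc.prems in auto)
  also have "\<dots> = (\<Sum>y\<in>Y. npaths (Suc k) n x y X * \<phi> y)"
    unfolding npaths_Suc sum_distrib_left sum_distrib_right by (subst sum.swap) (simp add: mult_ac)
  finally show ?case .
qed

lemma path_sum_add: "path_sum (j + k) \<phi> n x X = path_sum j (\<lambda>v. path_sum k \<phi> (n + j) v X) n x X"
  by (induction j arbitrary: n x) simp_all

lemma E_step2:
  assumes "\<And>s. cyl (Suc n) c (A s)" "\<And>s. cyl (Suc n) c (B s)"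
  shows "E (\<lambda>X. (\<Sum>s\<in>R. bit n x s X * A s X) * (\<Sum>t\<in>R. bit n x' t X * B t X))
    = (\<Sum>s\<in>R. \<Sum>t\<in>R. (if x = x' \<and> s = t then p * f s else p\<^sup>2 * f s * f t) * E (\<lambda>X. A s X * B t X))"
proof -
  have c: "cyl n (Suc n) (\<lambda>X. bit n x s X * bit n x' t X)" "cyl (Suc n) c (\<lambda>X. A s X * B t X)" for s t
    using assms cyl_bit' by auto
  have cc: "cyl n (max (Suc n) c) (\<lambda>X. (bit n x s X * bit n x' t X) * (A s X * B t X))" for s t
    by (intro cyl_mult[OF cyl_mono[OF c(1)] cyl_mono[OF c(2)]]) auto
  have "E (\<lambda>X. (\<Sum>s\<in>R. bit n x s X * A s X) * (\<Sum>t\<in>R. bit n x' t X * B t X))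
     = E (\<lambda>X. \<Sum>s\<in>R. \<Sum>t\<in>R. (bit n x s X * bit n x' t X) * (A s X * B t X))"
    by (simp add: sum_product mult_ac)
  also have "\<dots> = (\<Sum>s\<in>R. \<Sum>t\<in>R. E (\<lambda>X. (bit n x s X * bit n x' t X) * (A s X * B t X)))"
    by (simp add: Ev_sum[of R n "max (Suc n) c"] cyl_sum cc)
  also have "\<dots> = (\<Sum>s\<in>R. \<Sum>t\<in>R. (if x = x' \<and> s = t then p * f s else p\<^sup>2 * f s * f t) * E (\<lambda>X. A s X * B t X))"
    by (simp add: E_mult[OF c] E_bit2)
  finally show ?thesis .
qed

lemma E_npaths_step2:
  "E (\<lambda>X. npaths (Suc k) n x y X * npaths (Suc k) n x' y' X)
    = (\<Sum>s\<in>R. \<Sum>t\<in>R. (if x = x' \<and> s = t then p * f s else p\<^sup>2 * f s * f t)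
        * E (\<lambda>X. npaths k (Suc n) (x + s) y X * npaths k (Suc n) (x' + t) y' X))"
  unfolding npaths_Suc by (rule E_step2[of n "Suc n + k"]) (rule cyl_npaths)+

lemma E_npaths_step1:
  "E (npaths (Suc k) n x y) = (\<Sum>s\<in>R. p * f s * E (npaths k (Suc n) (x + s) y))"
proof -
  have c: "cyl n (n + Suc k) (\<lambda>X. bit n x s X * npaths k (Suc n) (x + s) y X)" for s
    by (intro cyl_mult cyl_mono[OF cyl_bit'] cyl_mono[OF cyl_npaths]) auto
  have "E (npaths (Suc k) n x y) = (\<Sum>s\<in>R. E (\<lambda>X. bit n x s X * npaths k (Suc n) (x + s) y X))"
    unfolding npaths_Suc[abs_def] by (rule Ev_sum[OF c])
  also have "\<dots> = (\<Sum>s\<in>R. p * f s * E (npaths k (Suc n) (x + s) y))"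
    by (simp add: E_mult[OF cyl_bit' cyl_npaths] E_bit)
  finally show ?thesis .
qed

text \<open>The \<open>k\<close>-fold convolution power of \<open>f\<close>, that is, the law of the
  free walk after \<open>k\<close> steps.\<close>

fun fpow :: "nat \<Rightarrow> (int ^ 'd) \<Rightarrow> real" where
  "fpow 0 u = of_bool (u = 0)"
| "fpow (Suc k) u = (\<Sum>s\<in>R. f s * fpow k (u - s))"

lemma fpow_nonneg: "0 \<le> fpow k u"
  by (induction k arbitrary: u) (auto intro!: sum_nonneg mult_nonneg_nonneg f_nonneg)

lemma E_npaths: "E (npaths k n x y) = p ^ k * fpow k (y - x)"
proof (induction k arbitrary: n x)
  case 0 then show ?case by (simp add: npaths_0[abs_def])
next
  case (Suc k)
  then show ?case unfolding E_npaths_step1 by (simp add: sum_distrib_left mult_ac diff_diff_eq)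
qed

text \<open>First-step analysis. Only the difference of the starting points matters, and two paths
  at one vertex that choose the same edge need it open once; this is exactly
  \<open>Qop\<close>.\<close>

lemma E_pair:
  assumes "finite Y" "finite Y'" "reach k x \<subseteq> Y" "reach k x' \<subseteq> Y'"
  shows "(\<Sum>y\<in>Y. \<Sum>y'\<in>Y'. E (\<lambda>X. npaths k n x y X * npaths k n x' y' X) * h (y - y')) = (Qop p ^^ k) h (x - x')"
  using assms(3,4)
proof (induction k arbitrary: n x x')
  case 0
  have "(\<Sum>y\<in>Y. \<Sum>y'\<in>Y'. E (\<lambda>X. npaths 0 n x y X * npaths 0 n x' y' X) * h (y - y'))
      = (\<Sum>y\<in>Y. \<Sum>y'\<in>Y'. if y' = x' then (if y = x then h (y - y') else 0) else 0)"
    by (intro sum.cong refl) (auto simp: npaths_0)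
  also have "\<dots> = h (x - x')" using 0 assms(1,2) by (simp add: sum.delta)
  finally show ?case by simp
next
  case (Suc k)
  let ?c = "\<lambda>s t. if x = x' \<and> s = t then p * f s else p\<^sup>2 * f s * f t"
  let ?h = "(Qop p ^^ k) h"
  have "(\<Sum>y\<in>Y. \<Sum>y'\<in>Y'. E (\<lambda>X. npaths (Suc k) n x y X * npaths (Suc k) n x' y' X) * h (y - y'))
    = (\<Sum>s\<in>R. \<Sum>t\<in>R. \<Sum>y\<in>Y. \<Sum>y'\<in>Y'. ?c s t * (E (\<lambda>X. npaths k (Suc n) (x + s) y X * npaths k (Suc n) (x' + t) y' X) * h (y - y')))"
    unfolding E_npaths_step2 sum_distrib_right by (subst sum_swap4) (simp add: mult_ac)
  also have "\<dots> = (\<Sum>s\<in>R. \<Sum>t\<in>R. ?c s t * ?h (x + s - (x' + t)))"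
  proof (intro sum.cong refl)
    fix s t assume "s \<in> R" "t \<in> R"
    then have "(\<Sum>y\<in>Y. \<Sum>y'\<in>Y'. E (\<lambda>X. npaths k (Suc n) (x + s) y X * npaths k (Suc n) (x' + t) y' X) * h (y - y')) = ?h (x + s - (x' + t))"
      using Suc.prems by (intro Suc.IH) auto
    then show "(\<Sum>y\<in>Y. \<Sum>y'\<in>Y'. ?c s t * (E (\<lambda>X. npaths k (Suc n) (x + s) y X * npaths k (Suc n) (x' + t) y' X) * h (y - y')))
      = ?c s t * ?h (x + s - (x' + t))" by (simp flip: sum_distrib_left)
  qed
  also have "\<dots> = Qop p ?h (x - x')"
  proof (cases "x = x'")
    case True
    have "(\<Sum>s\<in>R. \<Sum>t\<in>R. ?c s t * ?h (x + s - (x' + t)))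
       = (\<Sum>s\<in>R. \<Sum>t\<in>R. (if s = t then p * f s * ?h 0 else 0) + (if s = t then 0 else p\<^sup>2 * (f s * f t * ?h (s - t))))"
      using True by (intro sum.cong refl) (auto simp: algebra_simps)
    also have "\<dots> = p * ?h 0 + p\<^sup>2 * Poff ?h"
    proof -
      have "(\<Sum>s\<in>R. \<Sum>t\<in>R. if s = t then p * f s * ?h 0 else 0) = (\<Sum>s\<in>R. p * f s * ?h 0)"
        by (simp add: finite_R)
      also have "\<dots> = p * ?h 0" using f_sum by (simp flip: sum_distrib_right sum_distrib_left)
      finally have 1: "(\<Sum>s\<in>R. \<Sum>t\<in>R. if s = t then p * f s * ?h 0 else 0) = p * ?h 0" .
      have 2: "(\<Sum>s\<in>R. \<Sum>t\<in>R. if s = t then 0 else p\<^sup>2 * (f s * f t * ?h (s - t))) = p\<^sup>2 * Poff ?h"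
        unfolding Poff_def sum_distrib_left by (intro sum.cong refl) auto
      show ?thesis unfolding sum.distrib 1 2 ..
    qed
    finally show ?thesis using True by (simp add: Qop_def)
  next
    case False
    then show ?thesis by (simp add: Qop_def Pop_def sum_distrib_left algebra_simps)
  qed
  finally show ?case by simp
qed

end

text \<open>Here \<open>T\<close> is the set of steps that produce a coincidence. Each has weight at
  most \<open>\<epsilon>\<close>, which is the source of the factor \<open>\<epsilon>\<close> per
  coincidence.\<close>

lemma (in transient_kernel) sum_collision_le:
  assumes "finite T" "\<And>t. t \<in> R \<Longrightarrow> t \<notin> T \<Longrightarrow> G t \<le> \<alpha>" "\<And>t. t \<in> T \<Longrightarrow> G t \<le> \<beta>" "0 \<le> \<alpha>" "0 \<le> \<beta>"
  shows "(\<Sum>t\<in>R. f t * G t) \<le> \<alpha> + real (card T) * \<epsilon> * \<beta>"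
proof -
  have "(\<Sum>t\<in>R. f t * G t) \<le> (\<Sum>t\<in>R. f t * \<alpha> + (if t \<in> T then \<epsilon> * \<beta> else 0))"
  proof (rule sum_mono)
    fix t assume t: "t \<in> R"
    show "f t * G t \<le> f t * \<alpha> + (if t \<in> T then \<epsilon> * \<beta> else 0)"
    proof (cases "t \<in> T")
      case True
      have "f t * G t \<le> \<epsilon> * \<beta>"
        using mult_left_mono[OF assms(3)[OF True] f_nonneg] mult_right_mono[OF f_le assms(5)]
        by (rule order_trans)
      then show ?thesis using True f_nonneg[of t] assms(4) by (simp add: add_increasing)
    next
      case False
      then show ?thesis using mult_left_mono[OF assms(2)[OF t False] f_nonneg[of t]] by simp
    qed
  qed
  also have "\<dots> = \<alpha> + (\<Sum>t\<in>R \<inter> T. \<epsilon> * \<beta>)"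
    using f_sum finite_R by (simp add: sum.distrib sum_distrib_right[symmetric] sum.inter_restrict[symmetric] del: sum_constant)
  also have "\<dots> \<le> \<alpha> + (\<Sum>t\<in>T. \<epsilon> * \<beta>)"
    using assms eps by (intro add_left_mono sum_mono2) auto
  finally show ?thesis by simp
qed

section \<open>Moment bounds near criticality\<close>

locale near_critical = transient_kernel f R \<epsilon> + percolation_kernel f R p
  for f :: "(int ^ 'd::finite) \<Rightarrow> real" and R \<epsilon> p +
  assumes p_ge1: "1 \<le> p" and p_le2: "p \<le> 2"
begin

lemma p2_le: "p\<^sup>2 \<le> 4" using p_ge1 p_le2 power_mono[of p 2 2] by simp
lemma p3_le: "p ^ 3 \<le> 8" using p_ge1 p_le2 power_mono[of p 2 3] by simp
text \<open>The bounds hold at each endpoint relative to \<open>fpow\<close>, because the block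
  chain divides by the connection probability of every single displacement. They are proved
  together: distinct starting points can merge in one step, with weight at most
  \<open>\<epsilon>\<close>, and a common one can split.\<close>

lemma pair_pointwise:
  "(x \<noteq> x' \<longrightarrow> E (\<lambda>X. npaths k n x y X * npaths k n x' y X) \<le> 16 ^ k * \<epsilon> * fpow k (y - x)) \<and>
   E (\<lambda>X. npaths k n x y X * npaths k n x y X) \<le> (p ^ k + 16 ^ k * \<epsilon>) * fpow k (y - x)"
proof (induction k arbitrary: n x x')
  case 0
  show ?case using eps by (auto simp: npaths_0[abs_def])
next
  case (Suc k)
  let ?e = "\<lambda>x x'. E (\<lambda>X. npaths k (Suc n) x y X * npaths k (Suc n) x' y X)"
  let ?a = "\<lambda>s. fpow k (y - (x + s))"
  have e1: "?e z z' \<le> 16 ^ k * \<epsilon> * fpow k (y - z)" if "z \<noteq> z'" for z z' using Suc that by blast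
  have "p ^ k + 16 ^ k * \<epsilon> \<le> 2 * 16 ^ k"
  proof -
    have "p ^ k \<le> 16 ^ k" using p_ge1 p_le2 by (intro power_mono) auto
    moreover have "16 ^ k * \<epsilon> \<le> 16 ^ k * 1" using eps by (intro mult_left_mono) auto
    ultimately show ?thesis by linarith
  qed
  then have e2: "?e z z \<le> 2 * 16 ^ k * fpow k (y - z)" for z
    using Suc[of z z "Suc n"] mult_right_mono[OF _ fpow_nonneg] by (meson order_trans)
  have fkS: "(\<Sum>s\<in>R. f s * (c * ?a s)) = c * fpow (Suc k) (y - x)" for c
    by (simp add: sum_distrib_left mult_ac diff_diff_eq)
  \<comment> \<open>The 3 is 1 for no meeting plus 2 from \<open>e2\<close> for the single step that
    leads to one. The bound 4 for \<open>p^2\<close> turns it into 12, below the 16 of the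
    claim.\<close>
  have inner: "(\<Sum>t\<in>R. f t * ?e (x + s) (x' + t)) \<le> 3 * 16 ^ k * \<epsilon> * ?a s" for s
  proof -
    have "(\<Sum>t\<in>R. f t * ?e (x + s) (x' + t)) \<le> 16 ^ k * \<epsilon> * ?a s + real (card {x + s - x'}) * \<epsilon> * (2 * 16 ^ k * ?a s)"
    proof (rule sum_collision_le)
      show "?e (x + s) (x' + t) \<le> 16 ^ k * \<epsilon> * ?a s" if "t \<notin> {x + s - x'}" for t
        using that by (intro e1) (auto simp: algebra_simps)
      show "?e (x + s) (x' + t) \<le> 2 * 16 ^ k * ?a s" if "t \<in> {x + s - x'}" for t
        using that e2[of "x + s"] by simp
    qed (use eps fpow_nonneg in auto)
    then show ?thesis by (simp add: algebra_simps)
  qed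
  have "E (\<lambda>X. npaths (Suc k) n x y X * npaths (Suc k) n x' y X) \<le> 16 ^ Suc k * \<epsilon> * fpow (Suc k) (y - x)" if "x \<noteq> x'"
  proof -
    have "E (\<lambda>X. npaths (Suc k) n x y X * npaths (Suc k) n x' y X) = p\<^sup>2 * (\<Sum>s\<in>R. f s * (\<Sum>t\<in>R. f t * ?e (x + s) (x' + t)))"
      unfolding E_npaths_step2 using that by (simp add: sum_distrib_left mult_ac)
    also have "\<dots> \<le> 4 * (\<Sum>s\<in>R. f s * (3 * 16 ^ k * \<epsilon> * ?a s))"
      using p2_le eps
      by (intro mult_mono sum_mono mult_left_mono inner f_nonneg sum_nonneg mult_nonneg_nonneg Ev_nonneg npaths_nonneg fpow_nonneg) auto
    also have "\<dots> = 12 * 16 ^ k * \<epsilon> * fpow (Suc k) (y - x)" unfolding fkS by simp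
    also have "\<dots> \<le> 16 ^ Suc k * \<epsilon> * fpow (Suc k) (y - x)"
      using eps fpow_nonneg[of "Suc k" "y - x"] by (intro mult_right_mono) (auto simp del: fpow.simps)
    finally show ?thesis .
  qed
  moreover have "E (\<lambda>X. npaths (Suc k) n x y X * npaths (Suc k) n x y X) \<le> (p ^ Suc k + 16 ^ Suc k * \<epsilon>) * fpow (Suc k) (y - x)"
  proof -
    have "E (\<lambda>X. npaths (Suc k) n x y X * npaths (Suc k) n x y X)
      \<le> (\<Sum>s\<in>R. f s * ((p * (p ^ k + 16 ^ k * \<epsilon>) + 4 * (16 ^ k * \<epsilon>)) * ?a s))"
      unfolding E_npaths_step2
    proof (rule sum_mono)
      fix s assume s: "s \<in> R"
      have "(\<Sum>t\<in>R. (if x = x \<and> s = t then p * f s else p\<^sup>2 * f s * f t) * ?e (x + s) (x + t))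
        = p * f s * ?e (x + s) (x + s) + (\<Sum>t\<in>R - {s}. p\<^sup>2 * f s * f t * ?e (x + s) (x + t))"
        using s finite_R by (subst sum.remove[of R s]) (auto intro!: sum.cong split: if_splits)
      also have "\<dots> \<le> p * f s * ((p ^ k + 16 ^ k * \<epsilon>) * ?a s) + (\<Sum>t\<in>R - {s}. p\<^sup>2 * f s * f t * (16 ^ k * \<epsilon> * ?a s))"
        using Suc[of "x + s" "x + s" "Suc n"] p_ge1 f_nonneg
        by (intro add_mono sum_mono mult_left_mono e1) auto
      also have "\<dots> \<le> p * f s * ((p ^ k + 16 ^ k * \<epsilon>) * ?a s) + (\<Sum>t\<in>R. p\<^sup>2 * f s * f t * (16 ^ k * \<epsilon> * ?a s))"
        using finite_R f_nonneg fpow_nonneg eps by (intro add_left_mono sum_mono2) auto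
      also have "(\<Sum>t\<in>R. p\<^sup>2 * f s * f t * (16 ^ k * \<epsilon> * ?a s)) = p\<^sup>2 * (f s * (16 ^ k * \<epsilon> * ?a s)) * (\<Sum>t\<in>R. f t)"
        unfolding sum_distrib_left by (intro sum.cong refl) (simp add: mult_ac)
      also have "\<dots> \<le> 4 * (f s * (16 ^ k * \<epsilon> * ?a s))"
        unfolding f_sum using p2_le f_nonneg fpow_nonneg eps by (simp add: mult_right_mono)
      finally show "(\<Sum>t\<in>R. (if x = x \<and> s = t then p * f s else p\<^sup>2 * f s * f t) * ?e (x + s) (x + t))
         \<le> f s * ((p * (p ^ k + 16 ^ k * \<epsilon>) + 4 * (16 ^ k * \<epsilon>)) * ?a s)" by (simp add: algebra_simps)
    qed
    also have "\<dots> = (p ^ Suc k + (p * 16 ^ k + 4 * 16 ^ k) * \<epsilon>) * fpow (Suc k) (y - x)"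
      unfolding fkS by (simp add: algebra_simps del: fpow.simps)
    also have "\<dots> \<le> (p ^ Suc k + 16 ^ Suc k * \<epsilon>) * fpow (Suc k) (y - x)"
      using eps p_le2 fpow_nonneg[of "Suc k" "y - x"]
      by (intro mult_right_mono add_left_mono) (auto simp del: fpow.simps simp: algebra_simps intro!: order_trans[OF mult_right_mono[of p 2]])
    finally show ?thesis .
  qed
  ultimately show ?case by blast
qed

text \<open>Each coincidence of two of the endpoints costs one factor \<open>\<epsilon>\<close>.\<close>

definition m1 where "m1 Y k n x = E (\<lambda>X. \<Sum>y\<in>Y. npaths k n x y X)"
definition m2 where "m2 Y k n x = E (\<lambda>X. \<Sum>y\<in>Y. fall2 (npaths k n x y X))"
definition m3 where "m3 Y k n x = E (\<lambda>X. \<Sum>y\<in>Y. fall3 (npaths k n x y X))"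
definition m11 where "m11 Y k n x x' = E (\<lambda>X. \<Sum>y\<in>Y. npaths k n x y X * npaths k n x' y X)"
definition m21 where "m21 Y k n x x' = E (\<lambda>X. \<Sum>y\<in>Y. fall2 (npaths k n x y X) * npaths k n x' y X)"
definition m111 where "m111 Y k n x x' x'' = E (\<lambda>X. \<Sum>y\<in>Y. npaths k n x y X * (npaths k n x' y X * npaths k n x'' y X))"

lemmas m_defs = m1_def m2_def m3_def m11_def m21_def m111_def

lemma cyl_fall: "cyl n (n + k) (\<lambda>X. fall2 (npaths k n x y X))" "cyl n (n + k) (\<lambda>X. fall3 (npaths k n x y X))"
  by (rule cyl_comp[OF cyl_npaths])+

lemmas cyl_m = cyl_sum cyl_mult cyl_npaths cyl_fall

lemma E_sum_mult:
  assumes "finite I" "\<And>i. i \<in> I \<Longrightarrow> cyl n (Suc n) (A i)" "\<And>i. i \<in> I \<Longrightarrow> cyl (Suc n) c (B i)"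
  shows "E (\<lambda>X. \<Sum>i\<in>I. A i X * B i X) = (\<Sum>i\<in>I. E (A i) * E (B i))"
proof -
  have "cyl n (max (Suc n) c) (\<lambda>X. A i X * B i X)" if "i \<in> I" for i
    by (intro cyl_mult cyl_mono[OF assms(2)[OF that]] cyl_mono[OF assms(3)[OF that]]) auto
  then have "E (\<lambda>X. \<Sum>i\<in>I. A i X * B i X) = (\<Sum>i\<in>I. E (\<lambda>X. A i X * B i X))"
    by (rule Ev_sum)
  also have "\<dots> = (\<Sum>i\<in>I. E (A i) * E (B i))"
    by (intro sum.cong refl E_mult[OF assms(2,3)])
  finally show ?thesis .
qed

lemma fall2_bit: "fall2 (bit n x s X * a) = bit n x s X * fall2 a"
  and fall3_bit: "fall3 (bit n x s X * a) = bit n x s X * fall3 a"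
  using bit_01[of n x s X] by (auto simp: fall2_def fall3_def)

section \<open>First-step recursions for joint factorial moments\<close>

lemma m1_Suc: "m1 Y (Suc k) n x = (\<Sum>s\<in>R. p * f s * m1 Y k (Suc n) (x + s))"
proof -
  have "m1 Y (Suc k) n x = E (\<lambda>X. \<Sum>s\<in>R. bit n x s X * (\<Sum>y\<in>Y. npaths k (Suc n) (x + s) y X))"
    unfolding m1_def npaths_Suc sum_distrib_left by (subst sum.swap) simp
  then show ?thesis
    by (subst (asm) E_sum_mult[OF finite_R cyl_bit' cyl_sum[OF cyl_npaths]]) (simp add: E_bit m1_def)
qed

lemma m11_Suc:
  assumes "x \<noteq> x'"
  shows "m11 Y (Suc k) n x x' = p\<^sup>2 * (\<Sum>s\<in>R. f s * (\<Sum>t\<in>R. f t * m11 Y k (Suc n) (x + s) (x' + t)))"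
proof -
  have "m11 Y (Suc k) n x x' = (\<Sum>y\<in>Y. E (\<lambda>X. npaths (Suc k) n x y X * npaths (Suc k) n x' y X))"
    unfolding m11_def by (intro Ev_sum[of _ n "n + Suc k"] cyl_mult cyl_npaths)
  also have "\<dots> = (\<Sum>s\<in>R. \<Sum>t\<in>R. p\<^sup>2 * f s * f t * (\<Sum>y\<in>Y. E (\<lambda>X. npaths k (Suc n) (x + s) y X * npaths k (Suc n) (x' + t) y X)))"
    unfolding E_npaths_step2 using assms
    by (simp add: sum.swap[of _ R Y] sum_distrib_left)
  also have "\<dots> = p\<^sup>2 * (\<Sum>s\<in>R. f s * (\<Sum>t\<in>R. f t * m11 Y k (Suc n) (x + s) (x' + t)))"
    unfolding m11_def by (subst Ev_sum[OF cyl_mult[OF cyl_npaths cyl_npaths]]) (simp_all add: sum_distrib_left mult_ac)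
  finally show ?thesis .
qed

lemma cyl_m_Suc:
  fixes A B :: "'i \<Rightarrow> 'd config \<Rightarrow> real"
  assumes "\<And>i. i \<in> I \<Longrightarrow> cyl n (Suc n) (A i)" "\<And>i. i \<in> I \<Longrightarrow> cyl (Suc n) c (B i)"
  shows "cyl n (max (Suc n) c) (\<lambda>X. \<Sum>i\<in>I. A i X * B i X)"
proof (intro cyl_sum cyl_mult)
  fix i assume i: "i \<in> I"
  show "cyl n (max (Suc n) c) (A i)" by (rule cyl_mono[OF assms(1)[OF i]]) auto
  show "cyl n (max (Suc n) c) (B i)" by (rule cyl_mono[OF assms(2)[OF i]]) auto
qed

lemma cyl_off:
  "cyl n (Suc n) (\<lambda>X. if P then 0 else bit n x s X * bit n x' t X)"
  "cyl n (Suc n) (\<lambda>X. bit n x s X * bit n x' t X)"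
  "cyl n (Suc n) (\<lambda>X. if P then 0 else bit n x s X * (bit n x' t X * bit n x'' r X))"
  using cyl_mult[OF cyl_bit' cyl_bit', of n x s x' t] cyl_mult[OF cyl_bit' cyl_mult[OF cyl_bit' cyl_bit'], of n x s x' t x'' r]
  by (cases P; simp)+

lemma E_off2: "E (\<lambda>X. if s = t then 0 else bit n x s X * bit n x t X) = (if s = t then 0 else p\<^sup>2 * f s * f t)"
  by (simp add: E_bit2)

lemma cyl_m11: "cyl n (n + k) (\<lambda>X. \<Sum>y\<in>Y. npaths k n x y X * npaths k n x' y X)"
  and cyl_m21: "cyl n (n + k) (\<lambda>X. \<Sum>y\<in>Y. fall2 (npaths k n x y X) * npaths k n x' y X)"
  and cyl_m111: "cyl n (n + k) (\<lambda>X. \<Sum>y\<in>Y. npaths k n x y X * (npaths k n x' y X * npaths k n x'' y X))"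
  by (intro cyl_sum cyl_mult cyl_npaths cyl_fall)+

lemma sum_triple: "(\<Sum>i\<in>R \<times> R \<times> R. F i) = (\<Sum>s\<in>R. \<Sum>t\<in>R. \<Sum>r\<in>R. F (s, t, r))"
  by (simp add: sum.cartesian_product')

lemma m2_Suc:
  "m2 Y (Suc k) n x = p * (\<Sum>s\<in>R. f s * m2 Y k (Suc n) (x + s))
     + p\<^sup>2 * (\<Sum>s\<in>R. f s * (\<Sum>t\<in>R. f t * (if s = t then 0 else m11 Y k (Suc n) (x + s) (x + t))))"
proof -
  let ?Z = "\<lambda>s y X. npaths k (Suc n) (x + s) y X"
  let ?A = "\<lambda>i X. if fst i = snd i then 0 else bit n x (fst i) X * bit n x (snd i) X"
  let ?B = "\<lambda>i X. \<Sum>y\<in>Y. ?Z (fst i) y X * ?Z (snd i) y X"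
  have eq: "fall2 (npaths (Suc k) n x y X) = (\<Sum>s\<in>R. bit n x s X * fall2 (?Z s y X))
     + (\<Sum>i\<in>R \<times> R. ?A i X * (?Z (fst i) y X * ?Z (snd i) y X))" for y X
    unfolding npaths_Suc fall2_sum[OF finite_R] fall2_bit sum.cartesian_product'
    by (intro arg_cong2[of _ _ _ _ "(+)"] sum.cong refl) (auto simp: mult_ac)
  have "m2 Y (Suc k) n x = E (\<lambda>X. (\<Sum>s\<in>R. bit n x s X * (\<Sum>y\<in>Y. fall2 (?Z s y X))) + (\<Sum>i\<in>R \<times> R. ?A i X * ?B i X))"
    unfolding m2_def eq sum.distrib sum_distrib_left sum.swap[of _ R Y] sum.swap[of _ "R \<times> R" Y] ..
  also have "\<dots> = E (\<lambda>X. \<Sum>s\<in>R. bit n x s X * (\<Sum>y\<in>Y. fall2 (?Z s y X))) + E (\<lambda>X. \<Sum>i\<in>R \<times> R. ?A i X * ?B i X)"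
    by (rule Ev_add[OF cyl_m_Suc[where n = n and c = "Suc n + k"] cyl_m_Suc[where n = n and c = "Suc n + k"]]) (rule cyl_bit' cyl_off cyl_m11 cyl_sum cyl_fall)+
  also have "\<dots> = (\<Sum>s\<in>R. E (bit n x s) * m2 Y k (Suc n) (x + s)) + (\<Sum>i\<in>R \<times> R. E (?A i) * E (?B i))"
    unfolding m2_def
    by (rule arg_cong2[of _ _ _ _ "(+)"]; rule E_sum_mult[where n = n and c = "Suc n + k"])
      (rule finite_R finite_cartesian_product cyl_bit' cyl_off cyl_m11 cyl_sum cyl_fall)+
  also have "\<dots> = p * (\<Sum>s\<in>R. f s * m2 Y k (Suc n) (x + s))
     + p\<^sup>2 * (\<Sum>s\<in>R. f s * (\<Sum>t\<in>R. f t * (if s = t then 0 else m11 Y k (Suc n) (x + s) (x + t))))"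
    unfolding sum.cartesian_product' fst_conv snd_conv E_off2 E_bit m11_def sum_distrib_left
    by (intro arg_cong2[of _ _ _ _ "(+)"] sum.cong refl) (auto simp: mult_ac)
  finally show ?thesis .
qed

lemma sum_prod3:
  fixes a b c :: "'i \<Rightarrow> real"
  shows "sum a S * (sum b S * sum c S) = (\<Sum>s\<in>S. \<Sum>t\<in>S. \<Sum>r\<in>S. a s * (b t * c r))"
  unfolding sum_product[of b S c S] sum_distrib_right[of a S]
  unfolding sum_distrib_left ..

lemma m111_Suc:
  assumes "x1 \<noteq> x2" "x1 \<noteq> x3" "x2 \<noteq> x3"
  shows "m111 Y (Suc k) n x1 x2 x3
    = p ^ 3 * (\<Sum>s\<in>R. f s * (\<Sum>t\<in>R. f t * (\<Sum>r\<in>R. f r * m111 Y k (Suc n) (x1 + s) (x2 + t) (x3 + r))))"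
proof -
  let ?A = "\<lambda>i X. if False then 0 else bit n x1 (fst i) X * (bit n x2 (fst (snd i)) X * bit n x3 (snd (snd i)) X)"
  let ?Z = "\<lambda>x y X. npaths k (Suc n) x y X"
  let ?B = "\<lambda>i X. \<Sum>y\<in>Y. ?Z (x1 + fst i) y X * (?Z (x2 + fst (snd i)) y X * ?Z (x3 + snd (snd i)) y X)"
  have eq: "npaths (Suc k) n x1 y X * (npaths (Suc k) n x2 y X * npaths (Suc k) n x3 y X)
     = (\<Sum>i\<in>R \<times> R \<times> R. ?A i X * (?Z (x1 + fst i) y X * (?Z (x2 + fst (snd i)) y X * ?Z (x3 + snd (snd i)) y X)))" for y X
    unfolding npaths_Suc sum_prod3 sum_triple
    by (intro sum.cong refl) (auto simp: mult_ac)
  have "m111 Y (Suc k) n x1 x2 x3 = E (\<lambda>X. \<Sum>i\<in>R \<times> R \<times> R. ?A i X * ?B i X)"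
    unfolding m111_def eq sum_distrib_left sum.swap[of _ "R \<times> R \<times> R" Y] ..
  also have "\<dots> = (\<Sum>i\<in>R \<times> R \<times> R. E (?A i) * E (?B i))"
    by (rule E_sum_mult[where n = n and c = "Suc n + k"]) (rule finite_R finite_cartesian_product cyl_off cyl_m111)+
  also have "\<dots> = p ^ 3 * (\<Sum>s\<in>R. f s * (\<Sum>t\<in>R. f t * (\<Sum>r\<in>R. f r * m111 Y k (Suc n) (x1 + s) (x2 + t) (x3 + r))))"
    unfolding sum_triple fst_conv snd_conv m111_def sum_distrib_left
    using assms by (intro sum.cong refl) (simp add: E_bit3)
  finally show ?thesis .
qed

lemma E_off3:
  assumes "x \<noteq> x' \<or> (r \<noteq> s \<and> r \<noteq> t)"
  shows "E (\<lambda>X. if s = t then 0 else bit n x s X * (bit n x t X * bit n x' r X)) = (if s = t then 0 else p ^ 3 * (f s * (f t * f r)))"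
  using assms by (auto intro!: E_bit3)

lemma m21_Suc:
  assumes "x \<noteq> x'"
  shows "m21 Y (Suc k) n x x'
    = p\<^sup>2 * (\<Sum>s\<in>R. f s * (\<Sum>t\<in>R. f t * m21 Y k (Suc n) (x + s) (x' + t)))
    + p ^ 3 * (\<Sum>s\<in>R. f s * (\<Sum>t\<in>R. f t * (if s = t then 0 else \<Sum>r\<in>R. f r * m111 Y k (Suc n) (x + s) (x + t) (x' + r))))"
proof -
  let ?Z = "\<lambda>x y X. npaths k (Suc n) x y X"
  let ?A = "\<lambda>i X. bit n x (fst i) X * bit n x' (snd i) X"
  let ?B = "\<lambda>i X. \<Sum>y\<in>Y. fall2 (?Z (x + fst i) y X) * ?Z (x' + snd i) y X"
  let ?C = "\<lambda>i X. if fst i = fst (snd i) then 0 else bit n x (fst i) X * (bit n x (fst (snd i)) X * bit n x' (snd (snd i)) X)"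
  let ?D = "\<lambda>i X. \<Sum>y\<in>Y. ?Z (x + fst i) y X * (?Z (x + fst (snd i)) y X * ?Z (x' + snd (snd i)) y X)"
  have eq: "fall2 (npaths (Suc k) n x y X) * npaths (Suc k) n x' y X
     = (\<Sum>i\<in>R \<times> R. ?A i X * (fall2 (?Z (x + fst i) y X) * ?Z (x' + snd i) y X))
     + (\<Sum>i\<in>R \<times> R \<times> R. ?C i X * (?Z (x + fst i) y X * (?Z (x + fst (snd i)) y X * ?Z (x' + snd (snd i)) y X)))" for y X
  proof -
    let ?S = "\<Sum>r\<in>R. bit n x' r X * ?Z (x' + r) y X"
    have "(\<Sum>s\<in>R. bit n x s X * fall2 (?Z (x + s) y X)) * ?S
       = (\<Sum>i\<in>R \<times> R. ?A i X * (fall2 (?Z (x + fst i) y X) * ?Z (x' + snd i) y X))"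
      unfolding sum_product sum.cartesian_product'[of _ R R] by (intro sum.cong refl) (auto simp: mult_ac)
    moreover have "(\<Sum>s\<in>R. \<Sum>t\<in>R. if s = t then 0 else bit n x s X * ?Z (x + s) y X * (bit n x t X * ?Z (x + t) y X)) * ?S
       = (\<Sum>i\<in>R \<times> R \<times> R. ?C i X * (?Z (x + fst i) y X * (?Z (x + fst (snd i)) y X * ?Z (x' + snd (snd i)) y X)))"
      unfolding sum_distrib_right[of _ _ ?S]
      unfolding sum_distrib_left sum_triple
      by (intro sum.cong refl) (auto simp: mult_ac)
    ultimately show ?thesis unfolding npaths_Suc fall2_sum[OF finite_R] fall2_bit distrib_right by simp
  qed
  have "m21 Y (Suc k) n x x' = E (\<lambda>X. (\<Sum>i\<in>R \<times> R. ?A i X * ?B i X) + (\<Sum>i\<in>R \<times> R \<times> R. ?C i X * ?D i X))"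
    unfolding m21_def eq sum.distrib sum_distrib_left sum.swap[of _ "R \<times> R" Y] sum.swap[of _ "R \<times> R \<times> R" Y] ..
  also have "\<dots> = E (\<lambda>X. \<Sum>i\<in>R \<times> R. ?A i X * ?B i X) + E (\<lambda>X. \<Sum>i\<in>R \<times> R \<times> R. ?C i X * ?D i X)"
    by (rule Ev_add[OF cyl_m_Suc[where n = n and c = "Suc n + k"] cyl_m_Suc[where n = n and c = "Suc n + k"]]) (rule cyl_off cyl_m21 cyl_m111)+
  also have "\<dots> = (\<Sum>i\<in>R \<times> R. E (?A i) * E (?B i)) + (\<Sum>i\<in>R \<times> R \<times> R. E (?C i) * E (?D i))"
    by (rule arg_cong2[of _ _ _ _ "(+)"]; rule E_sum_mult[where n = n and c = "Suc n + k"])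
      (rule finite_R finite_cartesian_product cyl_off cyl_m21 cyl_m111)+
  also have "\<dots> = p\<^sup>2 * (\<Sum>s\<in>R. f s * (\<Sum>t\<in>R. f t * m21 Y k (Suc n) (x + s) (x' + t)))
    + p ^ 3 * (\<Sum>s\<in>R. f s * (\<Sum>t\<in>R. f t * (if s = t then 0 else \<Sum>r\<in>R. f r * m111 Y k (Suc n) (x + s) (x + t) (x' + r))))"
    unfolding sum_triple sum.cartesian_product'[of _ R R] fst_conv snd_conv m111_def m21_def sum_distrib_left
    using assms by (intro arg_cong2[of _ _ _ _ "(+)"] sum.cong refl) (auto simp: mult_ac E_bit2 E_off3 sum_distrib_left)
  finally show ?thesis .
qed

text \<open>Distinct triples sorted by their first steps as in \<open>fall3_sum\<close>. Each
  pattern continues from as many vertices as there are different first steps, which is why moments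
  with several starting points enter.\<close>

lemma m3_Suc:
  "m3 Y (Suc k) n x = p * (\<Sum>s\<in>R. f s * m3 Y k (Suc n) (x + s))
    + 3 * p\<^sup>2 * (\<Sum>s\<in>R. f s * (\<Sum>t\<in>R. f t * (if s = t then 0 else m21 Y k (Suc n) (x + s) (x + t))))
    + p ^ 3 * (\<Sum>s\<in>R. f s * (\<Sum>t\<in>R. f t * (\<Sum>r\<in>R. f r *
        (if s = t \<or> r = s \<or> r = t then 0 else m111 Y k (Suc n) (x + s) (x + t) (x + r)))))"
proof -
  let ?Z = "\<lambda>s y X. npaths k (Suc n) (x + s) y X"
  let ?A = "\<lambda>i X. if fst i = snd i then 0 else bit n x (fst i) X * bit n x (snd i) X"
  let ?B = "\<lambda>i X. \<Sum>y\<in>Y. fall2 (?Z (fst i) y X) * ?Z (snd i) y X"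
  let ?C = "\<lambda>i X. if fst i = fst (snd i) \<or> snd (snd i) = fst i \<or> snd (snd i) = fst (snd i) then 0
      else bit n x (fst i) X * (bit n x (fst (snd i)) X * bit n x (snd (snd i)) X)"
  let ?D = "\<lambda>i X. \<Sum>y\<in>Y. ?Z (fst i) y X * (?Z (fst (snd i)) y X * ?Z (snd (snd i)) y X)"
  have eq: "fall3 (npaths (Suc k) n x y X) = (\<Sum>s\<in>R. bit n x s X * fall3 (?Z s y X))
     + (3 * (\<Sum>i\<in>R \<times> R. ?A i X * (fall2 (?Z (fst i) y X) * ?Z (snd i) y X))
     + (\<Sum>i\<in>R \<times> R \<times> R. ?C i X * (?Z (fst i) y X * (?Z (fst (snd i)) y X * ?Z (snd (snd i)) y X))))" for y X
  proof -
    have "(\<Sum>s\<in>R. \<Sum>t\<in>R. if s = t then 0 else bit n x s X * ?Z s y X * (bit n x t X * ?Z t y X)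
        * (\<Sum>r\<in>R. if r = s \<or> r = t then 0 else bit n x r X * ?Z r y X))
      = (\<Sum>i\<in>R \<times> R \<times> R. ?C i X * (?Z (fst i) y X * (?Z (fst (snd i)) y X * ?Z (snd (snd i)) y X)))"
      unfolding sum_triple sum_distrib_left
      by (intro sum.cong refl) (auto simp: sum_distrib_left mult_ac intro!: sum.cong)
    moreover have "(\<Sum>s\<in>R. \<Sum>t\<in>R. if s = t then 0 else bit n x s X * fall2 (?Z s y X) * (bit n x t X * ?Z t y X))
       = (\<Sum>i\<in>R \<times> R. ?A i X * (fall2 (?Z (fst i) y X) * ?Z (snd i) y X))"
      unfolding sum.cartesian_product'[of _ R R] by (intro sum.cong refl) (auto simp: mult_ac)
    ultimately show ?thesis unfolding npaths_Suc fall3_sum[OF finite_R] fall2_bit fall3_bit by simp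
  qed
  have cC: "cyl n (Suc n) (?C i)" for i by (rule cyl_off)
  have "m3 Y (Suc k) n x = E (\<lambda>X. (\<Sum>s\<in>R. bit n x s X * (\<Sum>y\<in>Y. fall3 (?Z s y X)))
      + (3 * (\<Sum>i\<in>R \<times> R. ?A i X * ?B i X) + (\<Sum>i\<in>R \<times> R \<times> R. ?C i X * ?D i X)))"
    unfolding m3_def eq sum.distrib sum_distrib_left sum.swap[of _ R Y] sum.swap[of _ "R \<times> R" Y] sum.swap[of _ "R \<times> R \<times> R" Y] ..
  also have "\<dots> = E (\<lambda>X. \<Sum>s\<in>R. bit n x s X * (\<Sum>y\<in>Y. fall3 (?Z s y X)))
      + E (\<lambda>X. 3 * (\<Sum>i\<in>R \<times> R. ?A i X * ?B i X) + (\<Sum>i\<in>R \<times> R \<times> R. ?C i X * ?D i X))"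
    by (rule Ev_add[OF cyl_m_Suc[where n = n and c = "Suc n + k"] cyl_add[OF cyl_mult[OF cyl_const cyl_m_Suc[where n = n and c = "Suc n + k"]] cyl_m_Suc[where n = n and c = "Suc n + k"]]])
      (rule cyl_bit' cyl_off cC cyl_m21 cyl_m111 cyl_sum cyl_fall)+
  also have "E (\<lambda>X. 3 * (\<Sum>i\<in>R \<times> R. ?A i X * ?B i X) + (\<Sum>i\<in>R \<times> R \<times> R. ?C i X * ?D i X))
      = E (\<lambda>X. 3 * (\<Sum>i\<in>R \<times> R. ?A i X * ?B i X)) + E (\<lambda>X. \<Sum>i\<in>R \<times> R \<times> R. ?C i X * ?D i X)"
    by (rule Ev_add[OF cyl_mult[OF cyl_const cyl_m_Suc[where n = n and c = "Suc n + k"]] cyl_m_Suc[where n = n and c = "Suc n + k"]]) (rule cyl_off cC cyl_m21 cyl_m111)+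
  also have "E (\<lambda>X. 3 * (\<Sum>i\<in>R \<times> R. ?A i X * ?B i X)) = 3 * E (\<lambda>X. \<Sum>i\<in>R \<times> R. ?A i X * ?B i X)" by simp
  also have "E (\<lambda>X. \<Sum>i\<in>R \<times> R. ?A i X * ?B i X) = (\<Sum>i\<in>R \<times> R. E (?A i) * E (?B i))"
    by (rule E_sum_mult[where n = n and c = "Suc n + k"]) (rule finite_R finite_cartesian_product cyl_off cyl_m21)+
  also have "E (\<lambda>X. \<Sum>i\<in>R \<times> R \<times> R. ?C i X * ?D i X) = (\<Sum>i\<in>R \<times> R \<times> R. E (?C i) * E (?D i))"
    by (rule E_sum_mult[where n = n and c = "Suc n + k"]) (rule finite_R finite_cartesian_product cC cyl_m111)+
  also have "E (\<lambda>X. \<Sum>s\<in>R. bit n x s X * (\<Sum>y\<in>Y. fall3 (?Z s y X))) = (\<Sum>s\<in>R. E (bit n x s) * m3 Y k (Suc n) (x + s))"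
    unfolding m3_def by (rule E_sum_mult[where n = n and c = "Suc n + k"]) (rule finite_R cyl_bit' cyl_sum cyl_fall)+
  also have "(\<Sum>i\<in>R \<times> R \<times> R. E (?C i) * E (?D i)) = p ^ 3 * (\<Sum>s\<in>R. f s * (\<Sum>t\<in>R. f t * (\<Sum>r\<in>R. f r *
        (if s = t \<or> r = s \<or> r = t then 0 else m111 Y k (Suc n) (x + s) (x + t) (x + r)))))"
    unfolding sum_triple fst_conv snd_conv m111_def sum_distrib_left
    by (intro sum.cong refl) (auto simp: E_bit3)
  also have "(\<Sum>i\<in>R \<times> R. E (?A i) * E (?B i)) = p\<^sup>2 * (\<Sum>s\<in>R. f s * (\<Sum>t\<in>R. f t * (if s = t then 0 else m21 Y k (Suc n) (x + s) (x + t))))"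
    unfolding sum.cartesian_product' fst_conv snd_conv E_off2 m21_def sum_distrib_left
    by (intro sum.cong refl) (auto simp: mult_ac)
  also have "(\<Sum>s\<in>R. E (bit n x s) * m3 Y k (Suc n) (x + s)) = p * (\<Sum>s\<in>R. f s * m3 Y k (Suc n) (x + s))"
    by (simp add: E_bit sum_distrib_left mult_ac)
  finally show ?thesis by (simp add: add_ac)
qed

text \<open>When starting points coincide, a product of path counts also contains repetitions of the
  same path; these are the additional terms of lower order.\<close>

lemma m_coincide:
  "m111 Y k n x x x' = m21 Y k n x x' + m11 Y k n x x'"
  "m111 Y k n x x' x = m21 Y k n x x' + m11 Y k n x x'"
  "m111 Y k n x' x x = m21 Y k n x x' + m11 Y k n x x'"
  "m21 Y k n x x = m3 Y k n x + 2 * m2 Y k n x"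
  "m11 Y k n x x = m2 Y k n x + m1 Y k n x"
proof -
  have *: "E (\<lambda>X. (\<Sum>y\<in>Y. fall2 (npaths k n x y X) * npaths k n x' y X) + (\<Sum>y\<in>Y. npaths k n x y X * npaths k n x' y X)) = m21 Y k n x x' + m11 Y k n x x'"
    unfolding m_defs by (rule Ev_add[OF cyl_m21 cyl_m11])
  show "m111 Y k n x x x' = m21 Y k n x x' + m11 Y k n x x'" 
    unfolding *[symmetric] unfolding m_defs fall2_def by (simp add: algebra_simps flip: sum.distrib)
  show "m111 Y k n x x' x = m21 Y k n x x' + m11 Y k n x x'"
    unfolding *[symmetric] unfolding m_defs fall2_def by (simp add: algebra_simps flip: sum.distrib)
  show "m111 Y k n x' x x = m21 Y k n x x' + m11 Y k n x x'"
    unfolding *[symmetric] unfolding m_defs fall2_def by (simp add: algebra_simps flip: sum.distrib)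
  have "E (\<lambda>X. (\<Sum>y\<in>Y. fall3 (npaths k n x y X)) + 2 * (\<Sum>y\<in>Y. fall2 (npaths k n x y X)))
     = m3 Y k n x + E (\<lambda>X. 2 * (\<Sum>y\<in>Y. fall2 (npaths k n x y X)))"
    unfolding m_defs by (rule Ev_add[OF cyl_sum[OF cyl_fall(2)] cyl_mult[OF cyl_const cyl_sum[OF cyl_fall(1)]]])
  then have **: "m3 Y k n x + 2 * m2 Y k n x = E (\<lambda>X. (\<Sum>y\<in>Y. fall3 (npaths k n x y X)) + 2 * (\<Sum>y\<in>Y. fall2 (npaths k n x y X)))"
    by (simp add: m2_def)
  show "m21 Y k n x x = m3 Y k n x + 2 * m2 Y k n x"
    unfolding ** unfolding m_defs fall2_def fall3_def sum_distrib_left sum.distrib[symmetric] by (simp add: algebra_simps)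
  have "E (\<lambda>X. (\<Sum>y\<in>Y. fall2 (npaths k n x y X)) + (\<Sum>y\<in>Y. npaths k n x y X)) = m2 Y k n x + m1 Y k n x"
    unfolding m_defs by (rule Ev_add[OF cyl_sum[OF cyl_fall(1)] cyl_sum[OF cyl_npaths]])
  then show "m11 Y k n x x = m2 Y k n x + m1 Y k n x"
    unfolding m_defs fall2_def by (simp add: algebra_simps flip: sum.distrib)
qed

lemma fall_nonneg: "0 \<le> fall2 (npaths k n x y X)" "0 \<le> fall3 (npaths k n x y X)"
proof -
  obtain j :: nat where j: "npaths k n x y X = real j" using npaths_Nats Nats_cases by blast
  have "0 \<le> real j * (real j - 1) \<and> 0 \<le> real j * (real j - 1) * (real j - 2)"
  proof (cases "j \<le> 1")
    case True then show ?thesis by (cases j) auto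
  next
    case False
    then have "2 \<le> real j" by simp
    then show ?thesis by simp
  qed
  then show "0 \<le> fall2 (npaths k n x y X)" "0 \<le> fall3 (npaths k n x y X)" by (simp_all add: fall2_def fall3_def j)
qed

text \<open>One induction for all six moments: a step from distinct points can merge two or three of
  them, and a merged moment lacks as many powers of \<open>\<epsilon>\<close> as the merging costs.
  The largest factor per step is 8 * 12 = 96, for \<open>m111\<close>, whence the 100.\<close>

lemma third_moment:
  assumes "finite Y"
  defines "C \<equiv> \<lambda>k. 100 ^ k"
  shows "m1 Y k n x \<le> C k \<and> m2 Y k n x \<le> C k * \<epsilon> \<and> m3 Y k n x \<le> C k * \<epsilon>\<^sup>2 \<and>
    (x \<noteq> x' \<longrightarrow> m11 Y k n x x' \<le> C k * \<epsilon> \<and> m21 Y k n x x' \<le> C k * \<epsilon>\<^sup>2 \<and>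
     (x'' \<noteq> x \<longrightarrow> x'' \<noteq> x' \<longrightarrow> m111 Y k n x x' x'' \<le> C k * \<epsilon>\<^sup>2))"
proof (induction k arbitrary: n x x' x'')
  case 0
  have "m1 Y 0 n x \<le> 1" "m2 Y 0 n x = 0" "m3 Y 0 n x = 0"
    "x \<noteq> x' \<Longrightarrow> m11 Y 0 n x x' = 0" "x \<noteq> x' \<Longrightarrow> m21 Y 0 n x x' = 0" "x \<noteq> x' \<Longrightarrow> m111 Y 0 n x x' x'' = 0"
    using assms by (auto simp: m_defs npaths_0 fall2_def fall3_def of_bool_def intro!: sum.neutral)
  then show ?case using eps by (simp add: C_def)
next
  case (Suc k)
  have C: "0 < C k" by (simp add: C_def)
  have e2: "\<epsilon>\<^sup>2 = \<epsilon> * \<epsilon>" by (simp add: power2_eq_square)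
  have el: "\<epsilon> * \<epsilon> \<le> \<epsilon>" using eps mult_left_mono[of \<epsilon> 1 \<epsilon>] by simp
  have Ce: "C k * \<epsilon>\<^sup>2 \<le> C k * \<epsilon>" "C k * \<epsilon> \<le> C k" "0 \<le> C k * \<epsilon>\<^sup>2" "0 \<le> C k * \<epsilon>"
    using C el eps by (auto simp: e2)
  have b1: "m1 Y k n x \<le> C k" and b2: "m2 Y k n x \<le> C k * \<epsilon>" and b3: "m3 Y k n x \<le> C k * \<epsilon>\<^sup>2" for n x
    using Suc by blast+
  have b11: "m11 Y k n x x' \<le> C k * \<epsilon>" and b21: "m21 Y k n x x' \<le> C k * \<epsilon>\<^sup>2" if "x \<noteq> x'" for n x x'
    using Suc that by blast+
  have b111: "m111 Y k n x x' x'' \<le> C k * \<epsilon>\<^sup>2" if "x \<noteq> x'" "x'' \<noteq> x" "x'' \<noteq> x'" for n x x' x''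
    using Suc that by blast
  have d11: "m11 Y k n x x \<le> 2 * C k" for n x using b1[of n x] b2[of n x] Ce by (simp add: m_coincide)
  have d21: "m21 Y k n x x \<le> 3 * C k * \<epsilon>" for n x using b3[of n x] b2[of n x] Ce by (simp add: m_coincide)
  have d111: "m111 Y k n x x x' \<le> 2 * C k * \<epsilon>" "m111 Y k n x x' x \<le> 2 * C k * \<epsilon>" "m111 Y k n x' x x \<le> 2 * C k * \<epsilon>"
    if "x \<noteq> x'" for n x x'
    using b11[OF that, of n] b21[OF that, of n] Ce by (simp_all add: m_coincide)
  have t111: "m111 Y k n x x x \<le> 5 * C k" for n x
    using d11[of n x] d21[of n x] Ce by (simp add: m_coincide(1))
  have w1: "(\<Sum>r\<in>R. f r * m111 Y k n x x' (v + r)) \<le> 5 * C k * \<epsilon>\<^sup>2" if "x \<noteq> x'" for n x x' v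
  proof -
    have "(\<Sum>r\<in>R. f r * m111 Y k n x x' (v + r)) \<le> C k * \<epsilon>\<^sup>2 + real (card {x - v, x' - v}) * \<epsilon> * (2 * C k * \<epsilon>)"
    proof (rule sum_collision_le)
      show "m111 Y k n x x' (v + t) \<le> C k * \<epsilon>\<^sup>2" if "t \<notin> {x - v, x' - v}" for t
        using that \<open>x \<noteq> x'\<close> by (intro b111) (auto simp: algebra_simps)
      show "m111 Y k n x x' (v + t) \<le> 2 * C k * \<epsilon>" if "t \<in> {x - v, x' - v}" for t
        using that \<open>x \<noteq> x'\<close> d111[of x x' n] d111[of x' x n] by auto
    qed (use Ce C eps in auto)
    also have "\<dots> = 5 * C k * \<epsilon>\<^sup>2" using that by (simp add: e2)
    finally show ?thesis .
  qed
  have w2: "(\<Sum>r\<in>R. f r * m111 Y k n x x (v + r)) \<le> 7 * C k * \<epsilon>" for n x v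
  proof -
    have "(\<Sum>r\<in>R. f r * m111 Y k n x x (v + r)) \<le> 2 * C k * \<epsilon> + real (card {x - v}) * \<epsilon> * (5 * C k)"
    proof (rule sum_collision_le)
      show "m111 Y k n x x (v + t) \<le> 2 * C k * \<epsilon>" if "t \<notin> {x - v}" for t
        using that by (intro d111) (auto simp: algebra_simps)
      show "m111 Y k n x x (v + t) \<le> 5 * C k" if "t \<in> {x - v}" for t
        using that t111[of n x] by auto
    qed (use Ce C eps in auto)
    also have "\<dots> = 7 * C k * \<epsilon>" by simp
    finally show ?thesis .
  qed
  have avg: "(\<Sum>s\<in>R. f s * G s) \<le> \<alpha>" if "\<And>s. s \<in> R \<Longrightarrow> G s \<le> \<alpha>" for G \<alpha>
  proof -
    have "(\<Sum>s\<in>R. f s * G s) \<le> (\<Sum>s\<in>R. f s * \<alpha>)" by (intro sum_mono mult_left_mono that f_nonneg)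
    then show ?thesis using f_sum by (simp flip: sum_distrib_right)
  qed
  have w3: "(\<Sum>t\<in>R. f t * (\<Sum>r\<in>R. f r * m111 Y k n x (x' + t) (v + r))) \<le> 12 * C k * \<epsilon>\<^sup>2" for n x x' v
  proof -
    have "(\<Sum>t\<in>R. f t * (\<Sum>r\<in>R. f r * m111 Y k n x (x' + t) (v + r))) \<le> 5 * C k * \<epsilon>\<^sup>2 + real (card {x - x'}) * \<epsilon> * (7 * C k * \<epsilon>)"
    proof (rule sum_collision_le)
      show "(\<Sum>r\<in>R. f r * m111 Y k n x (x' + t) (v + r)) \<le> 5 * C k * \<epsilon>\<^sup>2" if "t \<notin> {x - x'}" for t
        using that by (intro w1) (auto simp: algebra_simps)
      show "(\<Sum>r\<in>R. f r * m111 Y k n x (x' + t) (v + r)) \<le> 7 * C k * \<epsilon>" if "t \<in> {x - x'}" for t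
        using that w2[of n x v] by auto
    qed (use Ce C eps in auto)
    also have "\<dots> = 12 * C k * \<epsilon>\<^sup>2" by (simp add: e2)
    finally show ?thesis .
  qed
  have v1: "(\<Sum>t\<in>R. f t * m21 Y k n x (x' + t)) \<le> 4 * C k * \<epsilon>\<^sup>2" for n x x'
  proof -
    have "(\<Sum>t\<in>R. f t * m21 Y k n x (x' + t)) \<le> C k * \<epsilon>\<^sup>2 + real (card {x - x'}) * \<epsilon> * (3 * C k * \<epsilon>)"
    proof (rule sum_collision_le)
      show "m21 Y k n x (x' + t) \<le> C k * \<epsilon>\<^sup>2" if "t \<notin> {x - x'}" for t
        using that by (intro b21) (auto simp: algebra_simps)
      show "m21 Y k n x (x' + t) \<le> 3 * C k * \<epsilon>" if "t \<in> {x - x'}" for t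
        using that d21[of n x] by auto
    qed (use Ce C eps in auto)
    also have "\<dots> = 4 * C k * \<epsilon>\<^sup>2" by (simp add: e2)
    finally show ?thesis .
  qed
  have u1: "(\<Sum>t\<in>R. f t * m11 Y k n x (x' + t)) \<le> 3 * C k * \<epsilon>" for n x x'
  proof -
    have "(\<Sum>t\<in>R. f t * m11 Y k n x (x' + t)) \<le> C k * \<epsilon> + real (card {x - x'}) * \<epsilon> * (2 * C k)"
    proof (rule sum_collision_le)
      show "m11 Y k n x (x' + t) \<le> C k * \<epsilon>" if "t \<notin> {x - x'}" for t
        using that by (intro b11) (auto simp: algebra_simps)
      show "m11 Y k n x (x' + t) \<le> 2 * C k" if "t \<in> {x - x'}" for t
        using that d11[of n x] by auto
    qed (use Ce C eps in auto)
    also have "\<dots> = 3 * C k * \<epsilon>" by simp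
    finally show ?thesis .
  qed
  have CS: "C (Suc k) = 100 * C k" by (simp add: C_def)
  have le: "a * S \<le> b * \<gamma>" if "S \<le> \<gamma>" "0 \<le> a" "a \<le> b" "0 \<le> \<gamma>" for a S b \<gamma> :: real
    using mult_left_mono[OF that(1,2)] mult_right_mono[OF that(3,4)] by linarith
  have h1: "m1 Y (Suc k) n x \<le> 2 * C k"
  proof -
    have "m1 Y (Suc k) n x = p * (\<Sum>s\<in>R. f s * m1 Y k (Suc n) (x + s))" by (simp add: m1_Suc sum_distrib_left mult_ac)
    also have "\<dots> \<le> 2 * C k" using C p_ge1 p_le2 by (intro le avg b1) auto
    finally show ?thesis .
  qed
  have h2: "m2 Y (Suc k) n x \<le> 2 * (C k * \<epsilon>) + 4 * (C k * \<epsilon>)"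
    unfolding m2_Suc using Ce p_ge1 p_le2 p2_le
    by (intro add_mono le avg b2) (auto intro!: b11)
  have h3: "m3 Y (Suc k) n x \<le> 2 * (C k * \<epsilon>\<^sup>2) + 12 * (C k * \<epsilon>\<^sup>2) + 8 * (C k * \<epsilon>\<^sup>2)"
    unfolding m3_Suc using Ce p_ge1 p_le2 p2_le p3_le
    by (intro add_mono le avg b3) (auto intro!: b21 b111)
  have h4: "m11 Y (Suc k) n x x' \<le> 4 * (3 * C k * \<epsilon>)" if "x \<noteq> x'"
    unfolding m11_Suc[OF that] by (rule le[OF avg[OF u1]]) (use Ce p2_le in \<open>auto simp: mult.assoc\<close>)
  have h5: "m21 Y (Suc k) n x x' \<le> 4 * (4 * C k * \<epsilon>\<^sup>2) + 8 * (5 * C k * \<epsilon>\<^sup>2)" if "x \<noteq> x'"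
    unfolding m21_Suc[OF that] using Ce p_ge1 p2_le p3_le
    by (intro add_mono le avg v1) (auto intro!: w1)
  have h6: "m111 Y (Suc k) n x x' x'' \<le> 8 * (12 * C k * \<epsilon>\<^sup>2)" if "x \<noteq> x'" "x'' \<noteq> x" "x'' \<noteq> x'"
    unfolding m111_Suc[OF that(1) that(2)[symmetric] that(3)[symmetric]]
    using Ce p_ge1 p3_le by (intro le avg w3) auto
  show ?case unfolding CS
  proof (intro conjI impI)
    assume "x \<noteq> x'"
    then show "m11 Y (Suc k) n x x' \<le> 100 * C k * \<epsilon>" "m21 Y (Suc k) n x x' \<le> 100 * C k * \<epsilon>\<^sup>2"
      using h4 h5 Ce unfolding mult.assoc by linarith+
    assume "x'' \<noteq> x" "x'' \<noteq> x'"
    then show "m111 Y (Suc k) n x x' x'' \<le> 100 * C k * \<epsilon>\<^sup>2"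
      using h6 \<open>x \<noteq> x'\<close> Ce unfolding mult.assoc by linarith
  qed (use h1 h2 h3 Ce C in \<open>unfold mult.assoc, linarith+\<close>)
qed

end

lemma incr_mult:
  "incr g \<Longrightarrow> incr h \<Longrightarrow> (\<And>X. 0 \<le> g X) \<Longrightarrow> (\<And>X. 0 \<le> h X) \<Longrightarrow> incr (\<lambda>X. g X * h X)"
  unfolding incr_def by (auto intro!: mult_mono)

section \<open>Connections, pivotal edges and their covariances\<close>

context percolation_kernel
begin

text \<open>A path crosses each level only once, so it uses a given edge at most once. Opening the
  edge adds the paths through it, a product of the segments before and after.\<close>

lemma npaths_upd:
  "npaths k n x y (X((l, v, w) := True)) = npaths k n x y (X((l, v, w) := False))
    + of_bool (w - v \<in> R \<and> n \<le> l \<and> l < n + k) * (npaths (l - n) n x v X * npaths (n + k - Suc l) (Suc l) w y X)"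
proof (induction k arbitrary: n x)
  case 0 then show ?case by (simp add: npaths_0)
next
  case (Suc k)
  let ?X1 = "X((l, v, w) := True)" and ?X0 = "X((l, v, w) := False)"
  have X: "X = ?X1 \<or> X = ?X0" by (cases "X (l, v, w)") (auto simp: fun_upd_idem)
  consider "l < n" | "l = n" | "n < l" by linarith
  then show ?case
  proof cases
    case 1
    then have "bit n x s ?X1 = bit n x s ?X0" for s by (simp add: bit_def)
    then show ?thesis using 1 Suc by (simp add: npaths_Suc del: fun_upd_apply)
  next
    case 2
    have z: "npaths k (Suc n) (x + s) y ?X1 = npaths k (Suc n) (x + s) y ?X0" for s
      using Suc[of "Suc n" "x + s"] 2 by (simp del: fun_upd_apply)
    then have z': "npaths k (Suc n) (x + s) y ?X0 = npaths k (Suc n) (x + s) y X" for s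
      using X by metis
    have b: "bit n x s ?X1 = bit n x s ?X0 + of_bool (s = w - v) * of_bool (x = v)" for s
      using 2 by (auto simp: bit_def)
    have "(\<Sum>s\<in>R. of_bool (s = w - v) * of_bool (x = v) * npaths k (Suc n) (x + s) y X)
       = (\<Sum>s\<in>R. if s = w - v then of_bool (x = v) * npaths k (Suc n) w y X else 0)"
      by (intro sum.cong refl) auto
    also have "\<dots> = of_bool (w - v \<in> R) * (of_bool (x = v) * npaths k (Suc n) w y X)"
      by (simp add: finite_R)
    finally show ?thesis
      unfolding npaths_Suc[of k n] z z' b using 2 by (simp add: distrib_right sum.distrib npaths_0)
  next
    case 3
    have b: "bit n x s ?X1 = bit n x s X" "bit n x s ?X0 = bit n x s X" for s
      using 3 by (simp_all add: bit_def)
    obtain j where j: "l - n = Suc j" "l - Suc n = j" using 3 by (metis Suc_diff_Suc)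
    show ?thesis unfolding npaths_Suc[of k n] b Suc[of "Suc n"] j npaths_Suc[of j n]
      using 3 by (simp add: distrib_left sum.distrib sum_distrib_left sum_distrib_right mult_ac)
  qed
qed

lemma incr_npaths: "incr (npaths k n x y)"
  unfolding incr_def using npaths_upd npaths_nonneg by (auto simp: of_bool_def)

definition conn :: "nat \<Rightarrow> nat \<Rightarrow> (int ^ 'd) \<Rightarrow> (int ^ 'd) \<Rightarrow> 'd config \<Rightarrow> real" where
  "conn k n x y X = of_bool (0 < npaths k n x y X)"

lemma cyl_conn: "cyl n (n + k) (conn k n x y)"
  unfolding conn_def[abs_def] by (rule cyl_comp[OF cyl_npaths])

lemma conn_le: "conn k n x y X \<le> npaths k n x y X"
proof -
  obtain j :: nat where "npaths k n x y X = real j" using npaths_Nats Nats_cases by blast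
  then show ?thesis by (cases j) (auto simp: conn_def)
qed

text \<open>The second Bonferroni inequality. Its factor 1/2 becomes the 1/2 in front of the excess
  in \<open>survival\<close>.\<close>

lemma conn_ge: "npaths k n x y X - fall2 (npaths k n x y X) / 2 \<le> conn k n x y X"
proof -
  obtain j :: nat where j: "npaths k n x y X = real j" using npaths_Nats Nats_cases by blast
  consider "j = 0" | "j = 1" | i where "j = Suc (Suc i)" by (metis One_nat_def not0_implies_Suc)
  then show ?thesis
  proof cases
    case 3
    have "0 \<le> real i * (1 + real i)" by simp
    then show ?thesis using 3 by (simp add: conn_def fall2_def j algebra_simps)
  qed (auto simp: conn_def fall2_def j)
qed

lemma conn_nonneg: "0 \<le> conn k n x y X" by (simp add: conn_def)

text \<open>Pivotality of an edge is bounded by the number of paths through it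
  that are open elsewhere.\<close>

definition piv :: "nat \<Rightarrow> nat \<Rightarrow> (int ^ 'd) \<Rightarrow> (int ^ 'd) \<Rightarrow> nat \<times> (int ^ 'd) \<times> (int ^ 'd) \<Rightarrow> 'd config \<Rightarrow> real" where
  "piv k n x y = (\<lambda>(l, v, w) X. if n \<le> l \<and> l < n + k then npaths (l - n) n x v X * npaths (n + k - Suc l) (Suc l) w y X else 0)"

lemma piv_nonneg: "0 \<le> piv k n x y e X"
  by (auto simp: piv_def npaths_nonneg split: prod.splits)

lemma conn_piv:
  "0 \<le> conn k n x y (X(e := True)) - conn k n x y (X(e := False)) \<and>
   conn k n x y (X(e := True)) - conn k n x y (X(e := False)) \<le> piv k n x y e X"
proof -
  obtain l v w where e: "e = (l, v, w)" by (cases e)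
  let ?c = "of_bool (w - v \<in> R \<and> n \<le> l \<and> l < n + k) * (npaths (l - n) n x v X * npaths (n + k - Suc l) (Suc l) w y X)"
  have c: "?c \<in> \<nat>" by (intro Nats_mult npaths_Nats) auto
  then obtain j :: nat where j: "?c = real j" using Nats_cases by blast
  have le: "?c \<le> piv k n x y e X" by (auto simp: piv_def e npaths_nonneg)
  show ?thesis
  proof (cases "j = 0")
    case True
    then show ?thesis using npaths_upd[of k n x y X l v w] piv_nonneg[of k n x y e X] unfolding j by (simp add: conn_def e)
  next
    case False
    then have "1 \<le> piv k n x y e X" using le unfolding j by linarith
    then show ?thesis using npaths_upd[of k n x y X l v w] npaths_nonneg[of k n x y "X(e := False)"] False
      unfolding j by (auto simp: conn_def e)
  qed
qed

lemma cyl_piv: "cyl n (n + k) (piv k n x y e)"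
proof -
  obtain l v w where e: "e = (l, v, w)" by (cases e)
  show ?thesis
  proof (cases "n \<le> l \<and> l < n + k")
    case True
    then have "cyl n (n + k) (npaths (l - n) n x v)" "cyl n (n + k) (npaths (n + k - Suc l) (Suc l) w y)"
      by (auto intro: cyl_mono[OF cyl_npaths])
    then show ?thesis using True by (auto simp: piv_def e)
  next
    case False
    then have "piv k n x y e = (\<lambda>_. 0)" by (auto simp: piv_def e fun_eq_iff)
    then show ?thesis by simp
  qed
qed

lemma incr_piv: "incr (piv k n x y e)"
proof -
  obtain l v w where e: "e = (l, v, w)" by (cases e)
  show ?thesis
  proof (cases "n \<le> l \<and> l < n + k")
    case True
    then show ?thesis by (auto simp: piv_def e intro!: incr_mult incr_npaths npaths_nonneg)
  next
    case False
    then have "piv k n x y e = (\<lambda>_. 0)" by (auto simp: piv_def e fun_eq_iff)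
    then show ?thesis by (simp add: incr_def)
  qed
qed

lemma E_piv:
  assumes "n \<le> l" "l < n + k"
  shows "E (\<lambda>X. piv k n x y (l, v, w) X * piv k n x' y' (l, v, w) X)
    = E (\<lambda>X. npaths (l - n) n x v X * npaths (l - n) n x' v X)
      * E (\<lambda>X. npaths (n + k - Suc l) (Suc l) w y X * npaths (n + k - Suc l) (Suc l) w y' X)"
proof -
  have "(\<lambda>X. piv k n x y (l, v, w) X * piv k n x' y' (l, v, w) X)
    = (\<lambda>X. (npaths (l - n) n x v X * npaths (l - n) n x' v X) * (npaths (n + k - Suc l) (Suc l) w y X * npaths (n + k - Suc l) (Suc l) w y' X))"
    using assms by (simp add: piv_def fun_eq_iff mult_ac)
  then show ?thesis
    using assms by (simp only:) (intro E_mult[where b = "Suc l" and a = n and c = "n + k"] cyl_mult; rule cyl_mono[OF cyl_npaths]; simp)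
qed

text \<open>At a pivotal edge leaving \<open>v\<close> both initial segments have to meet in
  \<open>v\<close>, which gives an iterate of \<open>ker0\<close>; the final segments share their
  start but have free endpoints, which gives an iterate of the constant one. The error
  \<open>c\<close> is attached to each pair of endpoints, while only its total is bounded.\<close>

lemma E_conn_cov:
  assumes Y: "finite Y" "finite Y'"
  shows "\<exists>c. (\<forall>y\<in>Y. \<forall>y'\<in>Y'. 0 \<le> c y y' \<and>
      E (\<lambda>X. conn k n x y X * conn k n x' y' X) \<le> E (conn k n x y) * E (conn k n x' y') + c y y') \<and>
    (\<Sum>y\<in>Y. \<Sum>y'\<in>Y'. c y y') \<le> p * (\<Sum>j<k. (Qop p ^^ j) ker0 (x - x') * (Qop p ^^ (k - Suc j)) (\<lambda>_. 1) 0)"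
proof -
  let ?G = "\<lambda>y y' e. E (\<lambda>X. piv k n x y e X * piv k n x' y' e X)"
  have G0: "0 \<le> ?G y y' e" for y y' e by (intro Ev_nonneg mult_nonneg_nonneg piv_nonneg)
  have "\<forall>y y'. \<exists>A. finite A \<and> (\<forall>e\<in>A. n \<le> fst e \<and> fst e < n + k) \<and> depends_on A (conn k n x y) \<and> depends_on A (conn k n x' y')"
  proof (intro allI)
    fix y y'
    obtain A where "finite A" "\<forall>e\<in>A. n \<le> fst e \<and> fst e < n + k" "depends_on A (conn k n x y)"
      using cyl_conn[of n k x y] unfolding cyl_def by blast
    moreover obtain A' where "finite A'" "\<forall>e\<in>A'. n \<le> fst e \<and> fst e < n + k" "depends_on A' (conn k n x' y')"
      using cyl_conn[of n k x' y'] unfolding cyl_def by blast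
    ultimately show "\<exists>A. finite A \<and> (\<forall>e\<in>A. n \<le> fst e \<and> fst e < n + k) \<and> depends_on A (conn k n x y) \<and> depends_on A (conn k n x' y')"
      by (intro exI[of _ "A \<union> A'"]) (auto intro: depends_on_mono)
  qed
  then obtain A where A: "\<And>y y'. finite (A y y')" "\<And>y y' e. e \<in> A y y' \<Longrightarrow> n \<le> fst e \<and> fst e < n + k"
    "\<And>y y'. depends_on (A y y') (conn k n x y)" "\<And>y y'. depends_on (A y y') (conn k n x' y')"
    by metis
  define c where "c y y' = (\<Sum>e\<in>A y y'. pe e * ?G y y' e)" for y y'
  have c0: "0 \<le> c y y'" for y y' unfolding c_def using pe G0 by (intro sum_nonneg mult_nonneg_nonneg) auto
  have cov: "E (\<lambda>X. conn k n x y X * conn k n x' y' X) \<le> E (conn k n x y) * E (conn k n x' y') + c y y'" for y y'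
  proof -
    have "\<forall>e. \<exists>B. finite B \<and> depends_on B (piv k n x y e) \<and> depends_on B (piv k n x' y' e)"
    proof
      fix e
      obtain B B' where "finite B" "depends_on B (piv k n x y e)" "finite B'" "depends_on B' (piv k n x' y' e)"
        using cyl_piv[of n k x y e] cyl_piv[of n k x' y' e] unfolding cyl_def by blast
      then show "\<exists>B. finite B \<and> depends_on B (piv k n x y e) \<and> depends_on B (piv k n x' y' e)"
        by (intro exI[of _ "B \<union> B'"]) (auto intro: depends_on_mono)
    qed
    then obtain B where "\<And>e. finite (B e)" "\<And>e. depends_on (B e) (piv k n x y e)" "\<And>e. depends_on (B e) (piv k n x' y' e)"
      by metis
    then show ?thesis unfolding c_def
      by (intro Ev_cov_le[OF pe A(1,3,4), where B = B] incr_piv conn_piv) auto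
  qed
  \<comment> \<open>The edge sets \<open>A y y'\<close> depend on the endpoints. Every contributing
    edge starts in \<open>V\<close> and has its displacement in \<open>R\<close>, so one finite set
    \<open>K\<close> serves all of them.\<close>
  define V where "V = (\<Union>j<k. reach j x \<union> reach j x')"
  have fV: "finite V" by (simp add: V_def finite_reach)
  define K where "K = {n..<n + k} \<times> V \<times> R"
  have fK: "finite K" by (simp add: K_def fV finite_R)
  let ?e = "\<lambda>(l, v, s). (l, v, v + s)"
  have inj: "inj_on ?e K" by (auto simp: inj_on_def)
  have c_le: "c y y' \<le> (\<Sum>(l, v, s)\<in>K. p * f s * ?G y y' (l, v, v + s))" for y y'
  proof -
    have zero: "pe e * ?G y y' e = 0" if e: "e \<in> A y y'" "e \<notin> ?e ` K" for e
    proof -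
      obtain l v w where lvw: "e = (l, v, w)" by (cases e)
      then have l: "n \<le> l" "l < n + k" using A(2)[OF e(1)] by auto
      have "v \<notin> V \<or> w - v \<notin> R"
      proof (rule ccontr)
        assume "\<not> (v \<notin> V \<or> w - v \<notin> R)"
        then have "(l, v, w - v) \<in> K" using l by (auto simp: K_def)
        then have "?e (l, v, w - v) \<in> ?e ` K" by blast
        then show False using e(2) lvw by simp
      qed
      then show ?thesis
      proof
        assume "v \<notin> V"
        then have "v \<notin> reach (l - n) x" using l unfolding V_def by force
        then have "piv k n x y e X = 0" for X using npaths_outside[of v "l - n" x n X] by (simp add: piv_def lvw)
        then show ?thesis by simp
      next
        assume "w - v \<notin> R" then show ?thesis by (simp add: pe_def lvw f_outside)
      qed
    qed
    have "c y y' = (\<Sum>e\<in>A y y' \<inter> ?e ` K. pe e * ?G y y' e)"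
      unfolding c_def using A(1) zero by (intro sum.mono_neutral_right) auto
    also have "\<dots> \<le> (\<Sum>e\<in>?e ` K. pe e * ?G y y' e)"
      using fK pe G0 by (intro sum_mono2 mult_nonneg_nonneg) auto
    also have "\<dots> = (\<Sum>(l, v, s)\<in>K. p * f s * ?G y y' (l, v, v + s))"
      by (subst sum.reindex[OF inj]) (auto intro!: sum.cong simp: pe_def)
    finally show ?thesis .
  qed
  let ?h = "\<lambda>j. (Qop p ^^ j) ker0 (x - x')" and ?q = "\<lambda>j. (Qop p ^^ j) (\<lambda>_. 1) 0"
  have q: "(\<Sum>y\<in>Y. \<Sum>y'\<in>Y'. E (\<lambda>X. npaths j l w y X * npaths j l w y' X)) \<le> ?q j" for j l w
  proof -
    have "(\<Sum>y\<in>Y. \<Sum>y'\<in>Y'. E (\<lambda>X. npaths j l w y X * npaths j l w y' X))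
      \<le> (\<Sum>y\<in>Y \<union> reach j w. \<Sum>y'\<in>Y' \<union> reach j w. E (\<lambda>X. npaths j l w y X * npaths j l w y' X) * 1)"
      unfolding sum.cartesian_product mult_1_right
    proof (rule sum_mono2)
      fix b show "0 \<le> (case b of (y, y') \<Rightarrow> E (\<lambda>X. npaths j l w y X * npaths j l w y' X))"
        by (cases b) (simp only: prod.case, intro Ev_nonneg mult_nonneg_nonneg npaths_nonneg)
    qed (use Y finite_reach in blast)+
    also have "\<dots> = ?q j"
      using E_pair[of "Y \<union> reach j w" "Y' \<union> reach j w" j w w l "\<lambda>_. 1"] Y by (simp add: finite_reach)
    finally show ?thesis .
  qed
  have h: "(\<Sum>v\<in>V. E (\<lambda>X. npaths j n x v X * npaths j n x' v X)) = ?h j" if "j < k" for j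
  proof -
    have "?h j = (\<Sum>v\<in>V. \<Sum>v'\<in>V. E (\<lambda>X. npaths j n x v X * npaths j n x' v' X) * ker0 (v - v'))"
      using fV that by (subst E_pair) (auto simp: V_def)
    also have "\<dots> = (\<Sum>v\<in>V. \<Sum>v'\<in>V. if v' = v then E (\<lambda>X. npaths j n x v X * npaths j n x' v X) else 0)"
      by (intro sum.cong refl) (auto simp: ker0_def)
    finally show ?thesis using fV by simp
  qed
  have "(\<Sum>y\<in>Y. \<Sum>y'\<in>Y'. c y y') \<le> (\<Sum>y\<in>Y. \<Sum>y'\<in>Y'. \<Sum>(l, v, s)\<in>K. p * f s * ?G y y' (l, v, v + s))"
    by (intro sum_mono c_le)
  also have "\<dots> = (\<Sum>(l, v, s)\<in>K. p * f s * (\<Sum>y\<in>Y. \<Sum>y'\<in>Y'. ?G y y' (l, v, v + s)))"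
    by (simp only: sum.swap[of _ K Y'] sum.swap[of _ K Y] case_prod_beta' sum_distrib_left)
  also have "\<dots> \<le> (\<Sum>(l, v, s)\<in>K. p * f s * (E (\<lambda>X. npaths (l - n) n x v X * npaths (l - n) n x' v X) * ?q (n + k - Suc l)))"
  proof (rule sum_mono, clarify)
    fix l v s assume "(l, v, s) \<in> K"
    then have l: "n \<le> l" "l < n + k" by (auto simp: K_def)
    have "(\<Sum>y\<in>Y. \<Sum>y'\<in>Y'. ?G y y' (l, v, v + s))
      = E (\<lambda>X. npaths (l - n) n x v X * npaths (l - n) n x' v X) * (\<Sum>y\<in>Y. \<Sum>y'\<in>Y'. E (\<lambda>X. npaths (n + k - Suc l) (Suc l) (v + s) y X * npaths (n + k - Suc l) (Suc l) (v + s) y' X))"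
      unfolding E_piv[OF l] sum_distrib_left ..
    also have "\<dots> \<le> E (\<lambda>X. npaths (l - n) n x v X * npaths (l - n) n x' v X) * ?q (n + k - Suc l)"
      by (intro mult_left_mono q Ev_nonneg mult_nonneg_nonneg npaths_nonneg)
    finally show "p * f s * (\<Sum>y\<in>Y. \<Sum>y'\<in>Y'. ?G y y' (l, v, v + s))
      \<le> p * f s * (E (\<lambda>X. npaths (l - n) n x v X * npaths (l - n) n x' v X) * ?q (n + k - Suc l))"
      using p_nonneg f_nonneg by (intro mult_left_mono) auto
  qed
  also have "\<dots> = (\<Sum>l=n..<n + k. \<Sum>v\<in>V. \<Sum>s\<in>R. p * f s * (E (\<lambda>X. npaths (l - n) n x v X * npaths (l - n) n x' v X) * ?q (n + k - Suc l)))"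
    unfolding K_def by (simp add: sum.cartesian_product')
  also have "\<dots> = (\<Sum>l=n..<n + k. \<Sum>v\<in>V. p * (E (\<lambda>X. npaths (l - n) n x v X * npaths (l - n) n x' v X) * ?q (n + k - Suc l)))"
    using f_sum by (simp flip: sum_distrib_right sum_distrib_left)
  also have "\<dots> = (\<Sum>l=n..<n + k. p * (?h (l - n) * ?q (n + k - Suc l)))"
    by (intro sum.cong refl, subst h[symmetric]) (auto simp: sum_distrib_left sum_distrib_right)
  also have "\<dots> = (\<Sum>j<k. p * (?h j * ?q (k - Suc j)))"
    by (rule sum.reindex_bij_witness[of _ "\<lambda>j. n + j" "\<lambda>l. l - n"]) (auto intro!: arg_cong2[of _ _ _ _ "(*)"] arg_cong[of _ _ ?q])
  finally have "(\<Sum>y\<in>Y. \<Sum>y'\<in>Y'. c y y') \<le> p * (\<Sum>j<k. ?h j * ?q (k - Suc j))" by (simp add: sum_distrib_left)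
  then show ?thesis using c0 cov by blast
qed

section \<open>Translation invariance and free walks\<close>

lemma npaths_shift: "npaths k (a + n) (v + x) (v + y) X = npaths k n x y (\<lambda>(l, u, w). X (a + l, v + u, v + w))"
proof (induction k arbitrary: n x)
  case 0 then show ?case by (simp add: npaths_0)
next
  case (Suc k)
  have "npaths k (Suc (a + n)) (v + x + s) (v + y) X = npaths k (Suc n) (x + s) y (\<lambda>(l, u, w). X (a + l, v + u, v + w))" for s
    using Suc[of "Suc n" "x + s"] by (simp add: add_ac)
  then show ?case by (simp add: npaths_Suc bit_def add_ac)
qed

lemma E_shift: "E (\<lambda>X. F (npaths k n x (x + u) X)) = E (\<lambda>X. F (npaths k 0 0 u X))"
proof -
  let ?T = "\<lambda>(l, u, w). (n + l, x + u, x + w)"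
  obtain A where A: "finite A" "depends_on A (\<lambda>X. F (npaths k 0 0 u X))"
    using cyl_comp[OF cyl_npaths[of 0 k 0 u], of F] unfolding cyl_def by blast
  have "E (\<lambda>X. F (npaths k 0 0 u (\<lambda>e. X (?T e)))) = E (\<lambda>X. F (npaths k 0 0 u X))"
    by (rule Ev_reindex[OF pe _ _ A]) (auto simp: inj_def pe_def)
  moreover have "(\<lambda>e. X (?T e)) = (\<lambda>(l, u, w). X (n + l, x + u, x + w))" for X :: "'d config"
    by (auto simp: fun_eq_iff)
  ultimately show ?thesis using npaths_shift[of k n 0 x 0 u] by simp
qed

text \<open>The counterpart of \<open>E_pair\<close> for two independent walks, with
  \<open>Pop\<close> in place of \<open>Qop\<close>.\<close>

lemma fpow_pair:
  assumes "finite Y" "finite Y'" "reach k x \<subseteq> Y" "reach k x' \<subseteq> Y'"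
  shows "(\<Sum>y\<in>Y. \<Sum>y'\<in>Y'. fpow k (y - x) * fpow k (y' - x') * h (y - y')) = (Pop ^^ k) h (x - x')"
  using assms(3,4)
proof (induction k arbitrary: x x')
  case 0
  have "(\<Sum>y\<in>Y. \<Sum>y'\<in>Y'. fpow 0 (y - x) * fpow 0 (y' - x') * h (y - y'))
      = (\<Sum>y\<in>Y. \<Sum>y'\<in>Y'. if y' = x' then (if y = x then h (y - y') else 0) else 0)"
    by (intro sum.cong refl) auto
  also have "\<dots> = h (x - x')" using 0 assms(1,2) by (simp add: sum.delta)
  finally show ?case by simp
next
  case (Suc k)
  have "(\<Sum>y\<in>Y. \<Sum>y'\<in>Y'. fpow (Suc k) (y - x) * fpow (Suc k) (y' - x') * h (y - y'))
    = (\<Sum>s\<in>R. \<Sum>t\<in>R. \<Sum>y\<in>Y. \<Sum>y'\<in>Y'. f s * f t * (fpow k (y - (x + s)) * fpow k (y' - (x' + t)) * h (y - y')))"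
    unfolding fpow.simps sum_product unfolding sum_distrib_right by (subst sum_swap4) (simp add: mult_ac diff_diff_eq)
  also have "\<dots> = (\<Sum>s\<in>R. \<Sum>t\<in>R. f s * f t * (Pop ^^ k) h (x + s - (x' + t)))"
  proof (intro sum.cong refl)
    fix s t assume "s \<in> R" "t \<in> R"
    then have "(\<Sum>y\<in>Y. \<Sum>y'\<in>Y'. fpow k (y - (x + s)) * fpow k (y' - (x' + t)) * h (y - y')) = (Pop ^^ k) h (x + s - (x' + t))"
      using Suc.prems by (intro Suc.IH) auto
    then show "(\<Sum>y\<in>Y. \<Sum>y'\<in>Y'. f s * f t * (fpow k (y - (x + s)) * fpow k (y' - (x' + t)) * h (y - y')))
      = f s * f t * (Pop ^^ k) h (x + s - (x' + t))" by (simp flip: sum_distrib_left)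
  qed
  also have "\<dots> = Pop ((Pop ^^ k) h) (x - x')" by (simp add: Pop_def algebra_simps)
  finally show ?case by simp
qed

lemma fpow_sum: "finite Y \<Longrightarrow> reach k x \<subseteq> Y \<Longrightarrow> (\<Sum>y\<in>Y. fpow k (y - x)) = 1"
proof (induction k arbitrary: x)
  case 0
  then have "(\<Sum>y\<in>Y. fpow 0 (y - x)) = (\<Sum>y\<in>Y. if y = x then 1 else 0)" by (intro sum.cong) auto
  then show ?case using 0 by simp
next
  case (Suc k)
  have "(\<Sum>y\<in>Y. fpow (Suc k) (y - x)) = (\<Sum>s\<in>R. f s * (\<Sum>y\<in>Y. fpow k (y - (x + s))))"
    unfolding fpow.simps sum_distrib_left by (subst sum.swap) (simp add: diff_diff_eq)
  also have "\<dots> = (\<Sum>s\<in>R. f s * 1)"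
    by (intro sum.cong refl arg_cong2[of _ _ _ _ "(*)"] Suc.IH) (use Suc.prems in auto)
  finally show ?case using f_sum by simp
qed

end

lemma inverse_one_minus_le:
  fixes x :: real assumes "0 \<le> x" "x \<le> 1 / 2"
  shows "1 / (1 - x) \<le> 1 + x + 2 * x\<^sup>2"
proof -
  have "0 \<le> x\<^sup>2 * (1 - 2 * x)" using assms by simp
  then have "1 \<le> (1 + x + 2 * x\<^sup>2) * (1 - x)" by (simp add: algebra_simps power2_eq_square)
  then show ?thesis using assms by (simp add: pos_divide_le_eq)
qed

section \<open>Survival by a second moment of block chains\<close>

locale block = near_critical f R \<epsilon> p for f :: "(int ^ 'd::finite) \<Rightarrow> real" and R \<epsilon> p +
  fixes m :: nat
  assumes m_pos: "1 \<le> m" and Aeps: "16 ^ m * \<epsilon> \<le> 1"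
begin

abbreviation "A \<equiv> (16::real) ^ m"
abbreviation "rho \<equiv> fpow m"
abbreviation "D \<equiv> reach m 0"

text \<open>Weighting a connection by \<open>rho u / kap u\<close> gives block chains
  mean one. Counting a block connection once, instead of once per open path, halves the
  contribution of double paths to the second moment.\<close>

definition kap :: "(int ^ 'd) \<Rightarrow> real" where "kap u = E (conn m 0 0 u)"
definition wt :: "(int ^ 'd) \<Rightarrow> real" where "wt u = rho u / kap u"

lemma E_conn: "E (conn m n x (x + u)) = kap u"
  unfolding kap_def conn_def by (rule E_shift[of "\<lambda>z. of_bool (0 < z)"])

lemma E_fall2_npaths: "E (\<lambda>X. fall2 (npaths k n x y X)) = E (\<lambda>X. npaths k n x y X * npaths k n x y X) - p ^ k * fpow k (y - x)"
proof -
  have "E (\<lambda>X. fall2 (npaths k n x y X)) = E (\<lambda>X. npaths k n x y X * npaths k n x y X - npaths k n x y X)"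
    by (simp add: fall2_def algebra_simps)
  then show ?thesis using Ev_diff[OF cyl_mult[OF cyl_npaths cyl_npaths] cyl_npaths] by (simp add: E_npaths)
qed

lemma pp: "0 < p ^ m" "1 \<le> p ^ m" using p_ge1 by (auto intro: one_le_power)

abbreviation "tau u \<equiv> E (\<lambda>X. fall2 (npaths m 0 0 u X))"

lemma tau_le: "tau u \<le> A * \<epsilon> * rho u"
  using conjunct2[OF pair_pointwise[of 0 0 m 0 u]] by (simp add: E_fall2_npaths algebra_simps)

lemma tau_le': "tau u \<le> A * \<epsilon> * (p ^ m * rho u)"
proof -
  have "rho u \<le> p ^ m * rho u" using mult_right_mono[OF pp(2) fpow_nonneg[of m u]] by simp
  then have "A * \<epsilon> * rho u \<le> A * \<epsilon> * (p ^ m * rho u)" using eps by (intro mult_left_mono) auto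
  then show ?thesis using tau_le[of u] by linarith
qed

lemma tau_nonneg: "0 \<le> tau u" by (intro Ev_nonneg fall_nonneg)

lemma kap_lower': "p ^ m * rho u - tau u / 2 \<le> kap u"
proof -
  have "E (\<lambda>X. npaths m 0 0 u X - fall2 (npaths m 0 0 u X) / 2) \<le> E (conn m 0 0 u)"
    by (rule Ev_mono[OF cyl_comp[OF cyl_npaths, where F = "\<lambda>z. z - fall2 z / 2"] cyl_conn conn_ge])
  moreover have "E (\<lambda>X. npaths m 0 0 u X - fall2 (npaths m 0 0 u X) / 2) = E (npaths m 0 0 u) - E (\<lambda>X. fall2 (npaths m 0 0 u X) / 2)"
    by (rule Ev_diff[OF cyl_npaths cyl_comp[OF cyl_npaths, where F = "\<lambda>z. fall2 z / 2"]])
  ultimately show ?thesis by (simp add: E_npaths kap_def)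
qed

lemma kap_lower: "p ^ m * rho u * (1 - A * \<epsilon> / 2) \<le> kap u"
proof -
  show ?thesis using tau_le'[of u] kap_lower'[of u] by (simp add: algebra_simps)
qed

lemma kap_nonneg: "0 \<le> kap u" unfolding kap_def by (intro Ev_nonneg conn_nonneg)

lemma kap_pos: "rho u \<noteq> 0 \<Longrightarrow> 0 < kap u"
proof -
  assume "rho u \<noteq> 0"
  then have "0 < rho u" using fpow_nonneg[of m u] by simp
  then have "0 < p ^ m * rho u * (1 - A * \<epsilon> / 2)" using pp Aeps by simp
  then show ?thesis using kap_lower[of u] by linarith
qed

lemma wt_nonneg: "0 \<le> wt u" unfolding wt_def using kap_nonneg fpow_nonneg by simp

lemma wt_kap: "wt u * kap u = rho u"
  using kap_pos[of u] by (cases "rho u = 0") (auto simp: wt_def)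

lemma wt_le: "wt u \<le> (1 + A * \<epsilon>) / p ^ m"
proof (cases "rho u = 0")
  case True then show ?thesis using eps pp by (simp add: wt_def)
next
  case False
  then have r: "0 < rho u" using fpow_nonneg[of m u] by simp
  let ?x = "A * \<epsilon>"
  have x: "0 \<le> ?x" "?x \<le> 1" using eps Aeps by auto
  have k: "0 < p ^ m * rho u * (1 - ?x / 2)" using r pp x by simp
  have "wt u \<le> rho u / (p ^ m * rho u * (1 - ?x / 2))"
    unfolding wt_def using kap_lower[of u] k kap_pos[OF False] r by (intro divide_left_mono) auto
  also have "\<dots> = (1 / (1 - ?x / 2)) / p ^ m"
  proof -
    have g: "a / (q * a * y) = (1 / y) / q" if "a \<noteq> 0" for a q y :: real using that by simp
    show ?thesis by (rule g) (use r in simp)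
  qed
  also have "\<dots> \<le> (1 + ?x) / p ^ m"
  proof (intro divide_right_mono)
    have "0 \<le> ?x * (1 - ?x)" by (rule mult_nonneg_nonneg) (use x in linarith)+
    then have "1 \<le> (1 + ?x) * (1 - ?x / 2)" by (simp add: algebra_simps)
    then show "1 / (1 - ?x / 2) \<le> 1 + ?x" using x by (simp add: pos_divide_le_eq)
  qed (use pp in simp)
  finally show ?thesis .
qed

lemma sum_tau: "(\<Sum>u\<in>D. tau u) = excess p m 0"
proof -
  have "(Qop p ^^ m) ker0 (0 - 0) = (\<Sum>u\<in>D. \<Sum>v\<in>D. E (\<lambda>X. npaths m 0 0 u X * npaths m 0 0 v X) * ker0 (u - v))"
    by (rule E_pair[symmetric]) (auto simp: finite_reach)
  also have "\<dots> = (\<Sum>u\<in>D. \<Sum>v\<in>D. if v = u then E (\<lambda>X. npaths m 0 0 u X * npaths m 0 0 u X) else 0)"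
    by (intro sum.cong refl) (auto simp: ker0_def)
  also have "\<dots> = (\<Sum>u\<in>D. E (\<lambda>X. npaths m 0 0 u X * npaths m 0 0 u X))" by (simp add: finite_reach)
  finally have "(\<Sum>u\<in>D. E (\<lambda>X. npaths m 0 0 u X * npaths m 0 0 u X)) = excess p m 0 + p ^ m"
    by (simp add: Qop_pow_ker0 ker0_def)
  moreover have "(\<Sum>u\<in>D. p ^ m * fpow m (u - 0)) = p ^ m"
    using fpow_sum[OF finite_reach order_refl, of m 0] by (simp flip: sum_distrib_left)
  ultimately show ?thesis by (simp add: E_fall2_npaths sum_subtractf)
qed

text \<open>Each summand is \<open>(rho u)\<^sup>2 / kap u\<close>. The Bonferroni bound for
  \<open>kap\<close> makes it at most \<open>rho u / p ^ m\<close> times \<open>1 / (1 - x)\<close>,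
  where \<open>x\<close> is half the relative excess at \<open>u\<close>. To first order the sum is
  therefore \<open>1 / p ^ m\<close> plus half the excess.\<close>

lemma diag_le: "(\<Sum>u\<in>D. (wt u)\<^sup>2 * kap u) \<le> 1 / p ^ m + excess 1 m 0 / 2 + (A * \<epsilon>)\<^sup>2 / 2"
proof -
  have "(wt u)\<^sup>2 * kap u \<le> rho u / p ^ m + tau u / (2 * p ^ (2 * m)) + rho u * ((A * \<epsilon>)\<^sup>2 / 2)" for u
  proof (cases "rho u = 0")
    case True then show ?thesis using tau_nonneg[of u] pp by (simp add: wt_def)
  next
    case False
    then have r: "0 < rho u" using fpow_nonneg[of m u] by simp
    define x where "x = tau u / (2 * p ^ m * rho u)"
    have pr: "0 < p ^ m * rho u" using pp r by simp
    have x0: "0 \<le> x" unfolding x_def using tau_nonneg pr by simp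
    have x1: "x \<le> A * \<epsilon> / 2" unfolding x_def using pr tau_le'[of u] by (simp add: pos_divide_le_eq mult_ac)
    then have x2: "x \<le> 1 / 2" using Aeps by simp
    have "(wt u)\<^sup>2 * kap u = (rho u)\<^sup>2 / kap u"
      using kap_pos[OF False] by (simp add: wt_def power2_eq_square)
    also have "\<dots> \<le> (rho u)\<^sup>2 / (p ^ m * rho u * (1 - x))"
    proof (intro divide_left_mono)
      have "tau u / 2 = p ^ m * rho u * x"
      proof -
        have g: "a / 2 = q * b * (a / (2 * q * b))" if "q * b \<noteq> 0" for a b q :: real using that by simp
        show ?thesis unfolding x_def by (rule g) (use pr in linarith)
      qed
      then show "p ^ m * rho u * (1 - x) \<le> kap u" using kap_lower'[of u] by (simp add: algebra_simps)
      show "0 < kap u * (p ^ m * rho u * (1 - x))" using kap_pos[OF False] pr x2 by simp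
    qed simp
    also have "\<dots> = rho u / p ^ m * (1 / (1 - x))" using r by (simp add: power2_eq_square)
    also have "\<dots> \<le> rho u / p ^ m * (1 + x + 2 * x\<^sup>2)"
      using inverse_one_minus_le[OF x0 x2] r pp by (intro mult_left_mono) auto
    also have "\<dots> = rho u / p ^ m + tau u / (2 * p ^ (2 * m)) + rho u / p ^ m * (2 * x\<^sup>2)"
    proof -
      have "rho u / p ^ m * x = tau u / (2 * p ^ (2 * m))"
      proof -
        have "p ^ m \<noteq> 0" using pp(1) by linarith
        then show ?thesis unfolding x_def mult_2 power_add using r by (simp add: field_simps)
      qed
      then show ?thesis by (simp add: distrib_left)
    qed
    also have "rho u / p ^ m * (2 * x\<^sup>2) \<le> rho u * ((A * \<epsilon>)\<^sup>2 / 2)"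
    proof (intro mult_mono)
      show "rho u / p ^ m \<le> rho u" using pp r by (simp add: pos_divide_le_eq)
      have "x\<^sup>2 \<le> (A * \<epsilon> / 2)\<^sup>2" using x0 x1 by (intro power_mono)
      then show "2 * x\<^sup>2 \<le> (A * \<epsilon>)\<^sup>2 / 2" by (simp add: power2_eq_square)
    qed (use r in auto)
    finally show ?thesis by simp
  qed
  then have "(\<Sum>u\<in>D. (wt u)\<^sup>2 * kap u) \<le> (\<Sum>u\<in>D. rho u / p ^ m + tau u / (2 * p ^ (2 * m)) + rho u * ((A * \<epsilon>)\<^sup>2 / 2))"
    by (intro sum_mono)
  also have "\<dots> = 1 / p ^ m + excess p m 0 / (2 * p ^ (2 * m)) + (A * \<epsilon>)\<^sup>2 / 2"
    using fpow_sum[OF finite_reach order_refl, of m 0] sum_tau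
    by (simp add: sum.distrib flip: sum_divide_distrib sum_distrib_right)
  \<comment> \<open>\<open>excess_le\<close> costs exactly the factor \<open>p ^ (2 * m)\<close>
    present in the denominator and brings the excess back to density one.\<close>
  also have "excess p m 0 / (2 * p ^ (2 * m)) \<le> excess 1 m 0 / 2"
    using excess_le[OF p_ge1, of m 0] p_ge1 by (simp add: field_simps)
  finally show ?thesis by simp
qed

lemma Qop_one_le: "(Qop p ^^ k) (\<lambda>_. 1) z \<le> 6 ^ k"
proof (induction k arbitrary: z)
  case (Suc k)
  have "Qop p ((Qop p ^^ k) (\<lambda>_. 1)) z \<le> Qop p (\<lambda>_. 6 ^ k) z"
    by (intro Qop_mono Suc p_nonneg)
  also have "\<dots> \<le> 6 ^ Suc k"
  proof (cases "z = 0")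
    case True
    have "Poff (\<lambda>_. 6 ^ k) \<le> 6 ^ k" using Poff_le[of "\<lambda>_. 6 ^ k"] by (simp add: Pop_const)
    then have "p\<^sup>2 * Poff (\<lambda>_. 6 ^ k) \<le> 4 * 6 ^ k" using p2_le by (intro mult_mono Poff_nonneg) auto
    moreover have "p * 6 ^ k \<le> 2 * 6 ^ k" using p_le2 by (intro mult_right_mono) auto
    moreover have "Qop p (\<lambda>_. 6 ^ k) z = p * 6 ^ k + p\<^sup>2 * Poff (\<lambda>_. 6 ^ k)" using True by (simp add: Qop_def)
    ultimately show ?thesis unfolding power_Suc by linarith
  next
    case False then show ?thesis using p2_le by (simp add: Qop_def Pop_const mult_right_mono)
  qed
  finally show ?case by simp
qed simp

text \<open>\<open>V\<close> is a Lyapunov function for the two-replica block kernel: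
  subtracting \<open>Dc\<close> at the origin absorbs the errors made off the diagonal.\<close>

definition Bc :: real where "Bc = real m / \<epsilon>"
text \<open>The covariance error of \<open>lyapunov_off\<close>: 4 bounds a product of two weights,
  \<open>1 + 2 * real m\<close> bounds \<open>V\<close> off the origin, and the last factor comes
  from \<open>E_conn_cov\<close>.\<close>

definition c3 :: real where "c3 = 4 * (1 + 2 * real m) * (2 * real m * 48 ^ m)"
text \<open>The first two terms bound the excess of \<open>Vg 0\<close> over \<open>Bc\<close>. The
  third is the relative block error \<open>19 * A * \<epsilon>\<close> multiplied by
  \<open>V 0\<close>, which is of order \<open>m / \<epsilon>\<close>; the last is the covariance
  error.\<close>

definition Dc :: real where "Dc = 1 + 2 * real m + 19 * A * (1 + 3 * real m) + c3"
definition Vg :: "(int ^ 'd) \<Rightarrow> real" where "Vg z = 1 + Bc * green z"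
definition V :: "(int ^ 'd) \<Rightarrow> real" where "V z = Vg z - Dc * ker0 z"

lemma Bc: "0 < Bc" "Bc * \<epsilon> = real m" using eps m_pos by (auto simp: Bc_def)

lemma Vg_ge1: "1 \<le> Vg z" unfolding Vg_def using Bc green_nonneg by simp

lemma wt2_le: "wt u * wt u' \<le> (1 + 3 * (A * \<epsilon>)) / p ^ (2 * m)"
proof -
  have "wt u * wt u' \<le> ((1 + A * \<epsilon>) / p ^ m) * ((1 + A * \<epsilon>) / p ^ m)"
    using wt_le wt_nonneg eps pp by (intro mult_mono) auto
  also have "\<dots> = ((1 + A * \<epsilon>) * (1 + A * \<epsilon>)) / p ^ (2 * m)" by (simp add: mult_2 power_add)
  also have "\<dots> \<le> (1 + 3 * (A * \<epsilon>)) / p ^ (2 * m)"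
  proof (intro divide_right_mono)
    have "(A * \<epsilon>) * (A * \<epsilon>) \<le> A * \<epsilon> * 1" using eps Aeps by (intro mult_left_mono) auto
    then show "(1 + A * \<epsilon>) * (1 + A * \<epsilon>) \<le> 1 + 3 * (A * \<epsilon>)" by (simp add: algebra_simps)
  qed (use p_ge1 in simp)
  finally show ?thesis .
qed

lemma eps_pow_le: "(1 + 4 * \<epsilon>) ^ m \<le> 1 + 4 * (A * \<epsilon>)" "(1 + 2 * \<epsilon>) ^ Suc m \<le> 1 + 4 * (A * \<epsilon>)"
proof -
  have A2: "2 ^ m * \<epsilon> \<le> A * \<epsilon>" using eps by (intro mult_right_mono power_mono) auto
  have "(1 + 4 * \<epsilon>) ^ m \<le> 1 + (2 ^ m - 1) * (4 * \<epsilon>)" using eps by (intro one_plus_power_le) auto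
  moreover have "(2 ^ m - 1) * (4 * \<epsilon>) = 4 * (2 ^ m * \<epsilon>) - 4 * \<epsilon>" by (simp add: algebra_simps)
  ultimately show "(1 + 4 * \<epsilon>) ^ m \<le> 1 + 4 * (A * \<epsilon>)" using A2 eps by linarith
  have "(1 + 2 * \<epsilon>) ^ Suc m \<le> 1 + (2 ^ Suc m - 1) * (2 * \<epsilon>)" using eps by (intro one_plus_power_le) auto
  moreover have "(2 ^ Suc m - 1) * (2 * \<epsilon>) = 4 * (2 ^ m * \<epsilon>) - 2 * \<epsilon>" by (simp add: algebra_simps)
  ultimately show "(1 + 2 * \<epsilon>) ^ Suc m \<le> 1 + 4 * (A * \<epsilon>)" using A2 eps by linarith
qed

lemma prod_19: "(1 + 3 * (A * \<epsilon>)) * (1 + 4 * (A * \<epsilon>)) \<le> 1 + 19 * (A * \<epsilon>)"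
proof -
  have "(A * \<epsilon>) * (A * \<epsilon>) \<le> A * \<epsilon> * 1" using eps Aeps by (intro mult_left_mono) auto
  then show ?thesis by (simp add: algebra_simps)
qed

definition blk :: "nat \<Rightarrow> (int ^ 'd) \<Rightarrow> (int ^ 'd) \<Rightarrow> (int ^ 'd) \<Rightarrow> (int ^ 'd) \<Rightarrow> real" where
  "blk n x x' u u' = wt u * wt u' * E (\<lambda>X. conn m n x (x + u) X * conn m n x' (x' + u') X)"

lemma blk_nonneg: "0 \<le> blk n x x' u u'"
  unfolding blk_def by (intro mult_nonneg_nonneg wt_nonneg Ev_nonneg conn_nonneg)

lemma blk_le: "blk n x x' u u' \<le> (1 + 3 * (A * \<epsilon>)) / p ^ (2 * m) * E (\<lambda>X. npaths m n x (x + u) X * npaths m n x' (x' + u') X)"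
  unfolding blk_def
proof (intro mult_mono wt2_le Ev_nonneg mult_nonneg_nonneg conn_nonneg)
  show "E (\<lambda>X. conn m n x (x + u) X * conn m n x' (x' + u') X) \<le> E (\<lambda>X. npaths m n x (x + u) X * npaths m n x' (x' + u') X)"
    by (rule Ev_mono[OF cyl_mult[OF cyl_conn cyl_conn] cyl_mult[OF cyl_npaths cyl_npaths]])
      (intro mult_mono conn_le npaths_nonneg conn_nonneg)
qed (use eps p_ge1 in auto)

lemma reach_D: "(\<lambda>u. x + u) ` D = reach m x"
  using reach_shift[of m 0 x] by (simp add: add.commute)

lemma sum_D: "(\<Sum>u\<in>D. F (x + u)) = (\<Sum>y\<in>reach m x. F y)"
  using sum.reindex[of "\<lambda>u. x + u" D F] reach_D[of x] by (simp add: comp_def)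

text \<open>Replaces connections by path counts at the relative cost
  \<open>3 * A * \<epsilon>\<close>. This is too crude for distant pairs, whose mass must be one up
  to an error proportional to their chance of meeting; those are treated by
  \<open>E_conn_cov\<close>.\<close>

lemma sum_blk_le:
  assumes "\<And>z. 0 \<le> h z"
  shows "(\<Sum>u\<in>D. \<Sum>u'\<in>D. blk n x x' u u' * h (x + u - (x' + u'))) \<le> (1 + 3 * (A * \<epsilon>)) / p ^ (2 * m) * (Qop p ^^ m) h (x - x')"
proof -
  have "(\<Sum>u\<in>D. \<Sum>u'\<in>D. blk n x x' u u' * h (x + u - (x' + u')))
    \<le> (\<Sum>u\<in>D. \<Sum>u'\<in>D. ((1 + 3 * (A * \<epsilon>)) / p ^ (2 * m) * E (\<lambda>X. npaths m n x (x + u) X * npaths m n x' (x' + u') X)) * h (x + u - (x' + u')))"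
    by (intro sum_mono mult_right_mono blk_le assms)
  also have "\<dots> = (1 + 3 * (A * \<epsilon>)) / p ^ (2 * m) * (\<Sum>u\<in>D. \<Sum>u'\<in>D. E (\<lambda>X. npaths m n x (x + u) X * npaths m n x' (x' + u') X) * h (x + u - (x' + u')))"
    by (simp add: sum_distrib_left mult.assoc)
  also have "(\<Sum>u\<in>D. \<Sum>u'\<in>D. E (\<lambda>X. npaths m n x (x + u) X * npaths m n x' (x' + u') X) * h (x + u - (x' + u')))
    = (\<Sum>y\<in>reach m x. \<Sum>y'\<in>reach m x'. E (\<lambda>X. npaths m n x y X * npaths m n x' y' X) * h (y - y'))"
  proof -
    have "(\<Sum>u'\<in>D. E (\<lambda>X. npaths m n x (x + u) X * npaths m n x' (x' + u') X) * h (x + u - (x' + u')))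
      = (\<Sum>y'\<in>reach m x'. E (\<lambda>X. npaths m n x (x + u) X * npaths m n x' y' X) * h (x + u - y'))" for u
      by (rule sum_D)
    then show ?thesis
      using sum_D[of "\<lambda>y. \<Sum>y'\<in>reach m x'. E (\<lambda>X. npaths m n x y X * npaths m n x' y' X) * h (y - y')" x] by simp
  qed
  also have "\<dots> = (Qop p ^^ m) h (x - x')" by (rule E_pair) (auto simp: finite_reach)
  finally show ?thesis .
qed


text \<open>The drop \<open>Bc * ?S\<close> of the Green term over a free block pays for the errors.
  Pairs that end apart follow the free kernel \<open>rho u * rho u'\<close> up to a covariance error
  proportional to \<open>?S\<close>. Pairs that end together are bounded by path counts, with mass a
  multiple of \<open>?S + ret m ?z\<close>; there \<open>V\<close> is smaller than \<open>Vg\<close>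
  by \<open>Dc\<close>.\<close>

lemma lyapunov_off:
  assumes xx: "x \<noteq> x'" and V0: "0 \<le> V 0" and e1: "\<epsilon> * Dc \<le> real m"
  shows "(\<Sum>u\<in>D. \<Sum>u'\<in>D. blk n x x' u u' * V (x + u - (x' + u'))) \<le> V (x - x')"
proof -
  let ?z = "x - x'" and ?ae = "A * \<epsilon>"
  let ?S = "\<Sum>n=1..<m. ret n (x - x')"
  let ?d = "\<lambda>u u'. x + u - (x' + u')"
  have z: "?z \<noteq> 0" using xx by simp
  have ae: "0 \<le> ?ae" using eps by simp
  have S0: "0 \<le> ?S" by (intro sum_nonneg ret_nonneg)
  have Vz: "V w = Vg w" if "w \<noteq> 0" for w using that by (simp add: V_def ker0_def)
  have Voff: "V w \<le> 1 + 2 * real m" "0 \<le> V w" if "w \<noteq> 0" for w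
  proof -
    have "Bc * green w \<le> Bc * (2 * \<epsilon>)" using green_le[of w] that Bc by (intro mult_left_mono) (auto simp: ker0_def)
    moreover have "Bc * (2 * \<epsilon>) = 2 * real m" using Bc(2) by simp
    ultimately show "V w \<le> 1 + 2 * real m" unfolding Vz[OF that] Vg_def by linarith
    show "0 \<le> V w" using Vg_ge1[of w] that by (simp add: Vz)
  qed
  have Vpos: "0 \<le> V w" for w using Voff(2)[of w] V0 by (cases "w = 0") auto
  have sumS: "(\<Sum>n\<le>m. ret n ?z) = ?S + ret m ?z" "(\<Sum>n<m. ret n ?z) = ?S"
  proof -
    have m: "{..<m} = insert 0 {1..<m}" using m_pos by auto
    show "(\<Sum>n<m. ret n ?z) = ?S" unfolding m using z by (simp add: ret_0)
    then show "(\<Sum>n\<le>m. ret n ?z) = ?S + ret m ?z" by (simp add: lessThan_Suc_atMost[symmetric])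
  qed
  let ?f = "1 + 19 * ?ae"
  have diag: "(\<Sum>u\<in>D. \<Sum>u'\<in>D. blk n x x' u u' * ker0 (?d u u')) \<le> ?f * (?S + ret m ?z)"
  proof -
    have "(\<Sum>u\<in>D. \<Sum>u'\<in>D. blk n x x' u u' * ker0 (?d u u')) \<le> (1 + 3 * ?ae) / p ^ (2 * m) * (Qop p ^^ m) ker0 ?z"
      by (rule sum_blk_le) (simp add: ker0_def)
    also have "\<dots> \<le> (1 + 3 * ?ae) / p ^ (2 * m) * (p ^ (2 * m) * ((1 + 4 * \<epsilon>) ^ m * (\<Sum>n\<le>m. ret n ?z)))"
      using ae p_ge1 by (intro mult_left_mono Qop_pow_ker0_le) auto
    also have "\<dots> = (1 + 3 * ?ae) * (1 + 4 * \<epsilon>) ^ m * (?S + ret m ?z)"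
      unfolding sumS using p_ge1 by simp
    also have "\<dots> \<le> ?f * (?S + ret m ?z)"
    proof (intro mult_right_mono)
      have "(1 + 3 * ?ae) * (1 + 4 * \<epsilon>) ^ m \<le> (1 + 3 * ?ae) * (1 + 4 * ?ae)"
        using ae eps_pow_le by (intro mult_left_mono) auto
      then show "(1 + 3 * ?ae) * (1 + 4 * \<epsilon>) ^ m \<le> ?f" using prod_19 by linarith
    qed (use S0 ret_nonneg in auto)
    finally show ?thesis .
  qed
  obtain c where c: "\<And>y y'. y \<in> reach m x \<Longrightarrow> y' \<in> reach m x' \<Longrightarrow> 0 \<le> c y y' \<and>
      E (\<lambda>X. conn m n x y X * conn m n x' y' X) \<le> E (conn m n x y) * E (conn m n x' y') + c y y'"
    and csum: "(\<Sum>y\<in>reach m x. \<Sum>y'\<in>reach m x'. c y y') \<le> p * (\<Sum>j<m. (Qop p ^^ j) ker0 ?z * (Qop p ^^ (m - Suc j)) (\<lambda>_. 1) 0)"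
    using E_conn_cov[OF finite_reach finite_reach, where n = n and x = x and k = m and x' = x'] by blast
  have cs: "(\<Sum>u\<in>D. \<Sum>u'\<in>D. c (x + u) (x' + u')) \<le> 2 * real m * 48 ^ m * ?S"
  proof -
    have "(\<Sum>u\<in>D. \<Sum>u'\<in>D. c (x + u) (x' + u')) = (\<Sum>y\<in>reach m x. \<Sum>y'\<in>reach m x'. c y y')"
      using sum_D[of "\<lambda>y. \<Sum>u'\<in>D. c y (x' + u')" x] by (simp add: sum_D)
    also note csum
    \<comment> \<open>48 is the product of 4 and 2 from \<open>Qop_pow_ker0_le\<close> and of 6 from
      \<open>Qop_one_le\<close>.\<close>
    also have "p * (\<Sum>j<m. (Qop p ^^ j) ker0 ?z * (Qop p ^^ (m - Suc j)) (\<lambda>_. 1) 0) \<le> 2 * (\<Sum>j<m. 48 ^ m * ?S)"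
    proof (rule mult_mono, rule p_le2, rule sum_mono)
      fix j assume j: "j \<in> {..<m}"
      have "(Qop p ^^ j) ker0 ?z \<le> p ^ (2 * j) * ((1 + 4 * \<epsilon>) ^ j * (\<Sum>n\<le>j. ret n ?z))"
        by (rule Qop_pow_ker0_le[OF p_ge1])
      also have "\<dots> \<le> 4 ^ m * (2 ^ m * ?S)"
      proof (intro mult_mono)
        have "p ^ (2 * j) = (p\<^sup>2) ^ j" by (simp add: power_mult)
        also have "\<dots> \<le> 4 ^ j" using p2_le by (intro power_mono) auto
        also have "\<dots> \<le> (4::real) ^ m" using j by (intro power_increasing) auto
        finally show "p ^ (2 * j) \<le> 4 ^ m" .
        have "(1 + 4 * \<epsilon>) ^ j \<le> 2 ^ j" using eps by (intro power_mono) auto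
        also have "\<dots> \<le> (2::real) ^ m" using j by (intro power_increasing) auto
        finally show "(1 + 4 * \<epsilon>) ^ j \<le> 2 ^ m" .
        have "(\<Sum>n\<le>j. ret n ?z) \<le> (\<Sum>n<m. ret n ?z)" using j by (intro sum_mono2 ret_nonneg) auto
        then show "(\<Sum>n\<le>j. ret n ?z) \<le> ?S" by (simp only: sumS)
      qed (use S0 eps p_ge1 in \<open>auto intro!: sum_nonneg mult_nonneg_nonneg ret_nonneg\<close>)
      finally have 1: "(Qop p ^^ j) ker0 ?z \<le> 8 ^ m * ?S" by (simp add: power_mult_distrib[symmetric] mult.assoc[symmetric])
      have "(Qop p ^^ (m - Suc j)) (\<lambda>_. 1) 0 \<le> 6 ^ (m - Suc j)" by (rule Qop_one_le)
      also have "\<dots> \<le> (6::real) ^ m" by (intro power_increasing) auto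
      finally have "(Qop p ^^ j) ker0 ?z * (Qop p ^^ (m - Suc j)) (\<lambda>_. 1) 0 \<le> (8 ^ m * ?S) * 6 ^ m"
        using 1 S0 p_nonneg by (intro mult_mono Qop_pow_nonneg) auto
      also have "(8 ^ m * ?S) * 6 ^ m = (8 ^ m * 6 ^ m) * ?S" by (simp only: mult_ac)
      also have "(8::real) ^ m * 6 ^ m = 48 ^ m" by (simp flip: power_mult_distrib)
      finally show "(Qop p ^^ j) ker0 ?z * (Qop p ^^ (m - Suc j)) (\<lambda>_. 1) 0 \<le> 48 ^ m * ?S" .
    qed (use p_nonneg in \<open>auto intro!: sum_nonneg mult_nonneg_nonneg Qop_pow_nonneg simp: ker0_def\<close>)
    also have "\<dots> = 2 * real m * 48 ^ m * ?S" by simp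
    finally show ?thesis .
  qed
  have blk_cov: "blk n x x' u u' \<le> rho u * rho u' + 4 * c (x + u) (x' + u')" if "u \<in> D" "u' \<in> D" for u u'
  proof -
    have in_r: "x + u \<in> reach m x" "x' + u' \<in> reach m x'" using that reach_D by blast+
    have "blk n x x' u u' \<le> wt u * wt u' * (kap u * kap u' + c (x + u) (x' + u'))"
      unfolding blk_def using c[OF in_r] wt_nonneg
      by (intro mult_left_mono) (auto simp: E_conn)
    also have "\<dots> = (wt u * kap u) * (wt u' * kap u') + wt u * wt u' * c (x + u) (x' + u')" by (simp add: algebra_simps)
    also have "\<dots> \<le> rho u * rho u' + 4 * c (x + u) (x' + u')"
      unfolding wt_kap
    proof (intro add_left_mono mult_right_mono)
      have "wt u * wt u' \<le> (1 + 3 * ?ae) / p ^ (2 * m)" by (rule wt2_le)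
      also have "\<dots> \<le> (1 + 3 * ?ae) / 1" using ae p_ge1 by (intro divide_left_mono one_le_power) auto
      also have "\<dots> \<le> 4" using Aeps by simp
      finally show "wt u * wt u' \<le> 4" .
    qed (use c[OF in_r] in auto)
    finally show ?thesis .
  qed
  have rho_pair: "(\<Sum>u\<in>D. \<Sum>u'\<in>D. rho u * rho u' * h (?d u u')) = (Pop ^^ m) h ?z" for h
  proof -
    have "(\<Sum>u\<in>D. \<Sum>u'\<in>D. rho u * rho u' * h (?d u u')) = (\<Sum>y\<in>reach m x. \<Sum>y'\<in>reach m x'. fpow m (y - x) * fpow m (y' - x') * h (y - y'))"
    proof -
      have "(\<Sum>u'\<in>D. rho u * rho u' * h (x + u - (x' + u'))) = (\<Sum>y'\<in>reach m x'. rho u * fpow m (y' - x') * h (x + u - y'))" for u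
        using sum_D[of "\<lambda>y'. rho u * fpow m (y' - x') * h (x + u - y')" x'] by simp
      then show ?thesis
        using sum_D[of "\<lambda>y. \<Sum>y'\<in>reach m x'. fpow m (y - x) * fpow m (y' - x') * h (y - y')" x] by simp
    qed
    also have "\<dots> = (Pop ^^ m) h ?z" by (rule fpow_pair) (auto simp: finite_reach)
    finally show ?thesis .
  qed
  have "(\<Sum>u\<in>D. \<Sum>u'\<in>D. blk n x x' u u' * V (?d u u'))
    \<le> (\<Sum>u\<in>D. \<Sum>u'\<in>D. V 0 * (blk n x x' u u' * ker0 (?d u u'))
        + (rho u * rho u' * Vg (?d u u') - Vg 0 * (rho u * rho u' * ker0 (?d u u')))
        + 4 * (1 + 2 * real m) * c (x + u) (x' + u'))"
  proof (intro sum_mono)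
    fix u u' assume u: "u \<in> D" "u' \<in> D"
    have c0: "0 \<le> c (x + u) (x' + u')" using c reach_D u by blast
    show "blk n x x' u u' * V (?d u u') \<le> V 0 * (blk n x x' u u' * ker0 (?d u u'))
        + (rho u * rho u' * Vg (?d u u') - Vg 0 * (rho u * rho u' * ker0 (?d u u')))
        + 4 * (1 + 2 * real m) * c (x + u) (x' + u')"
    proof (cases "?d u u' = 0")
      case True
      then show ?thesis using c0 by (simp add: ker0_def)
    next
      case False
      have "blk n x x' u u' * V (?d u u') \<le> (rho u * rho u' + 4 * c (x + u) (x' + u')) * V (?d u u')"
        using Voff[OF False] by (intro mult_right_mono blk_cov u) auto
      also have "\<dots> \<le> rho u * rho u' * V (?d u u') + 4 * c (x + u) (x' + u') * (1 + 2 * real m)"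
        unfolding distrib_right using Voff[OF False] c0 by (intro add_left_mono mult_left_mono) auto
      finally show ?thesis using False by (simp add: ker0_def Vz algebra_simps)
    qed
  qed
  also have "\<dots> = V 0 * (\<Sum>u\<in>D. \<Sum>u'\<in>D. blk n x x' u u' * ker0 (?d u u'))
      + ((\<Sum>u\<in>D. \<Sum>u'\<in>D. rho u * rho u' * Vg (?d u u')) - Vg 0 * (\<Sum>u\<in>D. \<Sum>u'\<in>D. rho u * rho u' * ker0 (?d u u')))
      + 4 * (1 + 2 * real m) * (\<Sum>u\<in>D. \<Sum>u'\<in>D. c (x + u) (x' + u'))"
    by (simp add: sum.distrib sum_subtractf sum_distrib_left)
  also have "\<dots> = V 0 * (\<Sum>u\<in>D. \<Sum>u'\<in>D. blk n x x' u u' * ker0 (?d u u'))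
      + ((Pop ^^ m) Vg ?z - Vg 0 * (Pop ^^ m) ker0 ?z)
      + 4 * (1 + 2 * real m) * (\<Sum>u\<in>D. \<Sum>u'\<in>D. c (x + u) (x' + u'))"
    unfolding rho_pair ..
  also have "V 0 * (\<Sum>u\<in>D. \<Sum>u'\<in>D. blk n x x' u u' * ker0 (?d u u'))
      + ((Pop ^^ m) Vg ?z - Vg 0 * (Pop ^^ m) ker0 ?z)
      + 4 * (1 + 2 * real m) * (\<Sum>u\<in>D. \<Sum>u'\<in>D. c (x + u) (x' + u'))
    \<le> V 0 * (?f * (?S + ret m ?z)) + (Vg ?z - Bc * ?S - Vg 0 * ret m ?z) + 4 * (1 + 2 * real m) * (2 * real m * 48 ^ m * ?S)"
  proof (intro add_mono mult_left_mono diag cs V0)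
    have "(Pop ^^ m) Vg ?z = Vg ?z - Bc * ?S"
      unfolding Vg_def[abs_def] Pop_pow_affine Pop_pow_green sumS by (simp add: algebra_simps)
    moreover have "(Pop ^^ m) ker0 ?z = ret m ?z" by (simp add: ret_def)
    ultimately show "(Pop ^^ m) Vg ?z - Vg 0 * (Pop ^^ m) ker0 ?z \<le> Vg ?z - Bc * ?S - Vg 0 * ret m ?z" by simp
  qed simp
  \<comment> \<open>Errors are collected by the visits before time \<open>m\<close> and at time
    \<open>m\<close>. The first coefficient is paid by the drop \<open>Bc\<close>, the second by the
    value \<open>Vg 0\<close> subtracted from the free kernel; \<open>Dc\<close> makes both
    nonpositive.\<close>
  also have "\<dots> = Vg ?z + ?S * (V 0 * ?f - Bc + c3) + ret m ?z * (V 0 * ?f - Vg 0)"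
    by (simp add: c3_def algebra_simps)
  also have "\<dots> \<le> Vg ?z + ?S * 0 + ret m ?z * 0"
  proof (intro add_mono mult_left_mono order_refl S0 ret_nonneg)
    have V00: "V 0 = Vg 0 - Dc" by (simp add: V_def ker0_def)
    have "Bc * green 0 \<le> Bc * (1 + 2 * \<epsilon>)" using green_le[of 0] Bc by (intro mult_left_mono) (auto simp: ker0_def)
    then have Vg0: "Vg 0 \<le> 1 + Bc + 2 * real m" using Bc by (simp add: Vg_def algebra_simps)
    have c3: "0 \<le> c3" by (simp add: c3_def)
    then have D0: "0 \<le> Dc" unfolding Dc_def by simp
    have "V 0 * ?ae \<le> (1 + Bc + 2 * real m) * ?ae"
      using Vg0 D0 ae by (intro mult_right_mono) (auto simp: V00)
    also have "\<dots> = A * (\<epsilon> * (1 + 2 * real m) + real m)" using Bc by (simp add: algebra_simps)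
    also have "\<dots> \<le> A * (1 * (1 + 2 * real m) + real m)" using eps by (intro mult_left_mono add_right_mono mult_right_mono) auto
    finally have "V 0 * ?ae \<le> A * (1 + 3 * real m)" by (simp add: algebra_simps)
    then have main: "V 0 * ?f \<le> Vg 0 - Dc + 19 * A * (1 + 3 * real m)" unfolding V00 by (simp add: algebra_simps)
    show "V 0 * ?f - Bc + c3 \<le> 0" using main Vg0 unfolding Dc_def by linarith
    show "V 0 * ?f - Vg 0 \<le> 0" using main c3 unfolding Dc_def by linarith
  qed
  finally show ?thesis using z by (simp add: Vz)
qed

text \<open>A pair that starts together ends the block together with weight at most
  \<open>1 - (harm m + 2) * \<epsilon>\<close>. As \<open>V 0\<close> is about
  \<open>m / \<epsilon>\<close>, this loses about \<open>m * (harm m + 2)\<close>, while the pairs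
  that end apart contribute about \<open>m * (harm m + 1)\<close>. The surplus \<open>m\<close>
  absorbs the lower-order terms, as \<open>e2\<close> demands.\<close>

lemma lyapunov_diag:
  assumes P: "1 / p ^ m + excess 1 m 0 / 2 + (A * \<epsilon>)\<^sup>2 / 2 \<le> 1 - (harm m + 2) * \<epsilon>"
    and e2: "\<epsilon> * (Dc * (harm m + 2) + 19 * A * real m * (1 + harm m)) \<le> real m"
  shows "(\<Sum>u\<in>D. \<Sum>u'\<in>D. blk n x x u u' * V (x + u - (x + u'))) \<le> V 0"
proof -
  let ?ae = "A * \<epsilon>"
  define v where "v z = (if z = 0 then 0 else 1 + Bc * green z)" for z
  have v0: "0 \<le> v z" for z using Bc green_nonneg[of z] by (simp add: v_def)
  have H: "0 \<le> (harm m :: real)" by (simp add: harm_nonneg)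
  have D0: "0 \<le> Dc" unfolding Dc_def c3_def by simp
  have e2': "\<epsilon> * Dc * (harm m + 2) + \<epsilon> * (19 * A * real m * (1 + harm m)) \<le> real m"
    using e2 by (simp add: algebra_simps)
  have V0: "1 + Bc - Dc \<le> V 0"
  proof -
    have "1 \<le> green 0" using sum_ret_le_green[of "{0}" 0] by (simp add: ret_0)
    then show ?thesis using Bc mult_left_mono[of 1 "green 0" Bc] by (simp add: V_def Vg_def ker0_def)
  qed
  have eD: "\<epsilon> * Dc \<le> real m"
  proof -
    have "\<epsilon> * Dc * 1 \<le> \<epsilon> * Dc * (harm m + 2)" using eps D0 H by (intro mult_left_mono) auto
    moreover have "0 \<le> \<epsilon> * (19 * A * real m * (1 + harm m))" using eps H by simp
    ultimately show ?thesis using e2' by linarith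
  qed
  have "Dc \<le> Bc" unfolding Bc_def using eD eps by (simp add: pos_le_divide_eq mult.commute)
  then have V0p: "0 \<le> V 0" using V0 by simp
  have Vv: "V z = V 0 * ker0 z + v z" for z by (auto simp: v_def V_def Vg_def ker0_def)
  have dg: "(\<Sum>u\<in>D. \<Sum>u'\<in>D. blk n x x u u' * ker0 (x + u - (x + u'))) = (\<Sum>u\<in>D. (wt u)\<^sup>2 * kap u)"
  proof -
    have cc: "conn m n x y X * conn m n x y X = conn m n x y X" for y X by (simp add: conn_def)
    have "(\<Sum>u\<in>D. \<Sum>u'\<in>D. blk n x x u u' * ker0 (x + u - (x + u'))) = (\<Sum>u\<in>D. \<Sum>u'\<in>D. if u' = u then (wt u)\<^sup>2 * kap u else 0)"
      by (intro sum.cong refl) (auto simp: ker0_def blk_def cc E_conn power2_eq_square)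
    then show ?thesis by (simp add: finite_reach)
  qed
  have off: "(\<Sum>u\<in>D. \<Sum>u'\<in>D. blk n x x u u' * v (x + u - (x + u'))) \<le> (1 + 19 * ?ae) * (real m * (1 + harm m))"
  proof -
    have "(\<Sum>u\<in>D. \<Sum>u'\<in>D. blk n x x u u' * v (x + u - (x + u'))) \<le> (1 + 3 * ?ae) / p ^ (2 * m) * (Qop p ^^ m) v (x - x)"
      by (rule sum_blk_le) (rule v0)
    also have "\<dots> \<le> (1 + 3 * ?ae) / p ^ (2 * m) * (p ^ (2 * m) * ((1 + 2 * \<epsilon>) ^ Suc m * (\<Sum>j=1..m. 1 + Bc * (\<epsilon> / real j))))"
      using Qop_pow_off_le[OF p_ge1, of Bc m] Bc eps p_ge1 unfolding v_def[abs_def] by (intro mult_left_mono) auto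
    also have "\<dots> = (1 + 3 * ?ae) * (1 + 2 * \<epsilon>) ^ Suc m * (\<Sum>j=1..m. 1 + Bc * (\<epsilon> / real j))"
      using p_ge1 by simp
    also have "(\<Sum>j=1..m. 1 + Bc * (\<epsilon> / real j)) = real m * (1 + harm m)"
      using Bc by (simp add: sum.distrib harm_def distrib_left sum_distrib_left divide_inverse flip: mult.assoc)
    also have "(1 + 3 * ?ae) * (1 + 2 * \<epsilon>) ^ Suc m * (real m * (1 + harm m)) \<le> (1 + 19 * ?ae) * (real m * (1 + harm m))"
    proof (intro mult_right_mono)
      have "(1 + 3 * ?ae) * (1 + 2 * \<epsilon>) ^ Suc m \<le> (1 + 3 * ?ae) * (1 + 4 * ?ae)"
        using eps eps_pow_le by (intro mult_left_mono) auto
      then show "(1 + 3 * ?ae) * (1 + 2 * \<epsilon>) ^ Suc m \<le> 1 + 19 * ?ae" using prod_19 by linarith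
    qed (use H in auto)
    finally show ?thesis .
  qed
  have "(\<Sum>u\<in>D. \<Sum>u'\<in>D. blk n x x u u' * V (x + u - (x + u')))
    = V 0 * (\<Sum>u\<in>D. \<Sum>u'\<in>D. blk n x x u u' * ker0 (x + u - (x + u'))) + (\<Sum>u\<in>D. \<Sum>u'\<in>D. blk n x x u u' * v (x + u - (x + u')))"
    by (subst Vv) (simp add: distrib_left sum.distrib sum_distrib_left mult_ac)
  also have "\<dots> \<le> V 0 * (1 - (harm m + 2) * \<epsilon>) + (1 + 19 * ?ae) * (real m * (1 + harm m))"
    unfolding dg using diag_le P V0p by (intro add_mono mult_left_mono off) auto
  also have "\<dots> \<le> V 0"
  proof -
    have "(Bc - Dc) * ((harm m + 2) * \<epsilon>) \<le> V 0 * ((harm m + 2) * \<epsilon>)"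
      using V0 H eps by (intro mult_right_mono) auto
    moreover have "(Bc - Dc) * ((harm m + 2) * \<epsilon>) = (Bc * \<epsilon>) * (harm m + 2) - \<epsilon> * Dc * (harm m + 2)"
      by (simp add: algebra_simps)
    ultimately have "real m * (harm m + 2) - \<epsilon> * Dc * (harm m + 2) \<le> V 0 * ((harm m + 2) * \<epsilon>)"
      unfolding Bc(2) by simp
    then show ?thesis using e2' by (simp add: algebra_simps)
  qed
  finally show ?thesis .
qed


lemma V_ge1:
  assumes "\<epsilon> * Dc \<le> real m" shows "1 \<le> V z"
proof (cases "z = 0")
  case True
  have "1 \<le> green 0" using sum_ret_le_green[of "{0}" 0] by (simp add: ret_0)
  moreover have "Dc \<le> Bc" unfolding Bc_def using assms eps by (simp add: pos_le_divide_eq mult.commute)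
  moreover have "Bc * 1 \<le> Bc * green 0" using Bc calculation(1) by (intro mult_left_mono) auto
  ultimately show ?thesis using True by (simp add: V_def Vg_def ker0_def)
next
  case False then show ?thesis using Vg_ge1[of z] by (simp add: V_def ker0_def)
qed

section \<open>Chains of connected blocks and the second-moment method\<close>

primrec chain :: "nat \<Rightarrow> nat \<Rightarrow> (int ^ 'd) \<Rightarrow> 'd config \<Rightarrow> real" where
  "chain 0 n x X = 1"
| "chain (Suc N) n x X = (\<Sum>u\<in>D. (wt u * conn m n x (x + u) X) * chain N (n + m) (x + u) X)"

lemma cyl_chain: "cyl n (n + N * m) (chain N n x)"
proof (induction N arbitrary: n x)
  case 0
  have "chain 0 n x = (\<lambda>X. 1)" by (simp add: fun_eq_iff)
  then show ?case by simp
next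
  case (Suc N)
  have "cyl n (n + Suc N * m) (\<lambda>X. \<Sum>u\<in>D. (wt u * conn m n x (x + u) X) * chain N (n + m) (x + u) X)"
  proof (intro cyl_sum cyl_mult cyl_const)
    fix u
    show "cyl n (n + Suc N * m) (conn m n x (x + u))" by (rule cyl_mono[OF cyl_conn]) auto
    show "cyl n (n + Suc N * m) (chain N (n + m) (x + u))" by (rule cyl_mono[OF Suc]) auto
  qed
  then show ?case by (subst chain.simps(2)[abs_def])
qed

lemma E_chain: "E (chain N n x) = 1"
proof (induction N arbitrary: n x)
  case 0
  have "chain 0 n x = (\<lambda>X. 1)" by (simp add: fun_eq_iff)
  then show ?case by simp
next
  case (Suc N)
  have c1: "cyl n (n + m) (\<lambda>X. wt u * conn m n x (x + u) X)" for u by (intro cyl_mult cyl_const cyl_conn)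
  have "E (chain (Suc N) n x) = (\<Sum>u\<in>D. E (\<lambda>X. (wt u * conn m n x (x + u) X) * chain N (n + m) (x + u) X))"
    unfolding chain.simps(2)[abs_def]
    by (rule Ev_sum[where a = n and b = "n + m + N * m"], rule cyl_mult[OF cyl_mono[OF c1] cyl_mono[OF cyl_chain]]) auto
  also have "\<dots> = (\<Sum>u\<in>D. rho u)"
    by (simp add: E_mult[OF c1 cyl_chain] Suc E_conn wt_kap)
  finally show ?case using fpow_sum[OF finite_reach order_refl, of m 0] by (simp del: chain.simps)
qed

text \<open>\<open>V\<close> dominates one and is superharmonic for the two-replica kernel
  \<open>blk\<close>, so induction over the blocks bounds all second moments uniformly in
  \<open>N\<close>.\<close>

lemma E_chain2:
  assumes ly: "\<And>n x x'. (\<Sum>u\<in>D. \<Sum>u'\<in>D. blk n x x' u u' * V (x + u - (x' + u'))) \<le> V (x - x')"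
    and V1: "\<And>z. 1 \<le> V z"
  shows "E (\<lambda>X. chain N n x X * chain N n x' X) \<le> V (x - x')"
proof (induction N arbitrary: n x x')
  case 0 then show ?case using V1 by simp
next
  case (Suc N)
  let ?A = "\<lambda>i X. (wt (fst i) * wt (snd i)) * (conn m n x (x + fst i) X * conn m n x' (x' + snd i) X)"
  let ?B = "\<lambda>i X. chain N (n + m) (x + fst i) X * chain N (n + m) (x' + snd i) X"
  have c1: "cyl n (n + m) (?A i)" for i by (intro cyl_mult cyl_const cyl_conn)
  have c2: "cyl (n + m) (n + m + N * m) (?B i)" for i by (intro cyl_mult cyl_chain)
  have "E (\<lambda>X. chain (Suc N) n x X * chain (Suc N) n x' X) = E (\<lambda>X. \<Sum>i\<in>D \<times> D. ?A i X * ?B i X)"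
    unfolding chain.simps(2) sum_product sum.cartesian_product'[of _ D D] by (simp add: mult_ac)
  also have "\<dots> = (\<Sum>i\<in>D \<times> D. E (\<lambda>X. ?A i X * ?B i X))"
    by (rule Ev_sum[where a = n and b = "n + m + N * m"], rule cyl_mult[OF cyl_mono[OF c1] cyl_mono[OF c2]]) auto
  also have "\<dots> = (\<Sum>i\<in>D \<times> D. blk n x x' (fst i) (snd i) * E (?B i))"
    by (simp add: E_mult[OF c1 c2] blk_def)
  also have "\<dots> \<le> (\<Sum>i\<in>D \<times> D. blk n x x' (fst i) (snd i) * V (x + fst i - (x' + snd i)))"
    by (intro sum_mono mult_left_mono Suc blk_nonneg)
  also have "\<dots> \<le> V (x - x')" using ly[of n x x'] by (simp add: sum.cartesian_product'[of _ D D])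
  finally show ?case .
qed

lemma chain_path_sum: "chain N n x X \<noteq> 0 \<Longrightarrow> path_sum (N * m) (\<lambda>_. 1) n x X > 0"
proof (induction N arbitrary: n x)
  case (Suc N)
  then obtain u where u: "u \<in> D" "conn m n x (x + u) X \<noteq> 0" "chain N (n + m) (x + u) X \<noteq> 0"
    by (auto elim!: sum.not_neutral_contains_not_neutral)
  have 1: "0 < npaths m n x (x + u) X" using u(2) by (simp add: conn_def split: if_splits)
  have 2: "0 < path_sum (N * m) (\<lambda>_. 1) (n + m) (x + u) X" using Suc.IH[OF u(3)] .
  have "path_sum (Suc N * m) (\<lambda>_. 1) n x X = (\<Sum>y\<in>reach m x. npaths m n x y X * path_sum (N * m) (\<lambda>_. 1) (n + m) y X)"
    by (simp add: path_sum_add) (rule path_sum_sum[OF finite_reach order_refl])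
  also have "\<dots> \<ge> npaths m n x (x + u) X * path_sum (N * m) (\<lambda>_. 1) (n + m) (x + u) X"
    using reach_D[of x] u(1)
    by (intro member_le_sum[of _ _ "\<lambda>y. npaths m n x y X * path_sum (N * m) (\<lambda>_. 1) (n + m) y X"] finite_reach mult_nonneg_nonneg npaths_nonneg path_sum_nonneg) auto
  moreover have "0 < npaths m n x (x + u) X * path_sum (N * m) (\<lambda>_. 1) (n + m) (x + u) X" using 1 2 by simp
  ultimately show ?case by linarith
qed simp

theorem survival:
  assumes P: "1 / p ^ m + excess 1 m 0 / 2 + (A * \<epsilon>)\<^sup>2 / 2 \<le> 1 - (harm m + 2) * \<epsilon>"
    and e2: "\<epsilon> * (Dc * (harm m + 2) + 19 * A * real m * (1 + harm m)) \<le> real m"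
  shows "\<exists>c>0. \<forall>N. c \<le> E (\<lambda>X. of_bool (0 < path_sum (N * m) (\<lambda>_. 1) 0 0 X))"
proof -
  have H: "0 \<le> (harm m :: real)" by (simp add: harm_nonneg)
  have D0: "0 \<le> Dc" unfolding Dc_def c3_def by simp
  have eD: "\<epsilon> * Dc \<le> real m"
  proof -
    have "\<epsilon> * Dc * 1 \<le> \<epsilon> * Dc * (harm m + 2)" using eps D0 H by (intro mult_left_mono) auto
    moreover have "0 \<le> \<epsilon> * (19 * A * real m * (1 + harm m))" using eps H by simp
    ultimately show ?thesis using e2 by (simp add: algebra_simps)
  qed
  have V1: "1 \<le> V z" for z by (rule V_ge1[OF eD])
  have ly: "(\<Sum>u\<in>D. \<Sum>u'\<in>D. blk n x x' u u' * V (x + u - (x' + u'))) \<le> V (x - x')" for n x x'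
    using lyapunov_diag[OF P e2, of n x] lyapunov_off[of x x' n, OF _ _ eD] V1[of 0] by (cases "x = x'") auto
  have "1 / V 0 \<le> E (\<lambda>X. of_bool (0 < path_sum (N * m) (\<lambda>_. 1) 0 0 X))" for N
  proof -
    let ?I = "\<lambda>X. of_bool (0 < path_sum (N * m) (\<lambda>_. 1) 0 0 X) :: real" and ?Y = "chain N 0 0"
    have cI: "cyl 0 (N * m) ?I" using cyl_comp[OF cyl_path_sum[of 0 "N * m" "\<lambda>_. 1" 0], of "\<lambda>z. of_bool (0 < z)"] by simp
    have cY: "cyl 0 (N * m) ?Y" using cyl_chain[of 0 N 0] by simp
    \<comment> \<open>The second-moment method in pointwise form: where the chain sum is nonzero,
      complete the square in \<open>?Y X - V 0\<close>. Taking expectations yields a survival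
      probability of at least \<open>1 / V 0\<close>, whatever \<open>N\<close> is.\<close>
    have pw: "2 * ?Y X \<le> (1 / V 0) * (?Y X * ?Y X) + V 0 * ?I X" for X
    proof (cases "?Y X = 0")
      case True then show ?thesis using V1[of 0] by simp
    next
      case False
      then have "?I X = 1" using chain_path_sum by simp
      moreover have "0 \<le> (?Y X - V 0)\<^sup>2 / V 0" using V1[of 0] by simp
      moreover have "(?Y X - V 0)\<^sup>2 / V 0 = (1 / V 0) * (?Y X * ?Y X) - 2 * ?Y X + V 0"
        using V1[of 0] by (simp add: power2_eq_square field_simps)
      ultimately show ?thesis by simp
    qed
    have "2 * E ?Y = E (\<lambda>X. 2 * ?Y X)" by simp
    also have "\<dots> \<le> E (\<lambda>X. (1 / V 0) * (?Y X * ?Y X) + V 0 * ?I X)"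
      by (rule Ev_mono[OF cyl_mult[OF cyl_const cY] cyl_add[OF cyl_mult[OF cyl_const cyl_mult[OF cY cY]] cyl_mult[OF cyl_const cI]] pw])
    also have "\<dots> = E (\<lambda>X. (1 / V 0) * (?Y X * ?Y X)) + E (\<lambda>X. V 0 * ?I X)"
      by (rule Ev_add[OF cyl_mult[OF cyl_const cyl_mult[OF cY cY]] cyl_mult[OF cyl_const cI]])
    also have "\<dots> = (1 / V 0) * E (\<lambda>X. ?Y X * ?Y X) + V 0 * E ?I" by simp
    also have "\<dots> \<le> (1 / V 0) * V 0 + V 0 * E ?I"
      using E_chain2[OF ly V1, of N 0 0 0] V1[of 0] by (intro add_right_mono mult_left_mono) auto
    finally have "1 \<le> V 0 * E ?I" using V1[of 0] by (simp add: E_chain)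
    then show ?thesis using V1[of 0] by (simp add: pos_divide_le_eq mult.commute)
  qed
  then show ?thesis using V1[of 0] by (intro exI[of _ "1 / V 0"]) auto
qed

end

section \<open>Fractional moments\<close>

text \<open>The constant 29/100 is slightly below \<open>1 - 2^(-1/2)\<close>: at
  \<open>z = 2\<close> the bound is 1.42, just above the root of 2. Half of it in front of
  \<open>fall3\<close> makes the total correction vanish at \<open>z = 4\<close> and nonnegative
  beyond.\<close>

lemma sqrt_Nats_le:
  assumes "z \<in> \<nat>"
  shows "sqrt z \<le> z - 29 / 100 * fall2 z + 29 / 200 * fall3 z"
proof -
  obtain k :: nat where k: "z = real k" using assms Nats_cases by blast
  consider "k = 0" | "k = 1" | "k = 2" | "k = 3" | "4 \<le> k" by linarith
  then show ?thesis
  proof cases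
    case 3
    have "sqrt 2 \<le> sqrt ((142 / 100)\<^sup>2)" by (intro real_sqrt_le_mono) (simp add: power2_eq_square)
    then show ?thesis using 3 by (simp add: k fall2_def fall3_def)
  next
    case 4
    have "sqrt 3 \<le> sqrt (2\<^sup>2)" by (intro real_sqrt_le_mono) simp
    then show ?thesis using 4 by (simp add: k fall2_def fall3_def)
  next
    case 5
    then have z: "4 \<le> z" by (simp add: k)
    have "sqrt z \<le> sqrt (z * z)" using z by (intro real_sqrt_le_mono) simp
    then have "sqrt z \<le> z" using z by simp
    moreover have "0 \<le> 29 / 200 * (z * (z - 1) * (z - 4))" using z by simp
    moreover have "z - 29 / 100 * fall2 z + 29 / 200 * fall3 z = z + 29 / 200 * (z * (z - 1) * (z - 4))"
      by (simp add: fall2_def fall3_def field_simps)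
    ultimately show ?thesis by linarith
  qed (auto simp: k fall2_def fall3_def)
qed

lemma sqrt_sum_le:
  assumes "finite I" "\<And>i. i \<in> I \<Longrightarrow> 0 \<le> a i"
  shows "sqrt (\<Sum>i\<in>I. a i) \<le> (\<Sum>i\<in>I. sqrt (a i))"
  using assms
proof (induction I rule: finite_induct)
  case (insert i I)
  have "sqrt (a i + sum a I) \<le> sqrt (a i) + sqrt (sum a I)"
    using insert.prems by (intro sqrt_add_le_add_sqrt) (auto intro: sum_nonneg)
  then show ?case using insert by fastforce
qed simp

context percolation_kernel
begin

abbreviation W :: "nat \<Rightarrow> nat \<Rightarrow> (int ^ 'd) \<Rightarrow> 'd config \<Rightarrow> real" where
  "W N \<equiv> path_sum N (\<lambda>_. 1)"

lemma path_sum_mono: "(\<And>y. \<phi> y \<le> \<psi> y) \<Longrightarrow> path_sum k \<phi> n x X \<le> path_sum k \<psi> n x X"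
  by (induction k arbitrary: n x) (auto intro!: sum_mono mult_left_mono bit_nonneg)

lemma path_sum_const: "path_sum k (\<lambda>_. c) n x X = c * W k n x X"
  by (induction k arbitrary: n x) (simp_all add: sum_distrib_left mult_ac)

lemma W_le: "W k n x X \<le> real (card R) ^ k"
proof (induction k arbitrary: n x)
  case (Suc k)
  have "W (Suc k) n x X \<le> (\<Sum>s\<in>R. 1 * real (card R) ^ k)"
    unfolding path_sum.simps using bit_01[of n x _ X]
    by (intro sum_mono mult_mono Suc path_sum_nonneg) (auto, metis le_numeral_extra(4) zero_le_one)
  then show ?case by simp
qed simp

lemma W_nonneg: "0 \<le> W k n x X" by (intro path_sum_nonneg) simp

lemma W_add_le: "W (j + r) n x X \<le> real (card R) ^ r * W j n x X"
  unfolding path_sum_add path_sum_const[symmetric] by (intro path_sum_mono W_le)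

lemma W_add_ge: "npaths k n x y X * W N (n + k) y X \<le> W (k + N) n x X"
proof (cases "y \<in> reach k x")
  case True
  then show ?thesis unfolding path_sum_add path_sum_sum[OF finite_reach order_refl, where \<phi> = "\<lambda>v. W N (n + k) v X"]
    by (intro member_le_sum[of _ _ "\<lambda>y. npaths k n x y X * W N (n + k) y X"] finite_reach mult_nonneg_nonneg npaths_nonneg W_nonneg)
next
  case False then show ?thesis by (simp add: npaths_outside W_nonneg)
qed

text \<open>Subadditivity of the square root over the intermediate vertex and independence of
  consecutive slabs make the fractional moment submultiplicative in the number of blocks.\<close>

lemma E_sqrt_W:
  "E (\<lambda>X. sqrt (W (N * m) n x X)) \<le> (\<Sum>u\<in>reach m 0. E (\<lambda>X. sqrt (npaths m 0 0 u X))) ^ N"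
proof (induction N arbitrary: n x)
  case 0 then show ?case by simp
next
  case (Suc N)
  let ?D = "reach m 0" and ?\<phi> = "\<Sum>u\<in>reach m 0. E (\<lambda>X. sqrt (npaths m 0 0 u X))"
  have D: "(\<lambda>u. x + u) ` ?D = reach m x" using reach_shift[of m 0 x] by (simp add: add.commute)
  have phi0: "0 \<le> ?\<phi>" by (intro sum_nonneg Ev_nonneg) (simp add: npaths_nonneg)
  have c1: "cyl n (n + m) (\<lambda>X. sqrt (npaths m n x (x + u) X))" for u by (rule cyl_comp[OF cyl_npaths])
  have c2: "cyl (n + m) (n + m + N * m) (\<lambda>X. sqrt (W (N * m) (n + m) (x + u) X))" for u by (rule cyl_comp[OF cyl_path_sum])
  have c3: "cyl n (n + m + N * m) (\<lambda>X. sqrt (npaths m n x (x + u) X) * sqrt (W (N * m) (n + m) (x + u) X))" for u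
    by (intro cyl_mult cyl_mono[OF c1] cyl_mono[OF c2]) auto
  have c4: "cyl n (n + Suc N * m) (\<lambda>X. sqrt (W (Suc N * m) n x X))" by (rule cyl_comp[OF cyl_path_sum])
  have "sqrt (W (Suc N * m) n x X) \<le> (\<Sum>u\<in>?D. sqrt (npaths m n x (x + u) X) * sqrt (W (N * m) (n + m) (x + u) X))" for X
  proof -
    have "W (Suc N * m) n x X = (\<Sum>y\<in>reach m x. npaths m n x y X * W (N * m) (n + m) y X)"
      by (simp add: path_sum_add) (rule path_sum_sum[OF finite_reach order_refl])
    also have "\<dots> = (\<Sum>u\<in>?D. npaths m n x (x + u) X * W (N * m) (n + m) (x + u) X)"
      unfolding D[symmetric] by (subst sum.reindex) auto
    finally show ?thesis
      using sqrt_sum_le[OF finite_reach, of m 0 "\<lambda>u. npaths m n x (x + u) X * W (N * m) (n + m) (x + u) X"]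
      by (simp add: real_sqrt_mult npaths_nonneg W_nonneg)
  qed
  then have "E (\<lambda>X. sqrt (W (Suc N * m) n x X)) \<le> E (\<lambda>X. \<Sum>u\<in>?D. sqrt (npaths m n x (x + u) X) * sqrt (W (N * m) (n + m) (x + u) X))"
    by (rule Ev_mono[OF c4 cyl_sum[OF c3]])
  also have "\<dots> = (\<Sum>u\<in>?D. E (\<lambda>X. sqrt (npaths m n x (x + u) X)) * E (\<lambda>X. sqrt (W (N * m) (n + m) (x + u) X)))"
    by (simp add: Ev_sum[OF c3] E_mult[OF c1 c2])
  also have "\<dots> \<le> (\<Sum>u\<in>?D. E (\<lambda>X. sqrt (npaths m 0 0 u X)) * ?\<phi> ^ N)"
    unfolding E_shift[of sqrt] by (intro sum_mono mult_left_mono Suc Ev_nonneg) (simp add: npaths_nonneg)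
  also have "\<dots> = ?\<phi> ^ Suc N" by (simp add: sum_distrib_right)
  finally show ?case .
qed

text \<open>Markov's inequality and Borel-Cantelli along the multiples of \<open>m\<close>; the
  times in between are filled by the trivial growth bound \<open>W_add_le\<close>.\<close>

lemma AE_W_le:
  assumes m: "1 \<le> m" and p: "0 < p"
    and phi: "(\<Sum>u\<in>reach m 0. E (\<lambda>X. sqrt (npaths m 0 0 u X))) < sqrt (p ^ m)"
  shows "\<exists>\<beta><ln p. AE X in bern pe. \<forall>\<^sub>F N in sequentially. W N 0 0 X \<le> exp (\<beta> * real N)"
proof -
  let ?\<phi> = "\<Sum>u\<in>reach m 0. E (\<lambda>X. sqrt (npaths m 0 0 u X))" and ?q = "sqrt (p ^ m)"
  have phi0: "0 \<le> ?\<phi>" by (intro sum_nonneg Ev_nonneg) (simp add: npaths_nonneg)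
  have q: "0 < ?q" using p by simp
  \<comment> \<open>\<open>r\<close> above the fractional moment makes the exceptional probabilities
    summable; \<open>r\<close> below \<open>sqrt (p ^ m)\<close> makes the rate
    \<open>2 * ln r / m\<close> smaller than \<open>ln p\<close>. The factor 2 undoes the square
    root.\<close>
  obtain r where r: "?\<phi> < r" "r < ?q" using dense[OF phi] by blast
  then have r0: "0 < r" using phi0 by linarith
  define \<beta>0 where "\<beta>0 = 2 * ln r / real m"
  have "\<beta>0 < ln p"
  proof -
    have "ln r < ln ?q" using r(2) r0 q by (subst ln_less_cancel_iff)
    then have "2 * ln r < 2 * ln ?q" by linarith
    also have "\<dots> = real m * ln p" using p by (simp add: ln_sqrt ln_realpow)
    finally show ?thesis using m by (simp add: \<beta>0_def pos_divide_less_eq mult.commute)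
  qed
  then obtain \<beta> where \<beta>: "\<beta>0 < \<beta>" "\<beta> < ln p" using dense by blast
  let ?S = "\<lambda>N. {X \<in> space (bern pe). r ^ N \<le> sqrt (W (N * m) 0 0 X)}"
  have c: "cyl 0 (N * m) (\<lambda>X. sqrt (W (N * m) 0 0 X))" for N
    using cyl_comp[OF cyl_path_sum[of 0 "N * m" "\<lambda>_. 1" 0], of sqrt] by simp
  have [measurable]: "(\<lambda>X. sqrt (W (N * m) 0 0 X)) \<in> borel_measurable (bern pe)" for N
    by (rule cyl_measurable[OF c])
  have "measure (bern pe) (?S N) \<le> (?\<phi> / r) ^ N" for N
  proof -
    have "measure (bern pe) (?S N) \<le> E (\<lambda>X. sqrt (W (N * m) 0 0 X)) / r ^ N"
      using r0 by (intro integral_Markov_inequality_measure[where A = "{}"] cyl_integrable[OF c]) (auto simp: W_nonneg)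
    also have "\<dots> \<le> ?\<phi> ^ N / r ^ N" using r0 by (intro divide_right_mono E_sqrt_W) auto
    finally show ?thesis by (simp add: power_divide)
  qed
  then have "summable (\<lambda>N. measure (bern pe) (?S N))"
    using r r0 phi0 by (intro summable_comparison_test'[OF summable_geometric[of "?\<phi> / r"], of 0]) auto
  then have "AE X in bern pe. \<forall>\<^sub>F N in sequentially. X \<in> space (bern pe) - ?S N"
  proof (intro borel_cantelli_AE1)
    show "?S N \<in> sets (bern pe)" for N by measurable
  qed (auto simp: bern.emeasure_eq_measure)
  then have "AE X in bern pe. \<forall>\<^sub>F N in sequentially. W N 0 0 X \<le> exp (\<beta> * real N)"
  proof (eventually_elim)
    case (elim X)
    then obtain N0 where N0: "\<And>N. N0 \<le> N \<Longrightarrow> sqrt (W (N * m) 0 0 X) < r ^ N"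
      by (auto simp: eventually_sequentially not_le)
    \<comment> \<open>The price of fewer than \<open>m\<close> extra steps. The absolute value of
      \<open>\<beta>0\<close> covers either sign when \<open>j * m\<close> is replaced by
      \<open>N\<close>; the margin between \<open>\<beta>0\<close> and \<open>\<beta>\<close>
      finally absorbs \<open>K\<close>.\<close>
    define K where "K = (real (card R) + 1) ^ m * exp (\<bar>\<beta>0\<bar> * real m)"
    have K: "0 < K" unfolding K_def by (intro mult_pos_pos zero_less_power) auto
    have bd: "W N 0 0 X \<le> K * exp (\<beta>0 * real N)" if "N0 * m \<le> N" for N
    proof -
      define j where "j = N div m"
      define i where "i = N mod m"
      have N: "N = j * m + i" "i < m" using m by (simp_all add: j_def i_def)
      have "N0 \<le> j" using that m unfolding j_def by (simp add: less_eq_div_iff_mult_less_eq)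
      then have "sqrt (W (j * m) 0 0 X) \<le> r ^ j" using N0 by (simp add: less_imp_le)
      then have "W (j * m) 0 0 X \<le> (r ^ j)\<^sup>2" by (rule sqrt_le_D)
      also have "(r ^ j)\<^sup>2 = exp (\<beta>0 * real (j * m))"
      proof -
        have "(r ^ j)\<^sup>2 = exp (ln r * real (2 * j))"
          unfolding exp_of_nat2_mult using r0 by (simp add: power_mult[symmetric] mult.commute)
        then show ?thesis using m by (simp add: \<beta>0_def mult_ac)
      qed
      finally have 1: "W (j * m) 0 0 X \<le> exp (\<beta>0 * real (j * m))" .
      have "W N 0 0 X \<le> real (card R) ^ i * W (j * m) 0 0 X" unfolding N(1) by (rule W_add_le)
      also have "\<dots> \<le> (real (card R) + 1) ^ m * (exp (\<bar>\<beta>0\<bar> * real m) * exp (\<beta>0 * real N))"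
      proof (intro mult_mono)
        have "real (card R) ^ i \<le> (real (card R) + 1) ^ i" by (intro power_mono) auto
        also have "\<dots> \<le> (real (card R) + 1) ^ m" using N by (intro power_increasing) auto
        finally show "real (card R) ^ i \<le> (real (card R) + 1) ^ m" .
        have "- \<beta>0 * real i \<le> \<bar>\<beta>0\<bar> * real m" using N by (intro mult_mono) auto
        then have "\<beta>0 * real (j * m) \<le> \<bar>\<beta>0\<bar> * real m + \<beta>0 * real N" unfolding N(1) by (simp add: algebra_simps)
        then show "W (j * m) 0 0 X \<le> exp (\<bar>\<beta>0\<bar> * real m) * exp (\<beta>0 * real N)"
          using 1 unfolding exp_add[symmetric] by (meson exp_le_cancel_iff order_trans)
      qed (auto simp: W_nonneg)
      finally show ?thesis by (simp add: K_def mult_ac)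
    qed
    have "\<forall>\<^sub>F N in sequentially. ln K / (\<beta> - \<beta>0) \<le> real N"
      by (rule eventually_sequentiallyI[of "nat \<lceil>ln K / (\<beta> - \<beta>0)\<rceil>"]) linarith
    moreover have "\<forall>\<^sub>F N in sequentially. N0 * m \<le> N" by (rule eventually_ge_at_top)
    ultimately show ?case
    proof eventually_elim
      case (elim N)
      then have "ln K \<le> (\<beta> - \<beta>0) * real N" using \<beta> by (simp add: pos_divide_le_eq mult.commute)
      then have "K \<le> exp ((\<beta> - \<beta>0) * real N)" using K by (metis exp_le_cancel_iff exp_ln)
      then have "K * exp (\<beta>0 * real N) \<le> exp ((\<beta> - \<beta>0) * real N) * exp (\<beta>0 * real N)" by (intro mult_right_mono) auto
      also have "\<dots> = exp (\<beta> * real N)" by (simp add: exp_add[symmetric] algebra_simps)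
      finally show ?case using bd[of N] elim by linarith
    qed
  qed
  then show ?thesis using \<beta> by blast
qed

end

context block
begin

text \<open>The fractional moment is at most \<open>p ^ m\<close> minus 29/100 of \<open>t\<close>
  up to the third moment, whereas \<open>sqrt (p ^ m)\<close> is at least \<open>p ^ m\<close> minus
  28/100 of \<open>t\<close>, half of the allowed 56/100, up to second order. By
  \<open>small\<close> the errors fit into the margin \<open>t / 100\<close>.\<close>

lemma disorder:
  assumes t: "t = excess 1 m 0" "t \<le> 1" and pm: "p ^ m \<le> 1 + 56 / 100 * t + t\<^sup>2"
    and small: "2 * t\<^sup>2 + 100 ^ m * \<epsilon>\<^sup>2 < t / 100"
  shows "(\<Sum>u\<in>D. E (\<lambda>X. sqrt (npaths m 0 0 u X))) < sqrt (p ^ m)"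
proof -
  have t0: "0 \<le> t" unfolding t by (rule excess_nonneg) simp
  have T2: "t \<le> (\<Sum>u\<in>D. tau u)" unfolding sum_tau t by (rule excess_mono[OF p_ge1])
  have T3: "(\<Sum>u\<in>D. E (\<lambda>X. fall3 (npaths m 0 0 u X))) \<le> 100 ^ m * \<epsilon>\<^sup>2"
  proof -
    have "(\<Sum>u\<in>D. E (\<lambda>X. fall3 (npaths m 0 0 u X))) = m3 D m 0 0"
      unfolding m3_def by (rule Ev_sum[OF cyl_fall(2), symmetric])
    then show ?thesis using third_moment[OF finite_reach] by simp
  qed
  have "(\<Sum>u\<in>D. E (\<lambda>X. sqrt (npaths m 0 0 u X)))
    \<le> (\<Sum>u\<in>D. p ^ m * rho u - 29 / 100 * tau u + 29 / 200 * E (\<lambda>X. fall3 (npaths m 0 0 u X)))"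
  proof (rule sum_mono)
    fix u
    have c: "cyl 0 (0 + m) (\<lambda>X. F (npaths m 0 0 u X))" for F :: "real \<Rightarrow> real" by (rule cyl_comp[OF cyl_npaths])
    have "E (\<lambda>X. sqrt (npaths m 0 0 u X)) \<le> E (\<lambda>X. npaths m 0 0 u X - 29 / 100 * fall2 (npaths m 0 0 u X) + 29 / 200 * fall3 (npaths m 0 0 u X))"
      by (rule Ev_mono[OF c c[of "\<lambda>z. z - 29 / 100 * fall2 z + 29 / 200 * fall3 z"]]) (rule sqrt_Nats_le[OF npaths_Nats])
    also have "\<dots> = E (\<lambda>X. npaths m 0 0 u X - 29 / 100 * fall2 (npaths m 0 0 u X)) + E (\<lambda>X. 29 / 200 * fall3 (npaths m 0 0 u X))"
      by (rule Ev_add[OF c[of "\<lambda>z. z - 29 / 100 * fall2 z"] c[of "\<lambda>z. 29 / 200 * fall3 z"]])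
    also have "E (\<lambda>X. npaths m 0 0 u X - 29 / 100 * fall2 (npaths m 0 0 u X)) = E (npaths m 0 0 u) - E (\<lambda>X. 29 / 100 * fall2 (npaths m 0 0 u X))"
      by (rule Ev_diff[OF cyl_npaths c[of "\<lambda>z. 29 / 100 * fall2 z"]])
    finally show "E (\<lambda>X. sqrt (npaths m 0 0 u X)) \<le> p ^ m * rho u - 29 / 100 * tau u + 29 / 200 * E (\<lambda>X. fall3 (npaths m 0 0 u X))"
      by (simp add: E_npaths)
  qed
  also have "\<dots> = p ^ m - 29 / 100 * (\<Sum>u\<in>D. tau u) + 29 / 200 * (\<Sum>u\<in>D. E (\<lambda>X. fall3 (npaths m 0 0 u X)))"
    unfolding sum.distrib sum_subtractf sum_distrib_left[symmetric]
    using fpow_sum[OF finite_reach order_refl, of m 0] by simp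
  also have "\<dots> \<le> p ^ m - 29 / 100 * t + 29 / 200 * (100 ^ m * \<epsilon>\<^sup>2)" using T2 T3 by linarith
  finally have 1: "(\<Sum>u\<in>D. E (\<lambda>X. sqrt (npaths m 0 0 u X))) \<le> p ^ m - 29 / 100 * t + 29 / 200 * (100 ^ m * \<epsilon>\<^sup>2)" .
  define q where "q = p ^ m - 1"
  have q: "0 \<le> q" "q \<le> 56 / 100 * t + t\<^sup>2" using pp pm by (auto simp: q_def)
  have excess: "t\<^sup>2 \<le> t" using t0 t(2) by (simp add: power2_eq_square mult_left_le)
  have q2: "q \<le> 2 * t" using q excess t0 by linarith
  have "1 + q / 2 - q\<^sup>2 / 4 \<le> sqrt (1 + q)"
  proof (rule real_le_rsqrt)
    have qq: "q \<le> 2" using q2 t by simp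
    have "0 \<le> q ^ 3 * (4 - q)" using q qq by simp
    then show "(1 + q / 2 - q\<^sup>2 / 4)\<^sup>2 \<le> 1 + q"
    proof -
      have "1 + q - (1 + q / 2 - q\<^sup>2 / 4)\<^sup>2 = q\<^sup>2 / 4 + q ^ 3 * (4 - q) / 16"
        by (simp add: power2_eq_square power3_eq_cube field_simps)
      moreover have "0 \<le> q\<^sup>2 / 4 + q ^ 3 * (4 - q) / 16" using \<open>0 \<le> q ^ 3 * (4 - q)\<close> by simp
      ultimately show ?thesis by linarith
    qed
  qed
  moreover have "q\<^sup>2 \<le> (2 * t)\<^sup>2" using q q2 by (intro power_mono)
  moreover have "(2 * t)\<^sup>2 = 4 * t\<^sup>2" "p ^ m = 1 + q" by (simp_all add: power2_eq_square q_def)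
  ultimately have "p ^ m - sqrt (p ^ m) \<le> q / 2 + t\<^sup>2" by simp
  also have "\<dots> \<le> 28 / 100 * t + 3 / 2 * t\<^sup>2" using q by simp
  finally have "p ^ m - sqrt (p ^ m) \<le> 28 / 100 * t + 3 / 2 * t\<^sup>2" .
  moreover have "0 \<le> 100 ^ m * \<epsilon>\<^sup>2" by simp
  moreover have "0 \<le> t\<^sup>2" by simp
  ultimately show ?thesis using 1 small by linarith
qed

end

section \<open>A zero-one law for the growth rate\<close>

lemma depends_on_sets:
  assumes "finite A" "depends_on A (\<lambda>X. X \<in> C)"
  shows "C \<in> sets (bern q)"
proof -
  have "depends_on A (\<lambda>X. of_bool (X \<in> C) :: real)"
    using assms(2) unfolding depends_on_def by (metis of_bool_eq_iff)
  from depends_on_measurable[OF assms(1) this, of q]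
  have "(\<lambda>X. of_bool (X \<in> C) :: real) -` {1} \<inter> space (bern q) \<in> sets (bern q)" by (rule measurable_sets) simp
  moreover have "(\<lambda>X. of_bool (X \<in> C) :: real) -` {1} \<inter> space (bern q) = C" by auto
  ultimately show ?thesis by simp
qed

text \<open>Approximable events are closed under complements and countable unions. A union is cut
  off after \<open>n\<close> sets, with half of the error for the remaining sets and half for the
  approximations of the first \<open>n\<close>.\<close>

lemma cylinder_approx:
  assumes "B \<in> sets (bern q)" "0 < e"
  shows "\<exists>A C. finite A \<and> depends_on A (\<lambda>X. X \<in> C) \<and> measure (bern q) ((B - C) \<union> (C - B)) < e"
proof -
  have s: "sets (bern q) = sigma_sets UNIV {{X. X i \<in> A} | i A. True}"
    unfolding bern_def sets_PiM_single by (simp add: PiE_UNIV_domain)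
  show ?thesis using assms unfolding s
  proof (induction arbitrary: e rule: sigma_sets.induct)
    case (Basic a)
    then obtain i A where a: "a = {X. X i \<in> A}" by blast
    show ?case using Basic by (intro exI[of _ "{i}"] exI[of _ a]) (auto simp: a depends_on_def)
  next
    case Empty
    then show ?case by (intro exI[of _ "{}"]) (auto simp: depends_on_def)
  next
    case (Compl a)
    from Compl.IH[OF Compl.prems] obtain A C where C: "finite A" "depends_on A (\<lambda>X. X \<in> C)" "measure (bern q) ((a - C) \<union> (C - a)) < e"
      by blast
    have "(UNIV - a - (UNIV - C)) \<union> (UNIV - C - (UNIV - a)) = (a - C) \<union> (C - a)" by auto
    then show ?case using C by (intro exI[of _ A] exI[of _ "UNIV - C"]) (auto simp: depends_on_def)
  next
    case (Union a)
    let ?U = "\<lambda>n. \<Union>i<n. a i"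
    have am: "a i \<in> sets (bern q)" for i using Union.hyps s by blast
    have "(\<lambda>n. measure (bern q) (?U n)) \<longlonglongrightarrow> measure (bern q) (\<Union>n. ?U n)"
      by (intro bern.finite_Lim_measure_incseq) (auto simp: incseq_def am intro: less_le_trans)
    moreover have "(\<Union>n. ?U n) = \<Union> (range a)" by auto
    ultimately have "(\<lambda>n. measure (bern q) (?U n)) \<longlonglongrightarrow> measure (bern q) (\<Union> (range a))" by simp
    then have "\<forall>\<^sub>F n in sequentially. measure (bern q) (\<Union> (range a)) - e / 2 < measure (bern q) (?U n)"
      using Union.prems by (intro order_tendstoD(1)) auto
    then obtain n where "measure (bern q) (\<Union> (range a)) - e / 2 < measure (bern q) (?U n)"
      unfolding eventually_sequentially by blast
    then have n: "measure (bern q) (\<Union> (range a)) - measure (bern q) (?U n) < e / 2" by linarith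
    have "0 < e / (2 * (real n + 1))" using Union.prems by simp
    from Union.IH[OF this] obtain A C where AC: "\<And>i. finite (A i)" "\<And>i. depends_on (A i) (\<lambda>X. X \<in> C i)"
      "\<And>i. measure (bern q) ((a i - C i) \<union> (C i - a i)) < e / (2 * (real n + 1))" by metis
    let ?C = "\<Union>i<n. C i" and ?d = "\<lambda>i. (a i - C i) \<union> (C i - a i)"
    have Cm: "C i \<in> sets (bern q)" for i using depends_on_sets[OF AC(1,2)] .
    have sub: "(\<Union> (range a) - ?C) \<union> (?C - \<Union> (range a)) \<subseteq> (\<Union> (range a) - ?U n) \<union> (\<Union>i<n. ?d i)" by auto
    have "measure (bern q) ((\<Union> (range a) - ?C) \<union> (?C - \<Union> (range a)))
      \<le> measure (bern q) ((\<Union> (range a) - ?U n) \<union> (\<Union>i<n. ?d i))"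
      using am Cm by (intro bern.finite_measure_mono sub) auto
    also have "\<dots> \<le> measure (bern q) (\<Union> (range a) - ?U n) + measure (bern q) (\<Union>i<n. ?d i)"
      using am Cm by (intro measure_Un_le) auto
    also have "measure (bern q) (\<Union> (range a) - ?U n) = measure (bern q) (\<Union> (range a)) - measure (bern q) (?U n)"
      using am by (intro bern.finite_measure_Diff) auto
    also have "measure (bern q) (\<Union>i<n. ?d i) \<le> (\<Sum>i<n. measure (bern q) (?d i))"
      using am Cm by (intro bern.finite_measure_subadditive_finite) auto
    also have "\<dots> \<le> (\<Sum>i<n. e / (2 * (real n + 1)))" using AC(3) by (intro sum_mono less_imp_le) auto
    also have "\<dots> \<le> e / 2" using Union.prems by (simp add: field_simps)
    finally have "measure (bern q) ((\<Union> (range a) - ?C) \<union> (?C - \<Union> (range a))) < e" using n by linarith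
    moreover have "depends_on (\<Union>i<n. A i) (\<lambda>X. X \<in> ?C)"
      using AC(2) unfolding depends_on_def by (metis (no_types, lifting) UN_iff)
    ultimately show ?case using AC(1) by (intro exI[of _ "\<Union>i<n. A i"] exI[of _ ?C]) auto
  qed
qed

lemma cyl_sets:
  assumes "cyl a b (\<lambda>X. X \<in> C)" shows "C \<in> sets (bern q)"
  using assms depends_on_sets unfolding cyl_def by blast

lemma cyl_of_bool: "cyl a b (\<lambda>X. X \<in> C) \<Longrightarrow> cyl a b (\<lambda>X. of_bool (X \<in> C) :: real)"
  by (rule cyl_comp)

lemma measure_eq_Ev: "C \<in> sets (bern q) \<Longrightarrow> measure (bern q) C = Ev q (\<lambda>X. of_bool (X \<in> C))"
proof -
  assume "C \<in> sets (bern q)"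
  moreover have "(indicator C :: _ \<Rightarrow> real) = (\<lambda>X. of_bool (X \<in> C))" by (simp add: indicator_def fun_eq_iff)
  ultimately show ?thesis using Bochner_Integration.integral_indicator[of "bern q" C] by simp
qed

context percolation_kernel
begin

abbreviation P where "P \<equiv> measure (bern pe)"

text \<open>A measurable event, determined by path counts at finite levels, that agrees almost
  surely with \<open>percolation\<close>.\<close>

definition surv :: "'d config set" where "surv = {X. \<forall>N. 0 < W N 0 0 X}"

definition slow :: "real \<Rightarrow> nat \<Rightarrow> (int ^ 'd) \<Rightarrow> 'd config set" where
  "slow \<beta> n x = {X. \<forall>\<^sub>F N in sequentially. W N n x X \<le> exp (\<beta> * real N)}"

text \<open>A truncation of \<open>slow\<close> to finitely many levels. Independence and
  translation invariance hold for such events and pass to \<open>slow\<close> in the limits over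
  \<open>b\<close> and then over \<open>a\<close>.\<close>

definition slowT :: "real \<Rightarrow> nat \<Rightarrow> nat \<Rightarrow> nat \<Rightarrow> (int ^ 'd) \<Rightarrow> 'd config set" where
  "slowT \<beta> a b n x = {X. \<forall>N\<in>{a..b}. W N n x X \<le> exp (\<beta> * real N)}"

lemma cyl_Ball:
  "finite I \<Longrightarrow> (\<And>i. i \<in> I \<Longrightarrow> cyl a b (g i)) \<Longrightarrow> cyl a b (\<lambda>X. \<forall>i\<in>I. g i X)"
proof (induction I rule: finite_induct)
  case (insert i I)
  have "cyl a b (\<lambda>X. g i X \<and> (\<forall>j\<in>I. g j X))"
    by (rule cyl_comp2[of a b "g i" "\<lambda>X. \<forall>j\<in>I. g j X" "(\<and>)"]) (use insert in auto)
  then show ?case by simp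
qed simp

lemma cyl_slowT: "cyl n (n + b) (\<lambda>X. X \<in> slowT \<beta> a b n x)"
  unfolding slowT_def mem_Collect_eq
proof (intro cyl_Ball)
  fix N assume "N \<in> {a..b}"
  then show "cyl n (n + b) (\<lambda>X. W N n x X \<le> exp (\<beta> * real N))"
    by (intro cyl_comp[where F = "\<lambda>z. z \<le> exp (\<beta> * real N)"] cyl_mono[OF cyl_path_sum]) auto
qed simp

lemma W_shift: "W k (a + n) (v + x) X = W k n x (\<lambda>(l, u, w). X (a + l, v + u, v + w))"
proof (induction k arbitrary: n x)
  case (Suc k)
  have "W k (Suc (a + n)) (v + x + s) X = W k (Suc n) (x + s) (\<lambda>(l, u, w). X (a + l, v + u, v + w))" for s
    using Suc[of "Suc n" "x + s"] by (simp add: add_ac)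
  then show ?case by (simp add: bit_def add_ac)
qed simp

lemma P_slowT: "P (slowT \<beta> a b n x) = P (slowT \<beta> a b 0 0)"
proof -
  let ?T = "\<lambda>(l, u, w). (n + l, x + u, x + w)"
  obtain A where A: "finite A" "depends_on A (\<lambda>X. of_bool (X \<in> slowT \<beta> a b 0 0) :: real)"
    using cyl_of_bool[OF cyl_slowT[of 0 b \<beta> a 0]] unfolding cyl_def by blast
  have "E (\<lambda>X. of_bool ((\<lambda>e. X (?T e)) \<in> slowT \<beta> a b 0 0)) = E (\<lambda>X. of_bool (X \<in> slowT \<beta> a b 0 0))"
    by (rule Ev_reindex[OF pe _ _ A]) (auto simp: inj_def pe_def)
  moreover have "(\<lambda>e. X (?T e)) = (\<lambda>(l, u, w). X (n + l, x + u, x + w))" for X :: "'d config"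
    by (auto simp: fun_eq_iff)
  moreover have "(\<lambda>(l, u, w). X (n + l, x + u, x + w)) \<in> slowT \<beta> a b 0 0 \<longleftrightarrow> X \<in> slowT \<beta> a b n x" for X
    using W_shift[of _ n 0 x 0 X] by (simp add: slowT_def)
  ultimately show ?thesis
    by (simp add: measure_eq_Ev cyl_sets[OF cyl_slowT])
qed

lemma slow_limit: "slow \<beta> n x = (\<Union>a. \<Inter>b. slowT \<beta> a b n x)"
proof -
  have "X \<in> slow \<beta> n x \<longleftrightarrow> (\<exists>a. \<forall>b. X \<in> slowT \<beta> a b n x)" for X
    unfolding slow_def slowT_def eventually_sequentially mem_Collect_eq by (meson atLeastAtMost_iff order_refl)
  then show ?thesis by auto
qed

lemma slow_sets [measurable]: "slow \<beta> n x \<in> sets (bern pe)"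
  unfolding slow_limit using cyl_sets[OF cyl_slowT] by (intro sets.countable_UN sets.countable_INT) auto

lemma P_slow_limit:
  assumes C: "C \<in> sets (bern pe)"
  shows "(\<lambda>b. P (C \<inter> slowT \<beta> a b n x)) \<longlonglongrightarrow> P (C \<inter> (\<Inter>b. slowT \<beta> a b n x))"
    and "(\<lambda>a. P (C \<inter> (\<Inter>b. slowT \<beta> a b n x))) \<longlonglongrightarrow> P (C \<inter> slow \<beta> n x)"
proof -
  have m: "slowT \<beta> a b n x \<in> sets (bern pe)" for a b by (rule cyl_sets[OF cyl_slowT])
  have "(\<lambda>b. P (C \<inter> slowT \<beta> a b n x)) \<longlonglongrightarrow> P (\<Inter>b. C \<inter> slowT \<beta> a b n x)"
    using m C by (intro bern.finite_Lim_measure_decseq) (auto simp: decseq_def slowT_def)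
  moreover have "(\<Inter>b. C \<inter> slowT \<beta> a b n x) = C \<inter> (\<Inter>b. slowT \<beta> a b n x)" by auto
  ultimately show "(\<lambda>b. P (C \<inter> slowT \<beta> a b n x)) \<longlonglongrightarrow> P (C \<inter> (\<Inter>b. slowT \<beta> a b n x))" by simp
  have "(\<lambda>a. P (C \<inter> (\<Inter>b. slowT \<beta> a b n x))) \<longlonglongrightarrow> P (\<Union>a. C \<inter> (\<Inter>b. slowT \<beta> a b n x))"
    using m C by (intro bern.finite_Lim_measure_incseq) (auto simp: incseq_def slowT_def)
  moreover have "(\<Union>a. C \<inter> (\<Inter>b. slowT \<beta> a b n x)) = C \<inter> slow \<beta> n x" unfolding slow_limit by auto
  ultimately show "(\<lambda>a. P (C \<inter> (\<Inter>b. slowT \<beta> a b n x))) \<longlonglongrightarrow> P (C \<inter> slow \<beta> n x)" by simp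
qed

lemma P_slow_indep:
  assumes C: "cyl 0 n (\<lambda>X. X \<in> C)"
  shows "P (C \<inter> slow \<beta> n x) = P C * P (slow \<beta> 0 0)"
proof -
  have Cs: "C \<in> sets (bern pe)" by (rule cyl_sets[OF C])
  have Us: "UNIV \<in> sets (bern pe)" using sets.top[of "bern pe"] by simp
  have 1: "P (C \<inter> slowT \<beta> a b n x) = P C * P (UNIV \<inter> slowT \<beta> a b 0 0)" for a b
  proof -
    have Ts: "slowT \<beta> a b n x \<in> sets (bern pe)" by (rule cyl_sets[OF cyl_slowT])
    have "P (C \<inter> slowT \<beta> a b n x) = E (\<lambda>X. of_bool (X \<in> C \<inter> slowT \<beta> a b n x))"
      using Cs Ts by (intro measure_eq_Ev) auto
    also have "\<dots> = E (\<lambda>X. of_bool (X \<in> C) * of_bool (X \<in> slowT \<beta> a b n x))"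
      by (simp add: of_bool_conj)
    also have "\<dots> = P C * P (slowT \<beta> a b n x)"
      unfolding measure_eq_Ev[OF Cs] measure_eq_Ev[OF Ts]
      by (rule E_mult[OF cyl_of_bool[OF C] cyl_of_bool[OF cyl_slowT]])
    finally show ?thesis using P_slowT[of \<beta> a b n x] by simp
  qed
  have 2: "P (C \<inter> (\<Inter>b. slowT \<beta> a b n x)) = P C * P (UNIV \<inter> (\<Inter>b. slowT \<beta> a b 0 0))" for a
    using LIMSEQ_unique[OF P_slow_limit(1)[OF Cs, of \<beta> a n x, unfolded 1] tendsto_mult[OF tendsto_const P_slow_limit(1)[OF Us, of \<beta> a 0 0]]] .
  show ?thesis
    using LIMSEQ_unique[OF P_slow_limit(2)[OF Cs, of \<beta> n x, unfolded 2] tendsto_mult[OF tendsto_const P_slow_limit(2)[OF Us, of \<beta> 0 0]]] by simp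
qed

lemma W_pos_npaths: "0 < W k n x X \<Longrightarrow> \<exists>y\<in>reach k x. 0 < npaths k n x y X"
proof (rule ccontr)
  assume W: "0 < W k n x X" and "\<not> (\<exists>y\<in>reach k x. 0 < npaths k n x y X)"
  then have "\<And>y. y \<in> reach k x \<Longrightarrow> npaths k n x y X = 0" using npaths_nonneg[of k n x _ X] by (metis less_eq_real_def)
  then have "W k n x X = 0" unfolding path_sum_sum[OF finite_reach order_refl] by simp
  then show False using W by simp
qed

lemma measurable_W [measurable]: "W N n x \<in> borel_measurable (bern pe)"
  by (rule cyl_measurable[OF cyl_path_sum])

lemma measurable_npaths [measurable]: "npaths N n x y \<in> borel_measurable (bern pe)"
  by (rule cyl_measurable[OF cyl_npaths])

lemma surv_sets [measurable]: "surv \<in> sets (bern pe)"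
proof -
  have "{X \<in> space (bern pe). \<forall>N. 0 < W N 0 0 X} \<in> sets (bern pe)" by measurable
  then show ?thesis by (simp add: surv_def)
qed

text \<open>A zero-one law: whatever happens up to level \<open>k\<close>, a reached vertex of
  level \<open>k\<close> starts an independent copy, which grows with probability bounded below.
  Approximating by cylinder events replaces the martingale convergence theorem.\<close>

lemma fast_somewhere:
  assumes fast: "P (slow \<beta> 0 0) < 1"
  shows "AE X in bern pe. X \<in> surv \<longrightarrow> (\<exists>k y. 0 < npaths k 0 0 y X \<and> X \<notin> slow \<beta> k y)"
proof -
  let ?\<nu> = "P (slow \<beta> 0 0)"
  \<comment> \<open>The event to be excluded: survival although every reached vertex of every level
    starts slow growth.\<close>
  define B where "B = surv \<inter> (\<Inter>k. \<Inter>y\<in>reach k 0. - {X. 0 < npaths k 0 0 y X} \<union> slow \<beta> k y)"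
  have zs: "{X. 0 < npaths k 0 0 y X} \<in> sets (bern pe)" for k y
  proof -
    have "{X \<in> space (bern pe). 0 < npaths k 0 0 y X} \<in> sets (bern pe)" by measurable
    then show ?thesis by simp
  qed
  have cs: "- S \<in> sets (bern pe)" if "S \<in> sets (bern pe)" for S
    using sets.compl_sets[OF that] by (simp add: Compl_eq_Diff_UNIV)
  have Us: "UNIV \<in> sets (bern pe)" using sets.top[of "bern pe"] by simp
  have Bs: "B \<in> sets (bern pe)"
  proof -
    have "(\<Inter>y\<in>reach k 0. - {X. 0 < npaths k 0 0 y X} \<union> slow \<beta> k y) \<in> sets (bern pe)" for k
    proof (cases "reach k 0 = {}")
      case True then show ?thesis using Us by simp
    next
      case False then show ?thesis using zs cs by (intro sets.finite_INT finite_reach) auto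
    qed
    then show ?thesis unfolding B_def by (intro sets.Int surv_sets sets.countable_INT) auto
  qed
  have key: "P (B \<inter> C) \<le> ?\<nu> * P C" if C: "cyl 0 k (\<lambda>X. X \<in> C)" for C k
  proof -
    \<comment> \<open>One reached vertex is singled out by looking at the first \<open>k\<close>
      levels only. Its future is independent of the past, so its being slow costs one factor
      \<open>?\<nu>\<close>, without a union bound over the vertices.\<close>
    define pick where "pick X = (SOME y. y \<in> reach k 0 \<and> 0 < npaths k 0 0 y X)" for X
    define D where "D y = {X. X \<in> C \<and> (\<exists>y\<in>reach k 0. 0 < npaths k 0 0 y X) \<and> pick X = y}" for y
    have cD: "cyl 0 k (\<lambda>X. X \<in> D y)" for y
    proof -
      have cv: "cyl 0 k (\<lambda>X. \<forall>y\<in>reach k 0. npaths k 0 0 y X = g y)" for g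
        using cyl_npaths[of 0 k 0] by (intro cyl_Ball finite_reach) (rule cyl_comp, simp)
      obtain A where A: "finite A" "\<forall>e\<in>A. 0 \<le> fst e \<and> fst e < k" "depends_on A (\<lambda>X. X \<in> C)"
        using C unfolding cyl_def by blast
      have "\<forall>y. \<exists>A. finite A \<and> (\<forall>e\<in>A. 0 \<le> fst e \<and> fst e < k) \<and> depends_on A (npaths k 0 0 y)"
        using cyl_npaths[of 0 k 0] unfolding cyl_def by simp
      then obtain A' where A': "\<And>y. finite (A' y)" "\<And>y. \<forall>e\<in>A' y. 0 \<le> fst e \<and> fst e < k" "\<And>y. depends_on (A' y) (npaths k 0 0 y)"
        by metis
      have "depends_on (A \<union> (\<Union>y\<in>reach k 0. A' y)) (\<lambda>X. X \<in> D y)"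
      proof (rule depends_onI)
        fix X Y :: "'d config" assume eq: "\<And>e. e \<in> A \<union> (\<Union>y\<in>reach k 0. A' y) \<Longrightarrow> X e = Y e"
        have "X \<in> C \<longleftrightarrow> Y \<in> C" using depends_onD[OF A(3)] eq by blast
        moreover have z: "npaths k 0 0 v X = npaths k 0 0 v Y" if "v \<in> reach k 0" for v
          using depends_onD[OF A'(3)] eq that by blast
        moreover have "pick X = pick Y" unfolding pick_def using z by (metis (no_types, lifting))
        ultimately show "X \<in> D y \<longleftrightarrow> Y \<in> D y" unfolding D_def by auto
      qed
      then show ?thesis unfolding cyl_def
        using A A' by (intro exI[of _ "A \<union> (\<Union>y\<in>reach k 0. A' y)"]) (auto simp: finite_reach)
    qed
    have Ds: "D y \<in> sets (bern pe)" for y by (rule cyl_sets[OF cD])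
    have pick: "pick X \<in> reach k 0 \<and> 0 < npaths k 0 0 (pick X) X" if "\<exists>y\<in>reach k 0. 0 < npaths k 0 0 y X" for X
      unfolding pick_def by (rule someI_ex) (use that in blast)
    have sub: "B \<inter> C \<subseteq> (\<Union>y\<in>reach k 0. D y \<inter> slow \<beta> k y)"
    proof
      fix X assume X: "X \<in> B \<inter> C"
      then have "0 < W k 0 0 X" by (auto simp: B_def surv_def)
      then have ex: "\<exists>y\<in>reach k 0. 0 < npaths k 0 0 y X" by (rule W_pos_npaths)
      then have "X \<in> D (pick X)" using X by (simp add: D_def)
      moreover have "X \<in> slow \<beta> k (pick X)" using X pick[OF ex] by (auto simp: B_def)
      ultimately show "X \<in> (\<Union>y\<in>reach k 0. D y \<inter> slow \<beta> k y)" using pick[OF ex] by blast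
    qed
    have "P (B \<inter> C) \<le> P (\<Union>y\<in>reach k 0. D y \<inter> slow \<beta> k y)"
      using Ds by (intro bern.finite_measure_mono sub sets.finite_UN finite_reach) auto
    also have "\<dots> \<le> (\<Sum>y\<in>reach k 0. P (D y \<inter> slow \<beta> k y))"
      using Ds by (intro bern.finite_measure_subadditive_finite finite_reach) auto
    also have "\<dots> = ?\<nu> * (\<Sum>y\<in>reach k 0. P (D y))"
      unfolding P_slow_indep[OF cD] by (simp add: sum_distrib_left mult.commute)
    also have "(\<Sum>y\<in>reach k 0. P (D y)) = P (\<Union>y\<in>reach k 0. D y)"
      using Ds by (intro bern.finite_measure_finite_Union[symmetric] finite_reach) (auto simp: disjoint_family_on_def D_def)
    also have "\<dots> \<le> P C"
      by (intro bern.finite_measure_mono cyl_sets[OF C]) (auto simp: D_def)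
    finally show ?thesis by (simp add: mult_left_mono)
  qed
  \<comment> \<open>Inserting into \<open>key\<close> a cylinder event close to \<open>B\<close>
    shows that \<open>P B\<close> is at most \<open>?\<nu> * P B\<close>, so \<open>B\<close> is
    null.\<close>
  have "P B \<le> ?\<nu> * P B + 2 * e" if e: "0 < e" for e
  proof -
    obtain A C where C: "finite A" "depends_on A (\<lambda>X. X \<in> C)" "P ((B - C) \<union> (C - B)) < e"
      using cylinder_approx[OF Bs e] by blast
    have Cs: "C \<in> sets (bern pe)" by (rule depends_on_sets[OF C(1,2)])
    define k where "k = Suc (Max (insert 0 (fst ` A)))"
    have "fst a < k" if "a \<in> A" for a
    proof -
      have "fst a \<le> Max (insert 0 (fst ` A))" using C(1) that by (intro Max_ge) auto
      then show ?thesis by (simp add: k_def)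
    qed
    then have cC: "cyl 0 k (\<lambda>X. X \<in> C)" unfolding cyl_def using C by blast
    have "P (B - C) \<le> P ((B - C) \<union> (C - B))" "P (C - B) \<le> P ((B - C) \<union> (C - B))"
      using Bs Cs by (auto intro!: bern.finite_measure_mono)
    then have d: "P (B - C) \<le> e" "P (C - B) \<le> e" using C(3) by linarith+
    have "P B \<le> P (B \<inter> C) + P (B - C)"
      using measure_Un_le[of "B \<inter> C" "bern pe" "B - C"] Bs Cs by (simp add: Un_Diff_Int Int_Diff_Un)
    moreover have "P C \<le> P (C \<inter> B) + P (C - B)"
      using measure_Un_le[of "C \<inter> B" "bern pe" "C - B"] Bs Cs by (simp add: Int_Diff_Un)
    moreover have "P (C \<inter> B) \<le> P B" using Bs by (intro bern.finite_measure_mono) auto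
    ultimately have "P B \<le> P (B \<inter> C) + e" "P C \<le> P B + e" using d by linarith+
    moreover have "?\<nu> * P C \<le> ?\<nu> * (P B + e)" using \<open>P C \<le> P B + e\<close> by (intro mult_left_mono) auto
    moreover have "?\<nu> * e \<le> 1 * e" using e fast by (intro mult_right_mono) auto
    ultimately show ?thesis using key[OF cC] by (simp add: distrib_left)
  qed
  then have "P B \<le> ?\<nu> * P B + e" if "0 < e" for e
    using that half_gt_zero[OF that] by fastforce
  then have "P B \<le> ?\<nu> * P B" by (rule field_le_epsilon)
  moreover have "0 < (1 - ?\<nu>) * P B" if "P B \<noteq> 0"
    using fast that by (intro mult_pos_pos) (simp_all add: zero_less_measure_iff)
  ultimately have "P B = 0" by (fastforce simp: algebra_simps)
  then have "AE X in bern pe. X \<notin> B"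
    using Bs by (intro AE_not_in) (simp add: null_sets_def bern.emeasure_eq_measure)
  then show ?thesis
    by eventually_elim (auto simp: B_def)
qed

end

section \<open>Path sets, percolation and almost sure growth\<close>

context percolation_kernel
begin

text \<open>Excludes a null set of configurations, on which \<open>W\<close> could miss paths
  through displacements outside \<open>R\<close> and \<open>card\<close> could meet an infinite
  set.\<close>

definition good :: "'d config \<Rightarrow> bool" where
  "good X \<longleftrightarrow> (\<forall>n x y. X (n, x, y) \<longrightarrow> y - x \<in> R)"

lemma AE_good: "AE X in bern pe. good X"
proof -
  have "AE X in bern pe. \<not> X (n, x, y)" if "y - x \<notin> R" for n x y
  proof -
    have "P {X. X (n, x, y)} = E (bit n x (y - x))"
      using measure_eq_Ev[OF depends_on_sets[of "{(n, x, y)}" "{X. X (n, x, y)}"]]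
      by (simp add: depends_on_def bit_def[abs_def])
    also have "\<dots> = 0" using that by (simp add: E_bit f_outside)
    finally have "{X. X (n, x, y)} \<in> null_sets (bern pe)"
      using depends_on_sets[of "{(n, x, y)}" "{X. X (n, x, y)}" pe]
      by (simp add: depends_on_def null_sets_def bern.emeasure_eq_measure)
    from AE_not_in[OF this] show ?thesis by simp
  qed
  then have "AE X in bern pe. y - x \<notin> R \<longrightarrow> \<not> X (n, x, y)" for n x y by (cases "y - x \<in> R") auto
  then have "AE X in bern pe. \<forall>n x y. y - x \<notin> R \<longrightarrow> \<not> X (n, x, y)"
    unfolding AE_all_countable by blast
  then show ?thesis by eventually_elim (auto simp: good_def)
qed

definition paths :: "'d config \<Rightarrow> nat \<Rightarrow> nat \<Rightarrow> (int ^ 'd) \<Rightarrow> (nat \<Rightarrow> int ^ 'd) set" where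
  "paths X k n x = {S \<in> {0..k} \<rightarrow>\<^sub>E UNIV. S 0 = x \<and> (\<forall>i<k. X (n + i, S i, S (Suc i)))}"

lemma card_paths:
  assumes "good X"
  shows "finite (paths X k n x) \<and> real (card (paths X k n x)) = W k n x X"
proof (induction k arbitrary: n x)
  case 0
  have "paths X 0 n x = {\<lambda>i. if i = 0 then x else undefined}"
    by (auto simp: paths_def PiE_def extensional_def fun_eq_iff)
  then show ?case by simp
next
  case (Suc k)
  \<comment> \<open>\<open>?c S\<close> puts \<open>x\<close> in front of \<open>S\<close> and keeps
    the value \<open>undefined\<close> beyond \<open>Suc k\<close>, as extensional functions
    require.\<close>
  let ?c = "\<lambda>S i. if i = 0 then x else if i \<le> Suc k then S (i - 1) else undefined"
  let ?R = "{s \<in> R. X (n, x, x + s)}"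
  let ?Q = "\<lambda>s. ?c ` paths X k (Suc n) (x + s)"
  have eq: "paths X (Suc k) n x = (\<Union>s\<in>?R. ?Q s)"
  proof (intro equalityI subsetI)
    fix S assume S: "S \<in> paths X (Suc k) n x"
    let ?s = "S 1 - x" and ?T = "\<lambda>i. if i \<le> k then S (Suc i) else undefined"
    have X0: "X (n, x, S 1)" using S by (auto simp: paths_def)
    then have s: "?s \<in> ?R" using assms by (auto simp: good_def)
    have "X (Suc n + i, ?T i, ?T (Suc i))" if "i < k" for i
      using S that unfolding paths_def by (auto dest!: spec[of _ "Suc i"])
    then have "?T \<in> paths X k (Suc n) (x + ?s)" by (auto simp: paths_def PiE_def extensional_def)
    moreover have "S = ?c ?T" using S by (auto simp: paths_def PiE_def extensional_def fun_eq_iff)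
    ultimately have "S \<in> ?Q ?s" by (intro image_eqI[of S ?c ?T])
    then show "S \<in> (\<Union>s\<in>?R. ?Q s)" by (rule UN_I[OF s])
  next
    fix S assume "S \<in> (\<Union>s\<in>?R. ?Q s)"
    then obtain s T where s: "s \<in> ?R" and T: "T \<in> paths X k (Suc n) (x + s)" and S: "S = ?c T" by blast
    have "X (n + i, S i, S (Suc i))" if "i < Suc k" for i
    proof (cases i)
      case 0 then show ?thesis using s T by (simp add: S paths_def)
    next
      case (Suc j)
      then have "X (Suc n + j, T j, T (Suc j))" using T that by (simp add: paths_def)
      then show ?thesis using Suc that by (simp add: S)
    qed
    then show "S \<in> paths X (Suc k) n x" by (auto simp: paths_def PiE_def extensional_def S)
  qed
  have inj: "inj_on ?c (paths X k (Suc n) v)" for v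
  proof (rule inj_onI)
    fix S T assume ST: "S \<in> paths X k (Suc n) v" "T \<in> paths X k (Suc n) v" "?c S = ?c T"
    show "S = T"
    proof
      fix i
      show "S i = T i"
      proof (cases "i \<le> k")
        case True then show ?thesis using fun_cong[OF ST(3), of "Suc i"] by simp
      next
        case False then show ?thesis using ST(1,2) by (auto simp: paths_def PiE_def extensional_def)
      qed
    qed
  qed
  have fin: "finite (?Q s)" "real (card (?Q s)) = W k (Suc n) (x + s) X" for s
    using Suc[of "Suc n" "x + s"] by (simp_all add: card_image[OF inj])
  have disj: "?Q s \<inter> ?Q t = {}" if "s \<noteq> t" for s t
  proof (rule ccontr)
    assume "?Q s \<inter> ?Q t \<noteq> {}"
    then obtain S T where "S \<in> paths X k (Suc n) (x + s)" "T \<in> paths X k (Suc n) (x + t)" "?c S = ?c T" by blast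
    then show False using that fun_cong[of "?c S" "?c T" 1] by (auto simp: paths_def)
  qed
  have "real (card (paths X (Suc k) n x)) = (\<Sum>s\<in>?R. W k (Suc n) (x + s) X)"
    unfolding eq using finite_R fin disj by (subst card_UN_disjoint) auto
  also have "\<dots> = W (Suc k) n x X"
    unfolding path_sum.simps using finite_R by (intro sum.mono_neutral_cong_left) (auto simp: bit_def)
  finally show ?case unfolding eq using fin finite_R by auto
qed

lemma num_paths_eq: "good X \<Longrightarrow> real (num_paths X N) = W N 0 0 X"
proof -
  assume "good X"
  have "{S \<in> {0..N} \<rightarrow>\<^sub>E UNIV. S 0 = 0 \<and> open_path X {0..N} S} = paths X N 0 0"
    unfolding paths_def open_path_def by (auto simp: Suc_le_eq)
  then show ?thesis using card_paths[OF \<open>good X\<close>, of N 0 0] by (simp add: num_paths_def)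
qed

lemma W_pos_Suc: "0 < W (Suc N) n x X \<Longrightarrow> 0 < W N n x X"
  using W_add_le[of N 1 n x X] W_nonneg[of N n x X] by (cases "W N n x X = 0") auto

lemma W_pos_antimono: "0 < W N n x X \<Longrightarrow> M \<le> N \<Longrightarrow> 0 < W M n x X"
  by (induction N rule: nat_induct) (auto elim!: le_SucE dest: W_pos_Suc simp del: path_sum.simps)

text \<open>The step of Konig's lemma: if the finitely many open successors all died out, the
  largest of their extinction levels would bound the lifetime of \<open>x\<close>.\<close>

lemma konig_step:
  assumes "\<forall>N. 0 < W N n x X"
  shows "\<exists>s\<in>R. X (n, x, x + s) \<and> (\<forall>N. 0 < W N (Suc n) (x + s) X)"
proof (rule ccontr)
  assume "\<not> ?thesis"
  then have "\<forall>s\<in>R. \<exists>N. X (n, x, x + s) \<longrightarrow> \<not> 0 < W N (Suc n) (x + s) X" by blast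
  then obtain K where K: "\<And>s. s \<in> R \<Longrightarrow> X (n, x, x + s) \<Longrightarrow> \<not> 0 < W (K s) (Suc n) (x + s) X" by metis
  let ?N = "Max (insert 0 (K ` R))"
  have "W (Suc ?N) n x X = 0"
    unfolding path_sum.simps
  proof (intro sum.neutral ballI)
    fix s assume s: "s \<in> R"
    have "K s \<le> ?N" using s finite_R by (intro Max_ge) auto
    then have "\<not> 0 < W ?N (Suc n) (x + s) X" if "X (n, x, x + s)"
      using W_pos_antimono K[OF s that] by blast
    then have "X (n, x, x + s) \<Longrightarrow> W ?N (Suc n) (x + s) X = 0"
      using W_nonneg[of ?N "Suc n" "x + s" X] by fastforce
    then show "bit n x s X * W ?N (Suc n) (x + s) X = 0" by (auto simp: bit_def)
  qed
  then show False using assms by (metis less_irrefl)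
qed

lemma surv_percolation: "X \<in> surv \<Longrightarrow> X \<in> percolation"
proof -
  assume X: "X \<in> surv"
  have "\<exists>S. S 0 = 0 \<and> (\<forall>n. (\<forall>N. 0 < W N n (S n) X) \<and> X (n, S n, S (Suc n)))"
  proof -
    have "\<exists>S. (\<forall>N. 0 < W N 0 (S 0) X) \<and> S 0 = 0 \<and> (\<forall>n. ((\<forall>N. 0 < W N (Suc n) (S (Suc n)) X)) \<and> X (n, S n, S (Suc n)))"
    proof -
      have "\<exists>S. \<forall>n. ((\<forall>N. 0 < W N n (S n) X) \<and> (n = 0 \<longrightarrow> S n = 0)) \<and> X (n, S n, S (Suc n))"
      proof (rule dependent_nat_choice)
        show "\<exists>x. (\<forall>N. 0 < W N 0 x X) \<and> (0 = 0 \<longrightarrow> x = 0)" using X by (auto simp: surv_def)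
      next
        fix x n assume "(\<forall>N. 0 < W N n x X) \<and> (n = 0 \<longrightarrow> x = 0)"
        then show "\<exists>y. ((\<forall>N. 0 < W N (Suc n) y X) \<and> (Suc n = 0 \<longrightarrow> y = 0)) \<and> X (n, x, y)"
          using konig_step[of n x X] by blast
      qed
      then show ?thesis by blast
    qed
    then obtain S where S: "\<forall>N. 0 < W N 0 (S 0) X" "S 0 = 0" "\<And>n. (\<forall>N. 0 < W N (Suc n) (S (Suc n)) X) \<and> X (n, S n, S (Suc n))" by blast
    have "\<forall>N. 0 < W N n (S n) X" for n using S by (cases n) auto
    then show ?thesis using S by blast
  qed
  then show ?thesis unfolding percolation_def open_path_def by blast
qed

lemma percolation_surv:
  assumes "good X" "X \<in> percolation" shows "X \<in> surv"
proof -
  obtain S where S: "S 0 = 0" "\<And>n. X (n, S n, S (Suc n))"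
    using assms(2) unfolding percolation_def open_path_def by auto
  have "0 < W N n (S n) X" for N n
  proof (induction N arbitrary: n)
    case (Suc N)
    let ?s = "S (Suc n) - S n"
    have s: "?s \<in> R" using S(2)[of n] assms(1) by (auto simp: good_def)
    have "bit n (S n) ?s X * W N (Suc n) (S n + ?s) X \<le> W (Suc N) n (S n) X"
      unfolding path_sum.simps using finite_R s bit_nonneg W_nonneg
      by (intro member_le_sum[of ?s R "\<lambda>s. bit n (S n) s X * W N (Suc n) (S n + s) X"]) auto
    moreover have "bit n (S n) ?s X * W N (Suc n) (S n + ?s) X = W N (Suc n) (S (Suc n)) X"
      using S(2)[of n] by (simp add: bit_def)
    ultimately show ?case using Suc[of "Suc n"] by linarith
  qed simp
  from this[of _ 0] show ?thesis using S(1) by (simp add: surv_def)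
qed

lemma perc_measure_eq: "perc_measure f p = completion (bern pe)"
proof -
  have "(\<lambda>(n::nat, x, y). measure_pmf (bernoulli_pmf (p * f (y - x)))) = (\<lambda>e. measure_pmf (bernoulli_pmf (pe e)))"
    by (auto simp: pe_def fun_eq_iff)
  then show ?thesis by (simp add: perc_measure_def bern_def)
qed

lemma AE_percolation: "AE X in bern pe. X \<in> percolation \<longleftrightarrow> X \<in> surv"
  using AE_good by eventually_elim (use surv_percolation percolation_surv in blast)

lemma percolation_sets: "percolation \<in> sets (completion (bern pe))"
proof -
  have "AE X in completion (bern pe). X \<in> surv \<longleftrightarrow> X \<in> percolation"
    by (rule AE_completion) (use AE_percolation in eventually_elim, blast)
  then show ?thesis
    by (rule completion.in_sets_AE) auto
qed

lemma measure_percolation: "measure (perc_measure f p) percolation = P surv"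
proof -
  have "measure (completion (bern pe)) percolation = measure (completion (bern pe)) surv"
    by (rule measure_eq_AE) (auto intro!: AE_completion AE_percolation percolation_sets)
  then show ?thesis by (simp add: perc_measure_eq)
qed

text \<open>Divergence from \<open>exp (\<beta> N)\<close> infinitely often transfers along a
  path of length \<open>k\<close> at the cost of a time shift only.\<close>

lemma growth_ge:
  assumes "good X" "0 < npaths k 0 0 y X" "X \<notin> slow \<beta> k y"
  shows "ereal \<beta> \<le> growth X"
proof (rule ccontr)
  assume "\<not> ereal \<beta> \<le> growth X"
  then have "growth X < ereal \<beta>" by simp
  then obtain \<gamma>' where "growth X < \<gamma>'" "\<gamma>' < ereal \<beta>" using dense by blast
  then obtain \<gamma> where \<gamma>: "growth X < ereal \<gamma>" "\<gamma> < \<beta>" by (cases \<gamma>') auto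
  have ev: "\<forall>\<^sub>F N in sequentially. ereal (1 / real N) * log_nat (num_paths X N) < ereal \<gamma>"
    using \<gamma>(1) unfolding growth_def by (rule Limsup_lessD)
  then obtain N0 where N0: "\<And>N. N0 \<le> N \<Longrightarrow> ereal (1 / real N) * log_nat (num_paths X N) < ereal \<gamma>"
    unfolding eventually_sequentially by blast
  obtain j :: nat where npaths: "npaths k 0 0 y X = real j" using npaths_Nats Nats_cases by blast
  then have zz1: "1 \<le> npaths k 0 0 y X" using assms(2) by simp
  have "\<forall>\<^sub>F N in sequentially. \<gamma> * real k / (\<beta> - \<gamma>) \<le> real N"
    by (rule eventually_sequentiallyI[of "nat \<lceil>\<gamma> * real k / (\<beta> - \<gamma>)\<rceil>"]) linarith
  then obtain N1 where N1: "\<And>N. N1 \<le> N \<Longrightarrow> \<gamma> * real k / (\<beta> - \<gamma>) \<le> real N"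
    unfolding eventually_sequentially by blast
  obtain N where N: "Suc N0 + N1 \<le> N" "exp (\<beta> * real N) < W N k y X"
    using assms(3) unfolding slow_def eventually_sequentially by (auto simp: not_le)
  have "W N k y X \<le> npaths k 0 0 y X * W N (0 + k) y X" using zz1 W_nonneg[of N k y X] by (simp add: mult_le_cancel_right1)
  also have "\<dots> \<le> W (k + N) 0 0 X" by (rule W_add_ge)
  finally have W: "exp (\<beta> * real N) < W (k + N) 0 0 X" using N(2) by linarith
  then have pos: "0 < W (k + N) 0 0 X" using exp_gt_zero[of "\<beta> * real N"] by linarith
  have ne: "num_paths X (k + N) \<noteq> 0" using pos num_paths_eq[OF assms(1), of "k + N"] by (metis less_irrefl of_nat_0)
  have "\<beta> * real N < ln (W (k + N) 0 0 X)" using W pos by (metis exp_gt_zero ln_exp ln_less_cancel_iff)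
  moreover have "\<gamma> * real (k + N) \<le> \<beta> * real N"
    using N1[of N] N(1) \<gamma>(2) by (simp add: pos_divide_le_eq algebra_simps)
  ultimately have "\<gamma> * real (k + N) < ln (W (k + N) 0 0 X)" by linarith
  then have "\<gamma> < 1 / real (k + N) * ln (W (k + N) 0 0 X)" using N(1) by (simp add: field_simps)
  moreover have "ereal (1 / real (k + N)) * log_nat (num_paths X (k + N)) = ereal (1 / real (k + N) * ln (W (k + N) 0 0 X))"
    using ne by (simp add: log_nat_def num_paths_eq[OF assms(1)])
  ultimately show False using N0[of "k + N"] N(1) by simp
qed

lemma growth_le:
  assumes "good X" "X \<in> slow \<beta> 0 0"
  shows "growth X \<le> ereal \<beta>"
  unfolding growth_def
proof (rule Limsup_bounded)
  have "\<forall>\<^sub>F N in sequentially. W N 0 0 X \<le> exp (\<beta> * real N)" using assms(2) by (simp add: slow_def)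
  moreover have "\<forall>\<^sub>F N in sequentially. 1 \<le> N" by (rule eventually_ge_at_top)
  ultimately show "\<forall>\<^sub>F N in sequentially. ereal (1 / real N) * log_nat (num_paths X N) \<le> ereal \<beta>"
  proof eventually_elim
    case (elim N)
    show ?case
    proof (cases "num_paths X N = 0")
      case True then show ?thesis using elim by (simp add: log_nat_def)
    next
      case False
      then have "0 < W N 0 0 X" using num_paths_eq[OF assms(1), of N] by (metis of_nat_0_less_iff not_gr_zero)
      then have "ln (W N 0 0 X) \<le> \<beta> * real N" using elim(1) by (metis exp_gt_zero ln_exp ln_le_cancel_iff)
      then have "1 / real N * ln (W N 0 0 X) \<le> \<beta>" using elim(2) by (simp add: field_simps)
      then show ?thesis using False by (simp add: log_nat_def num_paths_eq[OF assms(1)])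
    qed
  qed
qed

text \<open>The constant is the supremum of the rates that are exceeded infinitely often with
  positive probability. Above it \<open>slow\<close> has probability one; below it
  \<open>fast_somewhere\<close> and \<open>growth_ge\<close> give the lower bound on
  survival.\<close>

lemma growth_constant:
  assumes "0 < P surv"
  shows "\<exists>c::real. AE X in bern pe. X \<in> surv \<longrightarrow> growth X = ereal c"
proof -
  define S where "S = {\<beta>. P (slow \<beta> 0 0) < 1}"
  have R: "R \<noteq> {}" using f_sum by auto
  \<comment> \<open>On survival the path count is a positive integer, so it cannot decay
    exponentially.\<close>
  have "- 1 \<in> S"
  proof -
    have "slow (- 1) 0 0 \<inter> surv = {}"
    proof (rule ccontr)
      assume "slow (- 1) 0 0 \<inter> surv \<noteq> {}"
      then obtain X where X: "X \<in> slow (- 1) 0 0" "X \<in> surv" by blast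
      then obtain N0 where N0: "\<And>N. N0 \<le> N \<Longrightarrow> W N 0 0 X \<le> exp (- 1 * real N)"
        by (auto simp: slow_def eventually_sequentially)
      obtain j :: nat where j: "W (Suc N0) 0 0 X = real j" using path_sum_Nats[of "\<lambda>_. 1"] Nats_cases by (metis Nats_1)
      then have "1 \<le> W (Suc N0) 0 0 X" using X(2) by (simp add: surv_def) (metis of_nat_0_less_iff Suc_leI One_nat_def of_nat_1 of_nat_mono j)
      moreover have "exp (- 1 * real (Suc N0)) < 1" by simp
      ultimately show False using N0[OF le_SucI[OF order_refl]] by linarith
    qed
    then have "P (slow (- 1) 0 0) + P surv = P (slow (- 1) 0 0 \<union> surv)"
      by (intro bern.finite_measure_Union[symmetric]) auto
    also have "\<dots> \<le> 1" by simp
    finally show ?thesis using assms by (simp add: S_def)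
  qed
  have up: "P (slow \<beta> 0 0) = 1" if "ln (real (card R)) \<le> \<beta>" for \<beta>
  proof -
    have c: "0 < real (card R)" using R finite_R by (simp add: card_gt_0_iff)
    have "W N 0 0 X \<le> exp (\<beta> * real N)" for N X
    proof -
      have "W N 0 0 X \<le> real (card R) ^ N" by (rule W_le)
      also have "\<dots> = exp (ln (real (card R)) * real N)" using c by (simp add: exp_of_nat2_mult)
      also have "\<dots> \<le> exp (\<beta> * real N)" using that by (simp add: mult_right_mono)
      finally show ?thesis .
    qed
    then have "slow \<beta> 0 0 = UNIV" by (auto simp: slow_def)
    then show ?thesis by simp
  qed
  have bdd: "bdd_above S"
    using up unfolding S_def by (intro bdd_aboveI[of _ "ln (real (card R))"]) (metis (mono_tags) linear less_irrefl mem_Collect_eq)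
  define c where "c = Sup S"
  have lower: "AE X in bern pe. X \<in> surv \<longrightarrow> ereal (c - 1 / real (Suc n)) \<le> growth X" for n
  proof -
    have "c - 1 / real (Suc n) < Sup S" by (simp add: c_def)
    then obtain \<beta> where \<beta>: "\<beta> \<in> S" "c - 1 / real (Suc n) < \<beta>" using \<open>- 1 \<in> S\<close> bdd less_cSup_iff[of S] by blast
    have "AE X in bern pe. X \<in> surv \<longrightarrow> (\<exists>k y. 0 < npaths k 0 0 y X \<and> X \<notin> slow \<beta> k y)"
      using \<beta>(1) by (intro fast_somewhere) (simp add: S_def)
    with AE_good show ?thesis
    proof eventually_elim
      case (elim X)
      show ?case
      proof
        assume "X \<in> surv"
        then have "ereal \<beta> \<le> growth X" using elim growth_ge by blast
        moreover have "ereal (c - 1 / real (Suc n)) \<le> ereal \<beta>" using \<beta>(2) by simp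
        ultimately show "ereal (c - 1 / real (Suc n)) \<le> growth X" by (rule order_trans[rotated])
      qed
    qed
  qed
  have upper: "AE X in bern pe. growth X \<le> ereal (c + 1 / real (Suc n))" for n
  proof -
    have "c + 1 / real (Suc n) \<notin> S"
    proof
      assume "c + 1 / real (Suc n) \<in> S"
      then have "c + 1 / real (Suc n) \<le> c" unfolding c_def using bdd by (rule cSup_upper)
      then show False by simp
    qed
    then have "P (slow (c + 1 / real (Suc n)) 0 0) = 1" by (intro antisym bern.prob_le_1) (simp add: S_def)
    then have "AE X in bern pe. X \<in> slow (c + 1 / real (Suc n)) 0 0" by (subst (asm) bern.prob_eq_1) auto
    with AE_good show ?thesis by eventually_elim (rule growth_le)
  qed
  have "AE X in bern pe. \<forall>n. X \<in> surv \<longrightarrow> ereal (c - 1 / real (Suc n)) \<le> growth X"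
    using lower unfolding AE_all_countable by blast
  moreover have "AE X in bern pe. \<forall>n. growth X \<le> ereal (c + 1 / real (Suc n))"
    using upper unfolding AE_all_countable by blast
  ultimately have "AE X in bern pe. X \<in> surv \<longrightarrow> growth X = ereal c"
  proof eventually_elim
    case (elim X)
    show ?case
    proof
      assume X: "X \<in> surv"
      have lim: "(\<lambda>n. 1 / real (Suc n)) \<longlonglongrightarrow> 0" using LIMSEQ_inverse_real_of_nat by (simp add: inverse_eq_divide)
      have l1: "(\<lambda>n. ereal (c - 1 / real (Suc n))) \<longlonglongrightarrow> ereal c"
        using tendsto_diff[OF tendsto_const lim, of c] by simp
      have l2: "(\<lambda>n. ereal (c + 1 / real (Suc n))) \<longlonglongrightarrow> ereal c"
        using tendsto_add[OF tendsto_const lim, of c] by simp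
      have "ereal c \<le> growth X" by (rule LIMSEQ_le_const2[OF l1]) (use elim(1) X in blast)
      moreover have "growth X \<le> ereal c" by (rule LIMSEQ_le_const[OF l2]) (use elim(2) in blast)
      ultimately show "growth X = ereal c" by simp
    qed
  qed
  then show ?thesis by blast
qed

text \<open>On survival, constancy of the growth makes the definite description denote a real
  number, and the assumed bound puts it strictly below \<open>ln p\<close>. If survival has
  probability zero, the rate is minus infinity.\<close>

lemma growth_rate_neq:
  assumes "0 < P surv \<Longrightarrow> \<exists>\<beta><ln p. AE X in bern pe. \<forall>\<^sub>F N in sequentially. W N 0 0 X \<le> exp (\<beta> * real N)"
  shows "growth_rate f p \<noteq> ereal (ln p)"
proof (cases "0 < P surv")
  case False
  then show ?thesis by (simp add: growth_rate_def measure_percolation)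
next
  case True
  let ?U = "uniform_measure (perc_measure f p) percolation"
  obtain c where c: "AE X in bern pe. X \<in> surv \<longrightarrow> growth X = ereal c" using growth_constant[OF True] by blast
  have em: "emeasure (completion (bern pe)) percolation \<noteq> 0" "emeasure (completion (bern pe)) percolation \<noteq> \<infinity>"
  proof -
    have "emeasure (completion (bern pe)) percolation = emeasure (completion (bern pe)) surv"
      by (rule emeasure_eq_AE) (auto intro!: AE_completion AE_percolation percolation_sets)
    also have "\<dots> = ennreal (P surv)" by (simp add: bern.emeasure_eq_measure)
    finally show "emeasure (completion (bern pe)) percolation \<noteq> 0" "emeasure (completion (bern pe)) percolation \<noteq> \<infinity>"
      using True by auto
  qed
  interpret U: prob_space ?U unfolding perc_measure_eq by (rule prob_space_uniform_measure[OF em])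
  have AEU: "AE X in ?U. Q X" if "AE X in bern pe. X \<in> surv \<longrightarrow> Q X" for Q
  proof -
    have "AE X in bern pe. X \<in> percolation \<longrightarrow> Q X" using that AE_percolation by eventually_elim blast
    then show ?thesis unfolding perc_measure_eq by (intro AE_uniform_measureI percolation_sets AE_completion)
  qed
  have gc: "AE X in ?U. growth X = ereal c" by (rule AEU[OF c])
  have the: "(THE c. AE X in ?U. growth X = c) = ereal c"
  proof (rule the_equality, rule gc)
    fix c' assume "AE X in ?U. growth X = c'"
    with gc have "AE X in ?U. c' = ereal c" by eventually_elim simp
    then show "c' = ereal c" by (simp add: U.AE_const)
  qed
  obtain \<beta> where \<beta>: "\<beta> < ln p" "AE X in bern pe. \<forall>\<^sub>F N in sequentially. W N 0 0 X \<le> exp (\<beta> * real N)"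
    using assms[OF True] by blast
  have "AE X in bern pe. growth X \<le> ereal \<beta>"
    using AE_good \<beta>(2) by eventually_elim (auto intro: growth_le simp: slow_def)
  then have "AE X in ?U. growth X \<le> ereal \<beta>" by (intro AEU) (auto elim: eventually_mono)
  with gc have "AE X in ?U. ereal c \<le> ereal \<beta>" by eventually_elim simp
  then have "c \<le> \<beta>" by (simp add: U.AE_const)
  then show ?thesis using \<beta>(1) True by (simp add: growth_rate_def measure_percolation the)
qed

end

section \<open>Bounds on binomial coefficients\<close>

lemma central_binomial_sq_le: "(real (2 * n choose n))\<^sup>2 * (2 * real n + 1) \<le> 16 ^ n"
proof (induction n)
  case (Suc n)
  let ?c = "real (2 * n choose n)"
  have c1: "real (2 * Suc n choose Suc n) = fact (Suc (Suc (2 * n))) / (fact (Suc n) * fact (Suc n))"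
    by (subst binomial_fact) (simp_all add: numeral_2_eq_2)
  have c2: "?c = fact (2 * n) / (fact n * fact n)"
    by (subst binomial_fact) (simp_all add: mult_2)
  have "2 * e * y * b / (e * c * (e * c)) = b / (c * c) * (2 * y / e)" if "0 < e" for e y b c :: real
    using that by (simp add: mult_ac)
  from this[of "real n + 1" "2 * real n + 1" "fact (2 * n)" "fact n"]
  have rec: "real (2 * Suc n choose Suc n) = ?c * (2 * (2 * real n + 1) / (real n + 1))"
    unfolding c1 c2 fact_Suc by (simp add: algebra_simps)
  have q: "(2 * (2 * real n + 1) / (real n + 1))\<^sup>2 * (2 * real (Suc n) + 1) \<le> 16 * (2 * real n + 1)"
  proof -
    have "(2 * real n + 1) * (2 * real n + 3) \<le> 4 * (real n + 1)\<^sup>2" by (simp add: power2_eq_square algebra_simps)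
    then have "(2 * real n + 1) * (2 * real n + 3) / (real n + 1)\<^sup>2 \<le> 4" by (simp add: pos_divide_le_eq)
    then have "4 * (2 * real n + 1) * ((2 * real n + 1) * (2 * real n + 3) / (real n + 1)\<^sup>2) \<le> 4 * (2 * real n + 1) * 4"
      by (intro mult_left_mono) auto
    moreover have "(2 * (2 * real n + 1) / (real n + 1))\<^sup>2 * (2 * real (Suc n) + 1)
       = 4 * (2 * real n + 1) * ((2 * real n + 1) * (2 * real n + 3) / (real n + 1)\<^sup>2)"
      by (simp add: power2_eq_square add.commute) (simp add: algebra_simps)
    ultimately show ?thesis by simp
  qed
  have "(real (2 * Suc n choose Suc n))\<^sup>2 * (2 * real (Suc n) + 1)
      = ?c\<^sup>2 * ((2 * (2 * real n + 1) / (real n + 1))\<^sup>2 * (2 * real (Suc n) + 1))"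
    unfolding rec power_mult_distrib by simp
  also have "\<dots> \<le> ?c\<^sup>2 * (16 * (2 * real n + 1))" by (intro mult_left_mono q) simp
  also have "\<dots> \<le> 16 ^ Suc n" using Suc by (simp add: algebra_simps)
  finally show ?case .
qed simp

text \<open>Fair binomial atoms are at most \<open>1 / sqrt (k + 1)\<close>, in a squared form that
  keeps the arithmetic rational. For odd \<open>k\<close> the maximum is half of the next central
  coefficient.\<close>

lemma binomial_sq_le: "(real (k choose j))\<^sup>2 * (real k + 1) \<le> 4 ^ k"
proof (cases "even k")
  case True
  then obtain n where k: "k = 2 * n" by blast
  have "real (k choose j) \<le> real (2 * n choose n)" unfolding k using binomial_maximum'[of n j] by simp
  then have "(real (k choose j))\<^sup>2 * (real k + 1) \<le> (real (2 * n choose n))\<^sup>2 * (2 * real n + 1)"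
    unfolding k by (intro mult_mono power_mono) auto
  also have "\<dots> \<le> 4 ^ k" using central_binomial_sq_le[of n] by (simp add: k power_mult)
  finally show ?thesis .
next
  case False
  then obtain n where k: "k = 2 * n + 1" by (auto elim: oddE)
  have "k div 2 = n" using k by simp
  then have "real (k choose j) \<le> real (2 * n + 1 choose n)" using binomial_maximum[of k j] k by simp
  moreover have "2 * real (2 * n + 1 choose n) = real (2 * Suc n choose Suc n)"
  proof -
    have "2 * n + 1 choose Suc n = 2 * n + 1 choose n" using binomial_symmetric[of n "2 * n + 1"] by simp
    then have "2 * Suc n choose Suc n = 2 * (2 * n + 1 choose n)" by simp
    then show ?thesis by (metis of_nat_mult of_nat_numeral)
  qed
  ultimately have "(real (k choose j))\<^sup>2 \<le> (real (2 * Suc n choose Suc n) / 2)\<^sup>2" by (intro power_mono) auto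
  then have "(real (k choose j))\<^sup>2 * (real k + 1) \<le> (real (2 * Suc n choose Suc n) / 2)\<^sup>2 * (2 * real (Suc n) + 1)"
    unfolding k by (intro mult_mono) auto
  also have "\<dots> \<le> 16 ^ Suc n / 4" using central_binomial_sq_le[of "Suc n"] by (simp add: power_divide)
  also have "\<dots> = 4 ^ k" by (simp add: k power_mult)
  finally show ?thesis .
qed

section \<open>A local limit bound\<close>

definition avg1 :: "nat \<Rightarrow> (int \<Rightarrow> real) \<Rightarrow> int \<Rightarrow> real" where
  "avg1 n \<phi> t = (\<Sum>q<n. \<phi> (t + int q)) / real n"

lemma sum_lessThan_double: "(\<Sum>q<2 * h. F q) = (\<Sum>q<h. F q) + (\<Sum>q<h. F (q + h :: nat) :: real)"
proof -
  have "(\<Sum>q<2 * h. F q) = sum F ({..<h} \<union> {h..<2 * h})" by (intro arg_cong[of _ _ "sum F"]) auto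
  also have "\<dots> = sum F {..<h} + sum F {h..<2 * h}" by (rule sum.union_disjoint) auto
  also have "sum F {h..<2 * h} = (\<Sum>q<h. F (q + h))"
    by (rule sum.reindex_bij_witness[of _ "\<lambda>q. q + h" "\<lambda>q. q - h"]) auto
  finally show ?thesis .
qed

lemma avg1_double: "avg1 (2 * h) \<phi> t = (avg1 h \<phi> t + avg1 h \<phi> (t + int h)) / 2"
  unfolding avg1_def sum_lessThan_double by (simp add: add_divide_distrib add_ac)

lemma pascal_sum:
  "(\<Sum>j\<le>Suc k. real (Suc k choose j) * a j) = (\<Sum>j\<le>k. real (k choose j) * a j) + (\<Sum>j\<le>k. real (k choose j) * a (Suc j))"
proof -
  have "(\<Sum>j\<le>Suc k. real (Suc k choose j) * a j) = a 0 + (\<Sum>j\<le>k. real (k choose j) * a (Suc j) + real (k choose Suc j) * a (Suc j))"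
    by (subst sum.atMost_Suc_shift) (simp add: algebra_simps)
  moreover have "(\<Sum>j\<le>Suc k. real (k choose j) * a j) = a 0 + (\<Sum>j\<le>k. real (k choose Suc j) * a (Suc j))"
    by (subst sum.atMost_Suc_shift) simp
  moreover have "(\<Sum>j\<le>Suc k. real (k choose j) * a j) = (\<Sum>j\<le>k. real (k choose j) * a j)" by simp
  ultimately show ?thesis by (simp add: sum.distrib del: sum.atMost_Suc)
qed

text \<open>A uniform variable on \<open>2h\<close> points is \<open>h\<close> times a fair coin plus a
  uniform variable on \<open>h\<close> points; the sums of the latter are equidistributed mod
  \<open>h\<close>, so only the binomial atoms matter.\<close>

lemma avg1_double_pow:
  "(avg1 (2 * h) ^^ k) \<phi> t = (\<Sum>j\<le>k. real (k choose j) * (avg1 h ^^ k) \<phi> (t + int h * int j)) / 2 ^ k"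
proof (induction k arbitrary: t)
  case (Suc k)
  let ?b = "\<lambda>k t. (\<Sum>j\<le>k. real (k choose j) * (avg1 h ^^ k) \<phi> (t + int h * int j)) / 2 ^ k"
  have lin: "avg1 h (?b k) t = (\<Sum>j\<le>k. real (k choose j) * (avg1 h ^^ Suc k) \<phi> (t + int h * int j)) / 2 ^ k" for t
  proof -
    have "avg1 h (?b k) t = (\<Sum>q<h. (\<Sum>j\<le>k. real (k choose j) * (avg1 h ^^ k) \<phi> (t + int q + int h * int j))) / 2 ^ k / real h"
      by (simp add: avg1_def sum_divide_distrib)
    also have "\<dots> = (\<Sum>j\<le>k. \<Sum>q<h. real (k choose j) * (avg1 h ^^ k) \<phi> (t + int q + int h * int j)) / 2 ^ k / real h"
      by (subst sum.swap) simp
    also have "\<dots> = (\<Sum>j\<le>k. real (k choose j) * (avg1 h ^^ Suc k) \<phi> (t + int h * int j)) / 2 ^ k"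
      by (simp add: avg1_def sum_distrib_left sum_divide_distrib add_ac mult_ac)
    finally show ?thesis .
  qed
  have "(avg1 (2 * h) ^^ Suc k) \<phi> t = avg1 (2 * h) (?b k) t" by (simp add: Suc[abs_def])
  also have "\<dots> = (avg1 h (?b k) t + avg1 h (?b k) (t + int h)) / 2" by (rule avg1_double)
  also have "\<dots> = ?b (Suc k) t"
    unfolding lin pascal_sum by (simp add: algebra_simps add_divide_distrib)
  finally show ?case .
qed simp

lemma avg1_nonneg: "(\<And>t. 0 \<le> \<phi> t) \<Longrightarrow> 0 \<le> (avg1 n ^^ k) \<phi> t"
  by (induction k arbitrary: t) (auto simp: avg1_def intro!: sum_nonneg divide_nonneg_nonneg)

text \<open>After one average over \<open>h\<close> consecutive points the residue modulo
  \<open>h\<close> is uniform, so one residue class carries mass at most \<open>1 / h\<close>;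
  further averaging preserves this.\<close>

lemma avg1_periodic_le:
  assumes h: "1 \<le> h"
  shows "(\<Sum>j\<le>M. (avg1 h ^^ Suc k) (\<lambda>t. of_bool (t = 0)) (t + int h * int j)) \<le> 1 / real h"
proof (induction k arbitrary: t)
  case 0
  let ?D = "{..M} \<times> {..<h}"
  have "(\<Sum>j\<le>M. (avg1 h ^^ Suc 0) (\<lambda>t. of_bool (t = 0)) (t + int h * int j))
     = (\<Sum>j\<le>M. (\<Sum>q<h. of_bool (t + int h * int j + int q = 0)) / real h)"
    by (simp only: funpow.simps o_apply id_apply avg1_def)
  also have "\<dots> = (\<Sum>x\<in>?D. of_bool (t + int h * int (fst x) + int (snd x) = 0)) / real h"
    by (simp only: sum_divide_distrib[symmetric] sum.cartesian_product' fst_conv snd_conv)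
  also have "(\<Sum>x\<in>?D. of_bool (t + int h * int (fst x) + int (snd x) = 0) :: real) = real (card {x \<in> ?D. t + int h * int (fst x) + int (snd x) = 0})"
    by (subst sum_of_bool_eq) (auto intro!: arg_cong[of _ _ card])
  also have "\<dots> \<le> 1"
  proof -
    have "card {x \<in> ?D. t + int h * int (fst x) + int (snd x) = 0} \<le> Suc 0"
    proof (subst card_le_Suc0_iff_eq, simp, clarsimp)
      fix j q j' q' assume a: "q < h" "q' < h" "t + int h * int j + int q = 0" "t + int h * int j' + int q' = 0"
      then have "int (h * j + q) = int (h * j' + q')" by simp
      then have e: "h * j + q = h * j' + q'" by (simp only: of_nat_eq_iff)
      have "q = (h * j + q) mod h" using a by simp
      also have "\<dots> = q'" unfolding e using a by simp
      finally show "j = j' \<and> q = q'" using e h by simp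
    qed
    then show ?thesis by simp
  qed
  finally show ?case using h by (simp add: divide_right_mono)
next
  case (Suc k)
  let ?g = "(avg1 h ^^ Suc k) (\<lambda>t. of_bool (t = 0))"
  have "(\<Sum>j\<le>M. (avg1 h ^^ Suc (Suc k)) (\<lambda>t. of_bool (t = 0)) (t + int h * int j))
     = (\<Sum>j\<le>M. avg1 h ?g (t + int h * int j))" by simp
  also have "\<dots> = (\<Sum>q<h. \<Sum>j\<le>M. ?g (t + int q + int h * int j)) / real h"
    unfolding avg1_def[of h ?g] sum_divide_distrib[symmetric] by (subst sum.swap) (simp add: add_ac del: funpow.simps)
  also have "\<dots> \<le> (\<Sum>q<h. 1 / real h) / real h"
    by (intro divide_right_mono sum_mono Suc) simp
  also have "\<dots> = 1 / real h" using h by simp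
  finally show ?case .
qed

lemma avg1_pow_le:
  assumes h: "1 \<le> h" and k: "1 \<le> k"
  shows "(avg1 (2 * h) ^^ k) (\<lambda>t. of_bool (t = 0)) t \<le> 1 / real h / sqrt (real k + 1)"
proof -
  obtain k' where k': "k = Suc k'" using k by (cases k) auto
  let ?g = "(avg1 h ^^ k) (\<lambda>t. of_bool (t = 0))"
  have g0: "0 \<le> ?g s" for s by (rule avg1_nonneg) simp
  have b: "real (k choose j) / 2 ^ k \<le> 1 / sqrt (real k + 1)" for j
  proof -
    have "sqrt ((real (k choose j))\<^sup>2 * (real k + 1)) \<le> sqrt (4 ^ k)" by (intro real_sqrt_le_mono binomial_sq_le)
    moreover have "sqrt (4 ^ k) = 2 ^ k" by (simp add: real_sqrt_power)
    ultimately have "real (k choose j) * sqrt (real k + 1) \<le> 2 ^ k" by (simp add: real_sqrt_mult)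
    then show ?thesis by (simp add: field_simps)
  qed
  have "(avg1 (2 * h) ^^ k) (\<lambda>t. of_bool (t = 0)) t = (\<Sum>j\<le>k. real (k choose j) / 2 ^ k * ?g (t + int h * int j))"
    unfolding avg1_double_pow by (simp add: sum_divide_distrib)
  also have "\<dots> \<le> (\<Sum>j\<le>k. 1 / sqrt (real k + 1) * ?g (t + int h * int j))"
    by (intro sum_mono mult_right_mono b g0)
  also have "\<dots> \<le> 1 / sqrt (real k + 1) * (1 / real h)"
    unfolding sum_distrib_left[symmetric] using avg1_periodic_le[OF h, where k = k' and M = k and t = t] by (intro mult_left_mono) (auto simp: k')
  finally show ?thesis by (simp add: mult.commute)
qed

section \<open>Averaging operators and a minorization argument\<close>

definition avg_op :: "('a::ab_group_add) set \<Rightarrow> ('a \<Rightarrow> real) \<Rightarrow> ('a \<Rightarrow> real) \<Rightarrow> 'a \<Rightarrow> real" where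
  "avg_op S w h z = (\<Sum>s\<in>S. w s * h (z + s))"

lemma avg_op_commute: "avg_op S w (avg_op S' w' h) = avg_op S' w' (avg_op S w h)"
proof
  fix z
  have "avg_op S w (avg_op S' w' h) z = (\<Sum>s\<in>S. \<Sum>t\<in>S'. w s * w' t * h (z + s + t))"
    by (simp add: avg_op_def sum_distrib_left mult.assoc)
  also have "\<dots> = (\<Sum>t\<in>S'. \<Sum>s\<in>S. w s * w' t * h (z + s + t))" by (rule sum.swap)
  also have "\<dots> = avg_op S' w' (avg_op S w h) z" by (simp add: avg_op_def sum_distrib_left mult_ac add_ac)
  finally show "avg_op S w (avg_op S' w' h) z = avg_op S' w' (avg_op S w h) z" .
qed

lemma avg_op_pow_commute: "(avg_op S w ^^ n) (avg_op S' w' h) = avg_op S' w' ((avg_op S w ^^ n) h)"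
  by (induction n) (simp_all add: avg_op_commute)

lemma avg_op_le:
  assumes "\<And>s. s \<in> S \<Longrightarrow> 0 \<le> w s" "\<And>z. h z \<le> c"
  shows "avg_op S w h z \<le> sum w S * c"
  unfolding avg_op_def sum_distrib_right using assms by (intro sum_mono mult_left_mono) auto

text \<open>Moving from \<open>x\<close> to \<open>x + 1\<close> with probability
  \<open>\<kappa>\<close> lowers the mean inverse square at least as much as moving by
  \<open>\<kappa> / 2\<close> for certain. Halving the drift makes up for convexity when
  \<open>2 \<le> x\<close>.\<close>

lemma inverse_square_step:
  fixes x \<kappa> :: real assumes "2 \<le> x" "0 \<le> \<kappa>" "\<kappa> \<le> 1"
  shows "\<kappa> * (1 / (x + 1)\<^sup>2) + (1 - \<kappa>) * (1 / x\<^sup>2) \<le> 1 / (x + \<kappa> / 2)\<^sup>2"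
proof -
  have x: "0 < x" using assms by simp
  have "1 / (x + 1)\<^sup>2 \<le> 1 / x\<^sup>2 - 1 / x ^ 3"
  proof -
    have "2 * x \<le> x * x" using assms by (intro mult_right_mono) auto
    moreover have "1 \<le> x" using assms by simp
    ultimately have "x * x + 2 * x + 1 \<le> 2 * (x * x) + x" using assms by linarith
    then have "x ^ 3 \<le> (x - 1) * (x + 1)\<^sup>2" by (simp add: power2_eq_square power3_eq_cube algebra_simps)
    then have "1 / (x + 1)\<^sup>2 \<le> (x - 1) / x ^ 3" using x by (simp add: field_simps)
    also have "\<dots> = 1 / x\<^sup>2 - 1 / x ^ 3" using x by (simp add: field_simps power2_eq_square power3_eq_cube)
    finally show ?thesis .
  qed
  then have "\<kappa> * (1 / (x + 1)\<^sup>2) \<le> \<kappa> * (1 / x\<^sup>2 - 1 / x ^ 3)" using assms by (intro mult_left_mono) auto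
  moreover have "1 / x\<^sup>2 - \<kappa> / x ^ 3 \<le> 1 / (x + \<kappa> / 2)\<^sup>2"
  proof -
    have "(x - \<kappa>) * (x + \<kappa> / 2)\<^sup>2 \<le> x ^ 3"
    proof -
      have "x ^ 3 - (x - \<kappa>) * (x + \<kappa> / 2)\<^sup>2 = \<kappa>\<^sup>2 * (3 * x / 4) + \<kappa> ^ 3 / 4"
        by (simp add: power2_eq_square power3_eq_cube field_simps)
      moreover have "0 \<le> \<kappa>\<^sup>2 * (3 * x / 4) + \<kappa> ^ 3 / 4" using assms by simp
      ultimately show ?thesis by linarith
    qed
    moreover have "0 < (x + \<kappa> / 2)\<^sup>2" using assms by simp
    moreover have "1 / x\<^sup>2 - \<kappa> / x ^ 3 = (x - \<kappa>) / x ^ 3" using x by (simp add: field_simps power2_eq_square power3_eq_cube)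
    moreover have "a / b \<le> 1 / y" if "a * y \<le> b" "0 < y" "0 < b" for a b y :: real
      using that by (simp add: field_simps)
    ultimately show ?thesis using x by simp
  qed
  moreover have "\<kappa> * (1 / x\<^sup>2 - 1 / x ^ 3) + (1 - \<kappa>) * (1 / x\<^sup>2) = 1 / x\<^sup>2 - \<kappa> / x ^ 3"
    by (simp add: algebra_simps diff_divide_distrib)
  ultimately show ?thesis by linarith
qed

definition cube :: "nat \<Rightarrow> (int ^ 'd::finite) set" where
  "cube n = {q. \<forall>i. 0 \<le> q $ i \<and> q $ i < int n}"

lemma cube_sum_prod:
  fixes F :: "'d::finite \<Rightarrow> int \<Rightarrow> real"
  shows "(\<Sum>q\<in>cube n. \<Prod>i\<in>UNIV. F i (q $ i)) = (\<Prod>i\<in>UNIV. \<Sum>j<n. F i (int j))"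
    and "finite (cube n :: (int ^ 'd) set)" and "card (cube n :: (int ^ 'd) set) = n ^ CARD('d)"
proof -
  let ?P = "PiE (UNIV :: 'd set) (\<lambda>_. {0..<int n})"
  have bij: "bij_betw vec_lambda ?P (cube n :: (int ^ 'd) set)"
    by (rule bij_betwI[where g = vec_nth]) (auto simp: cube_def PiE_def Pi_def vec_lambda_inverse)
  have fin: "finite ?P" by (intro finite_PiE) auto
  show "finite (cube n :: (int ^ 'd) set)" using bij_betw_finite[OF bij] fin by simp
  show "card (cube n :: (int ^ 'd) set) = n ^ CARD('d)"
    using bij_betw_same_card[OF bij] by (simp add: card_PiE)
  have "(\<Sum>q\<in>cube n. \<Prod>i\<in>UNIV. F i (q $ i)) = (\<Sum>g\<in>?P. \<Prod>i\<in>UNIV. F i (g i))"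
    using sum.reindex_bij_betw[OF bij, of "\<lambda>q. \<Prod>i\<in>UNIV. F i (q $ i)"] by simp
  also have "\<dots> = (\<Prod>i\<in>UNIV. \<Sum>t\<in>{0..<int n}. F i t)"
    by (rule prod_sum_PiE[symmetric]) auto
  moreover have "(\<Sum>t\<in>{0..<int n}. F i t) = (\<Sum>j<n. F i (int j))" for i
    by (rule sum.reindex_bij_witness[of _ int nat]) auto
  ultimately show "(\<Sum>q\<in>cube n. \<Prod>i\<in>UNIV. F i (q $ i)) = (\<Prod>i\<in>UNIV. \<Sum>j<n. F i (int j))" by simp
qed

context kernel
begin

text \<open>A minorization: \<open>f\<close> is \<open>\<kappa>\<close> times the uniform law on a
  cube plus a nonnegative remainder. After \<open>k\<close> uniform steps each coordinate has atoms
  of order \<open>1 / (h * sqrt k)\<close>, and four coordinates give the decay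
  \<open>1 / k^2\<close>. Among \<open>n\<close> steps about \<open>\<kappa> * n\<close> are
  uniform; an induction on inverse squares replaces an estimate of the distribution of their
  number.\<close>

lemma local_bound:
  assumes d: "4 \<le> CARD('d)" and h: "1 \<le> h"
    and \<kappa>: "0 < \<kappa>" "\<kappa> \<le> 1"
    and low: "\<And>q. q \<in> cube (2 * h) \<Longrightarrow> \<kappa> / real (2 * h) ^ CARD('d) \<le> f (w + q)"
    and sub: "(\<lambda>q. w + q) ` cube (2 * h) \<subseteq> R"
    and e: "\<And>s. f s \<le> \<epsilon>'" "1 / real h ^ CARD('d) \<le> \<epsilon>'" and n: "1 \<le> n"
  shows "ret n z \<le> 16 * \<epsilon>' / \<kappa>\<^sup>2 / (real n)\<^sup>2"
proof -
  let ?Q = "(\<lambda>q. w + q) ` cube (2 * h)" and ?N = "real (2 * h) ^ CARD('d)"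
  define A where "A = avg_op R f"
  define U where "U = avg_op ?Q (\<lambda>_. 1 / ?N)"
  define g where "g s = f s - (if s \<in> ?Q then \<kappa> / ?N else 0)" for s
  define G where "G = avg_op R g"
  have N: "0 < ?N" using h by simp
  have cQ: "card ?Q = (2 * h) ^ CARD('d)" "finite ?Q"
    by (simp_all add: card_image cube_sum_prod)
  have sumQ: "(\<Sum>s\<in>?Q. \<kappa> / ?N) = \<kappa>" using cQ h by simp
  have g0: "0 \<le> g s" for s using low f_nonneg by (auto simp: g_def)
  have gsum: "sum g R = 1 - \<kappa>"
  proof -
    have "sum g R = sum f R - (\<Sum>s\<in>R. if s \<in> ?Q then \<kappa> / ?N else 0)" by (simp add: g_def sum_subtractf)
    also have "(\<Sum>s\<in>R. if s \<in> ?Q then \<kappa> / ?N else 0) = (\<Sum>s\<in>R \<inter> ?Q. \<kappa> / ?N)"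
      by (rule sum.inter_restrict[OF finite_R, symmetric])
    also have "R \<inter> ?Q = ?Q" using sub by blast
    finally show ?thesis using f_sum sumQ by simp
  qed
  have split: "A k z = \<kappa> * U k z + G k z" for k z
  proof -
    have "\<kappa> * U k z = (\<Sum>s\<in>?Q. \<kappa> / ?N * k (z + s))" by (simp add: U_def avg_op_def sum_distrib_left)
    also have "\<dots> = (\<Sum>s\<in>R \<inter> ?Q. \<kappa> / ?N * k (z + s))" using sub by (simp add: Int_absorb1)
    also have "\<dots> = (\<Sum>s\<in>R. if s \<in> ?Q then \<kappa> / ?N * k (z + s) else 0)" by (rule sum.inter_restrict[OF finite_R])
    also have "\<dots> + G k z = A k z"
      unfolding G_def A_def avg_op_def g_def sum.distrib[symmetric] by (intro sum.cong refl) (auto simp: algebra_simps)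
    finally show ?thesis by simp
  qed
  have U1: "(U ^^ k) ker0 z = (\<Prod>i\<in>UNIV. (avg1 (2 * h) ^^ k) (\<lambda>t. of_bool (t = 0)) (z $ i + int k * w $ i))" for k z
  proof (induction k arbitrary: z)
    case 0
    have "of_bool (z = 0) = (\<Prod>i\<in>UNIV. of_bool (z $ i = 0) :: real)"
    proof (cases "z = 0")
      case False
      then obtain i where "z $ i \<noteq> 0" by (auto simp: vec_eq_iff)
      then show ?thesis using False by (auto intro!: prod_zero[symmetric])
    qed simp
    then show ?case by (simp add: ker0_def)
  next
    case (Suc k)
    let ?a = "(avg1 (2 * h) ^^ k) (\<lambda>t. of_bool (t = 0))"
    have "(U ^^ Suc k) ker0 z = (\<Sum>q\<in>cube (2 * h). (U ^^ k) ker0 (z + (w + q))) / ?N"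
      by (simp add: U_def avg_op_def sum.reindex sum_divide_distrib)
    also have "(\<Sum>q\<in>cube (2 * h). (U ^^ k) ker0 (z + (w + q))) = (\<Sum>q\<in>cube (2 * h). \<Prod>i\<in>UNIV. ?a (z $ i + int (Suc k) * w $ i + q $ i))"
      by (simp add: Suc algebra_simps)
    also have "\<dots> = (\<Prod>i\<in>UNIV. \<Sum>j<2 * h. ?a (z $ i + int (Suc k) * w $ i + int j))"
      by (rule cube_sum_prod)
    also have "\<dots> / ?N = (\<Prod>i\<in>UNIV. (\<Sum>j<2 * h. ?a (z $ i + int (Suc k) * w $ i + int j)) / real (2 * h))"
      by (simp add: prod_dividef)
    also have "\<dots> = (\<Prod>i\<in>UNIV. (avg1 (2 * h) ^^ Suc k) (\<lambda>t. of_bool (t = 0)) (z $ i + int (Suc k) * w $ i))"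
      by (simp add: avg1_def)
    finally show ?case .
  qed
  have Uk: "(U ^^ k) ker0 z \<le> \<epsilon>' / (real k + 1)\<^sup>2" if k: "1 \<le> k" for k z
  proof -
    have s1: "1 \<le> sqrt (real k + 1)" by simp
    have "(U ^^ k) ker0 z \<le> (\<Prod>i\<in>(UNIV :: 'd set). 1 / real h / sqrt (real k + 1))"
      unfolding U1 by (intro prod_mono conjI avg1_nonneg avg1_pow_le h k) simp
    also have "\<dots> = (1 / real h ^ CARD('d)) * (1 / sqrt (real k + 1) ^ CARD('d))"
      by (simp add: power_divide power_mult_distrib)
    also have "\<dots> \<le> \<epsilon>' * (1 / sqrt (real k + 1) ^ 4)"
    proof (intro mult_mono e divide_left_mono power_increasing d s1)
      show "0 \<le> \<epsilon>'" using e(1) f_nonneg order_trans by blast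
    qed (use s1 in auto)
    also have "sqrt (real k + 1) ^ 4 = (real k + 1)\<^sup>2"
    proof -
      have "sqrt (real k + 1) ^ 4 = ((sqrt (real k + 1))\<^sup>2)\<^sup>2" by (simp only: power_mult[symmetric]) simp
      moreover have "(sqrt (real k + 1))\<^sup>2 = real k + 1" by (rule real_sqrt_pow2) simp
      ultimately show ?thesis by simp
    qed
    finally show ?thesis by simp
  qed
  have e0: "0 \<le> \<epsilon>'" using e(1) f_nonneg order_trans by blast
  have AU: "(U ^^ k) (A k') = A ((U ^^ k) k')" for k k' unfolding A_def U_def by (rule avg_op_pow_commute)
  \<comment> \<open>One step with \<open>f\<close> is set aside so that the bound also holds at
    \<open>k = 0\<close>, where it is the supremum of \<open>f\<close>. The shift to
    \<open>k + 2\<close> meets the assumption of \<open>inverse_square_step\<close>.\<close>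
  have base: "(U ^^ k) (A ker0) z \<le> 4 * \<epsilon>' * (1 / (real k + 2)\<^sup>2)" for k z
  proof -
    have "(U ^^ k) (A ker0) z \<le> \<epsilon>' / (real k + 1)\<^sup>2"
    proof (cases "k = 0")
      case True
      have "A ker0 z = (\<Sum>s\<in>R. if s = - z then f s else 0)"
        unfolding A_def avg_op_def ker0_def by (intro sum.cong refl) (auto simp: add_eq_0_iff)
      also have "\<dots> \<le> \<epsilon>'" using finite_R e(1) e0 by (simp add: sum.delta)
      finally show ?thesis using True by simp
    next
      case False
      have "A ((U ^^ k) ker0) z \<le> sum f R * (\<epsilon>' / (real k + 1)\<^sup>2)"
        unfolding A_def using f_nonneg Uk False by (intro avg_op_le) auto
      then show ?thesis by (simp add: AU f_sum)
    qed
    also have "\<dots> \<le> 4 * \<epsilon>' * (1 / (real k + 2)\<^sup>2)"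
    proof -
      have "(real k + 2)\<^sup>2 \<le> (2 * (real k + 1))\<^sup>2" by (intro power_mono) auto
      then have "(real k + 2)\<^sup>2 \<le> 4 * (real k + 1)\<^sup>2" unfolding power_mult_distrib by simp
      moreover have "0 < (real k + 1)\<^sup>2" "0 < (real k + 2)\<^sup>2" by simp_all
      moreover have "1 / a \<le> 4 * (1 / b)" if "b \<le> 4 * a" "0 < a" "0 < b" for a b :: real using that by (simp add: field_simps)
      ultimately have "1 / (real k + 1)\<^sup>2 \<le> 4 * (1 / (real k + 2)\<^sup>2)" by blast
      from mult_left_mono[OF this e0] show ?thesis by (simp add: mult.commute)
    qed
    finally show ?thesis .
  qed
  have main: "(A ^^ n) ((U ^^ k) (A ker0)) z \<le> 4 * \<epsilon>' * (1 / (real k + \<kappa> * real n / 2 + 2)\<^sup>2)" for n k z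
  proof (induction n arbitrary: k z)
    case 0 then show ?case using base by simp
  next
    case (Suc n)
    let ?H = "\<lambda>k. (A ^^ n) ((U ^^ k) (A ker0))" and ?x = "real k + \<kappa> * real n / 2 + 2"
    have "(A ^^ Suc n) ((U ^^ k) (A ker0)) z = A (?H k) z" by simp
    also have "\<dots> = \<kappa> * U (?H k) z + G (?H k) z" by (rule split)
    also have "U (?H k) = ?H (Suc k)"
      unfolding A_def U_def by (simp add: avg_op_pow_commute)
    also have "\<kappa> * ?H (Suc k) z + G (?H k) z \<le> \<kappa> * (4 * \<epsilon>' * (1 / (?x + 1)\<^sup>2)) + (1 - \<kappa>) * (4 * \<epsilon>' * (1 / ?x\<^sup>2))"
    proof (intro add_mono mult_left_mono)
      show "?H (Suc k) z \<le> 4 * \<epsilon>' * (1 / (?x + 1)\<^sup>2)" using Suc[of "Suc k" z] by (simp add: add_ac)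
      show "G (?H k) z \<le> (1 - \<kappa>) * (4 * \<epsilon>' * (1 / ?x\<^sup>2))"
        unfolding G_def gsum[symmetric] by (intro avg_op_le g0 Suc)
    qed (use \<kappa> in simp)
    also have "\<dots> = 4 * \<epsilon>' * (\<kappa> * (1 / (?x + 1)\<^sup>2) + (1 - \<kappa>) * (1 / ?x\<^sup>2))" by (simp add: algebra_simps)
    also have "\<dots> \<le> 4 * \<epsilon>' * (1 / (?x + \<kappa> / 2)\<^sup>2)"
      using \<kappa> e0 by (intro mult_left_mono inverse_square_step) auto
    also have "?x + \<kappa> / 2 = real k + \<kappa> * real (Suc n) / 2 + 2" by (simp add: algebra_simps add_divide_distrib)
    finally show ?case .
  qed
  obtain n' where n': "n = Suc n'" using n by (cases n) auto
  have An: "(A ^^ n) ker0 z \<le> 16 * \<epsilon>' / \<kappa>\<^sup>2 / (real n)\<^sup>2" for z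
  proof -
    have "(A ^^ n) ker0 z = (A ^^ n') (A ker0) z" unfolding n' funpow_Suc_right by simp
    also have "\<dots> \<le> 4 * \<epsilon>' * (1 / (\<kappa> * real n' / 2 + 2)\<^sup>2)" using main[of n' 0 z] by simp
    also have "\<dots> \<le> 4 * \<epsilon>' * (1 / (\<kappa> * real n / 2)\<^sup>2)"
    proof -
      have pos: "0 < \<kappa> * real n' / 2 + 2" using \<kappa> by (intro add_nonneg_pos) auto
      show ?thesis
    proof (intro mult_left_mono divide_left_mono power_mono)
      show "\<kappa> * real n / 2 \<le> \<kappa> * real n' / 2 + 2" using \<kappa> by (simp add: n' algebra_simps)
    qed (use \<kappa> n e0 pos in \<open>auto intro!: mult_pos_pos\<close>)
    qed
    also have "\<dots> = 16 * \<epsilon>' / \<kappa>\<^sup>2 / (real n)\<^sup>2" by (simp add: power_divide power_mult_distrib)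
    finally show ?thesis .
  qed
  \<comment> \<open>\<open>Pop\<close> is a forward average followed by a backward one. The two
    commute, and backward averages cannot increase a supremum, so the \<open>n\<close>-step bound
    for one walk carries over to the difference of two.\<close>
  define B where "B = avg_op (uminus ` R) (\<lambda>s. f (- s))"
  have PBA: "Pop k = B (A k)" for k
  proof
    fix z
    have "B (A k) z = (\<Sum>b\<in>R. \<Sum>a\<in>R. f b * (f a * k (z - b + a)))"
      by (simp add: B_def A_def avg_op_def sum.reindex sum_distrib_left)
    also have "\<dots> = (\<Sum>a\<in>R. \<Sum>b\<in>R. f b * (f a * k (z - b + a)))" by (rule sum.swap)
    finally show "Pop k z = B (A k) z" by (simp add: Pop_def algebra_simps)
  qed
  have retBA: "ret k = (B ^^ k) ((A ^^ k) ker0)" for k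
  proof (induction k)
    case 0 then show ?case by (simp add: ret_def)
  next
    case (Suc k)
    have "ret (Suc k) = B (A ((B ^^ k) ((A ^^ k) ker0)))" by (simp add: ret_Suc PBA Suc)
    also have "A ((B ^^ k) ((A ^^ k) ker0)) = (B ^^ k) (A ((A ^^ k) ker0))"
      unfolding A_def B_def by (rule avg_op_pow_commute[symmetric])
    finally show ?case by simp
  qed
  have "(B ^^ k) F z \<le> c" if "\<And>z. F z \<le> c" for k F c z
  proof (induction k arbitrary: z)
    case (Suc k)
    have "B ((B ^^ k) F) z \<le> sum (\<lambda>s. f (- s)) (uminus ` R) * c"
      unfolding B_def by (rule avg_op_le) (use f_nonneg Suc in \<open>auto simp: B_def\<close>)
    also have "sum (\<lambda>s. f (- s)) (uminus ` R) = 1" using f_sum by (simp add: sum.reindex)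
    finally show ?case by simp
  qed (use that in simp)
  then show ?thesis unfolding retBA using An by blast
qed

end

section \<open>Spread-out kernels\<close>

definition ibox :: "nat \<Rightarrow> (int ^ 'd::finite) set" where
  "ibox K = {y. \<forall>i. \<bar>y $ i\<bar> \<le> int K}"

lemma ibox: "finite (ibox K :: (int ^ 'd::finite) set)" "card (ibox K :: (int ^ 'd) set) = (2 * K + 1) ^ CARD('d)"
proof -
  let ?w = "(\<chi> i. - int K) :: int ^ 'd"
  have eq: "(ibox K :: (int ^ 'd) set) = (\<lambda>q. ?w + q) ` cube (2 * K + 1)"
  proof (intro equalityI subsetI)
    fix y :: "int ^ 'd" assume "y \<in> ibox K"
    then have "y - ?w \<in> cube (2 * K + 1)" unfolding ibox_def cube_def by (auto simp: abs_le_iff) (smt (verit, ccfv_SIG))+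
    then show "y \<in> (\<lambda>q. ?w + q) ` cube (2 * K + 1)" by (intro image_eqI[of _ _ "y - ?w"]) auto
  next
    fix y :: "int ^ 'd" assume "y \<in> (\<lambda>q. ?w + q) ` cube (2 * K + 1)"
    then obtain q where q: "y = ?w + q" "q \<in> cube (2 * K + 1)" by blast
    show "y \<in> ibox K" unfolding ibox_def mem_Collect_eq
    proof
      fix i
      have "0 \<le> q $ i" "q $ i < int (2 * K + 1)" using q(2) by (auto simp: cube_def)
      then show "\<bar>y $ i\<bar> \<le> int K" by (simp add: q(1))
    qed
  qed
  show "finite (ibox K :: (int ^ 'd) set)" unfolding eq by (intro finite_imageI cube_sum_prod)
  show "card (ibox K :: (int ^ 'd) set) = (2 * K + 1) ^ CARD('d)"
    unfolding eq by (subst card_image) (simp_all add: cube_sum_prod)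
qed

text \<open>Cauchy-Schwarz: two independent copies of a law on finitely many points agree with
  probability at least the reciprocal of their number, and two steps stay within
  \<open>ibox (2 * K)\<close>.\<close>

lemma (in kernel) ret_2_lower:
  assumes "R \<subseteq> ibox K"
  shows "1 / real (card (ibox (2 * K) :: (int ^ 'd) set)) \<le> ret 2 0"
proof -
  \<comment> \<open>Any admissible density makes \<open>reach\<close>, \<open>fpow\<close> and
    \<open>fpow_pair\<close> available; zero is admissible for every kernel.\<close>
  interpret percolation_kernel f R 0 by unfold_locales auto
  let ?I = "ibox (2 * K) :: (int ^ 'd) set"
  have sub: "reach 2 0 \<subseteq> ?I"
  proof
    fix y :: "int ^ 'd" assume "y \<in> reach 2 0"
    then obtain s t where st: "s \<in> R" "t \<in> R" "y = s + t" by (auto simp: numeral_2_eq_2)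
    have "\<bar>s $ i\<bar> \<le> int K" "\<bar>t $ i\<bar> \<le> int K" for i using st assms by (auto simp: ibox_def)
    then show "y \<in> ?I" by (auto simp: ibox_def st(3)) (smt (verit, ccfv_SIG))
  qed
  have "ret 2 0 = (\<Sum>y\<in>?I. \<Sum>y'\<in>?I. fpow 2 (y - 0) * fpow 2 (y' - 0) * ker0 (y - y'))"
    using fpow_pair[of ?I ?I 2 0 0 ker0] sub by (simp add: ibox ret_def)
  also have "\<dots> = (\<Sum>y\<in>?I. \<Sum>y'\<in>?I. if y' = y then (fpow 2 y)\<^sup>2 else 0)"
    by (intro sum.cong refl) (auto simp: ker0_def power2_eq_square)
  also have "\<dots> = (\<Sum>y\<in>?I. (fpow 2 y)\<^sup>2)" by (simp add: ibox)
  finally have r: "ret 2 0 = (\<Sum>y\<in>?I. (fpow 2 y)\<^sup>2)" .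
  have "1 = (\<Sum>y\<in>?I. 1 * fpow 2 y)\<^sup>2" using fpow_sum[of ?I 2 0] sub by (simp add: ibox)
  also have "\<dots> \<le> (\<Sum>y\<in>?I. 1\<^sup>2) * (\<Sum>y\<in>?I. (fpow 2 y)\<^sup>2)" by (rule Cauchy_Schwarz_ineq_sum)
  finally have "1 \<le> real (card ?I) * ret 2 0" by (simp add: r)
  moreover have "0 < real (card ?I)" by (simp add: ibox)
  ultimately show ?thesis by (simp add: pos_divide_le_eq mult.commute)
qed

lemma dist_vec_le:
  fixes x y :: "real ^ 'd::finite"
  assumes "\<And>i. \<bar>x $ i - y $ i\<bar> \<le> c"
  shows "dist x y \<le> real CARD('d) * c"
proof -
  have "dist x y \<le> (\<Sum>i\<in>UNIV. \<bar>(x - y) $ i\<bar>)" unfolding dist_norm by (rule norm_le_l1_cart)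
  also have "\<dots> \<le> (\<Sum>i\<in>(UNIV :: 'd set). c)" using assms by (intro sum_mono) simp
  finally show ?thesis by simp
qed

text \<open>Everything scales like \<open>L^(-d)\<close>: \<open>F\<close> is bounded with bounded
  support, and it is bounded below on a ball, which after scaling contains a lattice cube with side
  of order \<open>L\<close>. It matters that \<open>C\<close> and \<open>c0\<close> do not depend on
  \<open>L\<close>.\<close>

lemma spread_out_kernel:
  fixes F :: "real ^ 'd::finite \<Rightarrow> real"
  assumes d: "4 \<le> CARD('d)" and F0: "\<And>x. F x \<ge> 0" and cont: "continuous_on UNIV F"
    and comp: "compact (closure {x. F x \<noteq> 0})" and int: "integral\<^sup>L lborel F = 1"
  shows "\<exists>C>0. \<exists>c0>0. \<forall>\<^sub>F L in sequentially. \<exists>R. kernel (spread_out F L) R \<and>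
    (\<forall>s. spread_out F L s \<le> C / real L ^ CARD('d)) \<and>
    (\<forall>n\<ge>1. \<forall>z. kernel.ret (spread_out F L) R n z \<le> C / real L ^ CARD('d) / (real n)\<^sup>2) \<and>
    2 * c0 * (C / real L ^ CARD('d)) \<le> kernel.ret (spread_out F L) R 2 0"
proof -
  let ?d = "CARD('d)"
  have "\<exists>x. F x \<noteq> 0"
  proof (rule ccontr)
    assume "\<not> (\<exists>x. F x \<noteq> 0)"
    then have "F = (\<lambda>_. 0)" by auto
    then show False using int by simp
  qed
  then obtain x0 where x0: "0 < F x0" using F0 by (metis less_eq_real_def)
  define \<eta> where "\<eta> = F x0 / 2"
  have \<eta>: "0 < \<eta>" using x0 by (simp add: \<eta>_def)
  have "continuous (at x0) F" using cont by (simp add: continuous_on_eq_continuous_at)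
  then obtain r where r: "0 < r" "\<And>x. dist x x0 < r \<Longrightarrow> dist (F x) (F x0) < \<eta>"
    unfolding continuous_at_eps_delta using \<eta> by (metis dist_commute)
  have Fball: "\<eta> \<le> F x" if "dist x x0 < r" for x
    using r(2)[OF that] unfolding dist_real_def \<eta>_def by linarith
  have "compact (F ` closure {x. F x \<noteq> 0})" using cont comp by (intro compact_continuous_image) (rule continuous_on_subset, auto)
  then obtain B where B: "\<And>y. y \<in> F ` closure {x. F x \<noteq> 0} \<Longrightarrow> norm y \<le> B" using compact_imp_bounded bounded_iff by metis
  have FB: "F x \<le> B" if "F x \<noteq> 0" for x
    using B[of "F x"] that closure_subset[of "{x. F x \<noteq> 0}"] by auto
  have Bpos: "0 < B" using FB[of x0] x0 by simp
  have FB': "F x \<le> B" for x using FB[of x] Bpos by (cases "F x = 0") auto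
  obtain M0 where M0: "\<And>x. x \<in> closure {x. F x \<noteq> 0} \<Longrightarrow> norm x \<le> M0" using comp compact_imp_bounded bounded_iff by metis
  define M where "M = nat \<lceil>M0\<rceil>"
  have M: "\<bar>x $ i\<bar> \<le> real M" if "F x \<noteq> 0" for x i
  proof -
    have "\<bar>x $ i\<bar> \<le> norm x" by (rule component_le_norm_cart)
    also have "\<dots> \<le> M0" using that closure_subset[of "{x. F x \<noteq> 0}"] by (intro M0) auto
    also have "\<dots> \<le> real M" unfolding M_def by linarith
    finally show ?thesis .
  qed
  \<comment> \<open>A lattice cube of side \<open>2 * h\<close> shrinks to sides of at most
    \<open>2 * \<rho>\<close>; summed over the coordinates this is a displacement of at most
    \<open>r / 2\<close>. The other half of \<open>r\<close> is left for rounding.\<close>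
  define \<rho> where "\<rho> = r / (4 * real ?d)"
  have dpos: "0 < real ?d" by simp
  have \<rho>: "0 < \<rho>" using r by (simp add: \<rho>_def)
  define K1 where "K1 = (2 * real M + 1) ^ ?d * B"
  have K1: "0 < K1" using Bpos by (simp add: K1_def)
  \<comment> \<open>Compares the lower bound \<open>\<eta> / (K1 * L^d)\<close> for the kernel on
    the cube with the uniform weight \<open>1 / (2 * h)^d\<close>, using that \<open>2 * h\<close>
    is at least \<open>\<rho> * L\<close>.\<close>
  define \<kappa> where "\<kappa> = min 1 (\<eta> * \<rho> ^ ?d / K1)"
  have \<kappa>: "0 < \<kappa>" "\<kappa> \<le> 1" using \<eta> \<rho> K1 by (auto simp: \<kappa>_def)
  \<comment> \<open>Covers both demands of \<open>local_bound\<close>: the supremum of the kernel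
    and \<open>1 / h^d\<close>.\<close>
  define C1 where "C1 = max (B / (\<eta> * \<rho> ^ ?d)) ((2 / \<rho>) ^ ?d)"
  have C1: "0 < C1" using \<rho> by (simp add: C1_def less_max_iff_disj)
  define C where "C = 16 * C1 / \<kappa>\<^sup>2"
  have C: "0 < C" "C1 \<le> C"
  proof -
    show "0 < C" using C1 \<kappa> by (simp add: C_def)
    have "\<kappa>\<^sup>2 \<le> 1" using \<kappa> by (simp add: power_le_one)
    then have "C1 * \<kappa>\<^sup>2 \<le> 16 * C1" using C1 mult_left_mono[of "\<kappa>\<^sup>2" 1 C1] by simp
    then show "C1 \<le> C" using \<kappa> by (simp add: C_def pos_le_divide_eq)
  qed
  \<comment> \<open>Makes \<open>2 * c0 * (C / L^d)\<close> equal to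
    \<open>1 / ((4 * M + 1) * L)^d\<close>, which lies below the bound supplied by
    \<open>ret_2_lower\<close>.\<close>
  define c0 where "c0 = 1 / (4 * real M + 1) ^ ?d / (2 * C)"
  have c0: "0 < c0" using C by (simp add: c0_def)
  \<comment> \<open>Makes \<open>\<rho> * L\<close> exceed 2, so that rounding down to
    \<open>h\<close> loses at most a factor 2, and keeps the rounding of \<open>x0\<close> within
    the radius.\<close>
  define L0 where "L0 = nat \<lceil>max (2 / \<rho>) (4 * real ?d / r)\<rceil> + 1"
  have "\<exists>R. kernel (spread_out F L) R \<and>
    (\<forall>s. spread_out F L s \<le> C / real L ^ ?d) \<and>
    (\<forall>n\<ge>1. \<forall>z. kernel.ret (spread_out F L) R n z \<le> C / real L ^ ?d / (real n)\<^sup>2) \<and>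
    2 * c0 * (C / real L ^ ?d) \<le> kernel.ret (spread_out F L) R 2 0" if L: "L0 \<le> L" for L
  proof -
    have Lr: "2 / \<rho> < real L" "4 * real ?d / r < real L" "1 \<le> L" using L unfolding L0_def by linarith+
    have L1: "1 \<le> real L" using Lr by simp
    have Ld: "0 < real L ^ ?d" using L1 by simp
    define K where "K = M * L"
    let ?R = "ibox K :: (int ^ 'd) set"
    let ?G = "\<lambda>y. F (real_point y /\<^sub>R real L)"
    have outR: "?G y = 0" if "y \<notin> ?R" for y
    proof (rule ccontr)
      assume "?G y \<noteq> 0"
      then have "\<bar>(real_point y /\<^sub>R real L) $ i\<bar> \<le> real M" for i by (rule M)
      then have "\<bar>real_of_int (y $ i)\<bar> \<le> real M * real L" for i
        using L1 by (simp add: real_point_def abs_mult field_simps)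
      then have "\<bar>y $ i\<bar> \<le> int K" for i
        unfolding K_def by (metis (no_types, opaque_lifting) of_int_abs of_int_le_iff of_int_of_nat_eq of_nat_mult)
      then show False using that by (simp add: ibox_def)
    qed
    define S where "S = (\<Sum>y\<in>?R. ?G y)"
    have inf: "(\<Sum>\<^sub>\<infinity>y. ?G y) = S"
    proof -
      have "(\<Sum>\<^sub>\<infinity>y\<in>UNIV. ?G y) = (\<Sum>\<^sub>\<infinity>y\<in>?R. ?G y)" by (rule infsum_cong_neutral) (auto simp: outR)
      then show ?thesis by (simp add: S_def ibox)
    qed
    have f_eq: "spread_out F L s = ?G s / S" for s by (simp add: spread_out_def inf)
    define h where "h = nat \<lfloor>\<rho> * real L\<rfloor>"
    have "2 < \<rho> * real L" using Lr(1) \<rho> by (simp add: pos_divide_less_eq mult.commute)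
    then have h: "1 \<le> h" "\<rho> * real L \<le> 2 * real h" "real h \<le> \<rho> * real L" unfolding h_def by linarith+
    define w :: "int ^ 'd" where "w = (\<chi> i. \<lfloor>real L * x0 $ i\<rfloor>)"
    have near: "\<eta> \<le> ?G (w + q)" if q: "q \<in> cube (2 * h)" for q
    proof -
      have "\<bar>(real_point (w + q) /\<^sub>R real L) $ i - x0 $ i\<bar> \<le> (2 * real h + 1) / real L" for i
      proof -
        have qi: "0 \<le> q $ i" "q $ i < int (2 * h)" using q by (auto simp: cube_def)
        have "\<bar>real_of_int (w $ i) + real_of_int (q $ i) - real L * x0 $ i\<bar> \<le> 2 * real h + 1"
          using qi unfolding w_def by simp linarith
        moreover have "(real_point (w + q) /\<^sub>R real L) $ i - x0 $ i = (real_of_int (w $ i) + real_of_int (q $ i) - real L * x0 $ i) / real L"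
          using L1 by (simp add: real_point_def field_simps)
        ultimately show ?thesis using L1 by (simp add: divide_right_mono abs_divide)
      qed
      then have "dist (real_point (w + q) /\<^sub>R real L) x0 \<le> real ?d * ((2 * real h + 1) / real L)" by (rule dist_vec_le)
      also have "\<dots> \<le> real ?d * ((2 * (\<rho> * real L) + 1) / real L)"
        using h L1 by (intro mult_left_mono divide_right_mono) auto
      also have "\<dots> = r / 2 + real ?d / real L" using L1 by (simp add: \<rho>_def field_simps)
      also have "real ?d / real L < r / 2"
      proof -
        have "4 * real ?d < real L * r" using Lr(2) r by (simp add: pos_divide_less_eq)
        then have "2 * real ?d < real L * r" using dpos by linarith
        then show ?thesis using L1 by (simp add: field_simps)
      qed
      finally show ?thesis by (intro Fball) simp
    qed
    have sub: "(\<lambda>q. w + q) ` cube (2 * h) \<subseteq> ?R"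
    proof
      fix y assume "y \<in> (\<lambda>q. w + q) ` cube (2 * h)"
      then have "?G y \<noteq> 0" using near \<eta> by fastforce
      then show "y \<in> ?R" using outR by blast
    qed
    have S_lower: "\<eta> * (\<rho> * real L) ^ ?d \<le> S"
    proof -
      have "\<eta> * (\<rho> * real L) ^ ?d \<le> \<eta> * real (2 * h) ^ ?d"
        using h \<rho> L1 \<eta> by (intro mult_left_mono power_mono) auto
      also have "\<dots> = (\<Sum>y\<in>(\<lambda>q. w + q) ` cube (2 * h). \<eta>)"
        by (simp add: card_image cube_sum_prod)
      also have "\<dots> \<le> (\<Sum>y\<in>(\<lambda>q. w + q) ` cube (2 * h). ?G y)" using near by (intro sum_mono) auto
      also have "\<dots> \<le> S" unfolding S_def using sub F0 by (intro sum_mono2 ibox) auto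
      finally show ?thesis .
    qed
    have Spos: "0 < S" using S_lower \<eta> \<rho> L1 by (smt (verit) mult_pos_pos zero_less_power)
    have S_upper: "S \<le> K1 * real L ^ ?d"
    proof -
      have "S \<le> (\<Sum>y\<in>?R. B)" unfolding S_def by (intro sum_mono FB')
      also have "\<dots> = real ((2 * K + 1) ^ ?d) * B" by (simp add: ibox)
      also have "\<dots> \<le> ((2 * real M + 1) * real L) ^ ?d * B"
      proof -
        have "real ((2 * K + 1) ^ ?d) \<le> ((2 * real M + 1) * real L) ^ ?d"
          unfolding K_def of_nat_power using L1 by (intro power_mono) (auto simp: algebra_simps)
        then show ?thesis using Bpos by (intro mult_right_mono) auto
      qed
      finally show ?thesis by (simp add: K1_def power_mult_distrib mult_ac)
    qed
    interpret kernel "spread_out F L" ?R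
    proof
      show "sum (spread_out F L) ?R = 1" using Spos by (simp add: f_eq S_def flip: sum_divide_distrib)
    qed (use F0 Spos outR in \<open>auto simp: f_eq ibox\<close>)
    let ?e = "C1 / real L ^ ?d"
    have f_le: "spread_out F L s \<le> ?e" for s
    proof -
      have "spread_out F L s \<le> B / (\<eta> * (\<rho> * real L) ^ ?d)"
        unfolding f_eq using FB' F0 S_lower \<eta> \<rho> L1 Bpos by (intro frac_le) auto
      also have "\<dots> = B / (\<eta> * \<rho> ^ ?d) / real L ^ ?d" by (simp add: power_mult_distrib)
      also have "\<dots> \<le> ?e" using Ld by (intro divide_right_mono) (auto simp: C1_def)
      finally show ?thesis .
    qed
    have h_le: "1 / real h ^ ?d \<le> ?e"
    proof -
      have "1 / real h ^ ?d \<le> 1 / (\<rho> * real L / 2) ^ ?d"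
        using h \<rho> L1 by (intro divide_left_mono power_mono) auto
      also have "\<dots> = (2 / \<rho>) ^ ?d / real L ^ ?d" by (simp add: power_divide power_mult_distrib)
      also have "\<dots> \<le> ?e" using Ld by (intro divide_right_mono) (auto simp: C1_def)
      finally show ?thesis .
    qed
    have low: "\<kappa> / real (2 * h) ^ ?d \<le> spread_out F L (w + q)" if q: "q \<in> cube (2 * h)" for q
    proof -
      have "\<kappa> / real (2 * h) ^ ?d \<le> (\<eta> * \<rho> ^ ?d / K1) / (\<rho> * real L) ^ ?d"
        using h \<rho> L1 \<eta> K1 \<kappa> by (intro frac_le power_mono) (auto simp: \<kappa>_def)
      also have "\<dots> = \<eta> / (K1 * real L ^ ?d)" using \<rho> by (simp add: power_mult_distrib)
      also have "\<dots> \<le> \<eta> / S" using S_upper Spos \<eta> K1 Ld by (intro divide_left_mono) auto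
      also have "\<dots> \<le> spread_out F L (w + q)" unfolding f_eq using near[OF q] Spos by (intro divide_right_mono) auto
      finally show ?thesis .
    qed
    have "ret n z \<le> C / real L ^ ?d / (real n)\<^sup>2" if "1 \<le> n" for n z
      using local_bound[OF d h(1) \<kappa> low sub f_le h_le that, of z] by (simp add: C_def mult_ac)
    moreover have "spread_out F L s \<le> C / real L ^ ?d" for s
      using f_le[of s] C(2) Ld by (meson divide_right_mono less_imp_le order_trans)
    moreover have "2 * c0 * (C / real L ^ ?d) \<le> ret 2 0"
    proof -
      have "2 * c0 * (C / real L ^ ?d) = 1 / ((4 * real M + 1) * real L) ^ ?d"
        using C by (simp add: c0_def power_mult_distrib)
      also have "\<dots> \<le> 1 / real (card (ibox (2 * K) :: (int ^ 'd) set))"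
      proof -
        have "real ((2 * (2 * K) + 1) ^ ?d) \<le> ((4 * real M + 1) * real L) ^ ?d"
          unfolding K_def of_nat_power using L1 by (intro power_mono) (auto simp: algebra_simps)
        then show ?thesis unfolding ibox using L1 by (intro divide_left_mono) auto
      qed
      also have "\<dots> \<le> ret 2 0" by (rule ret_2_lower) simp
      finally show ?thesis .
    qed
    ultimately show ?thesis using kernel_axioms by blast
  qed
  then have "\<forall>\<^sub>F L in sequentially. \<exists>R. kernel (spread_out F L) R \<and>
    (\<forall>s. spread_out F L s \<le> C / real L ^ ?d) \<and>
    (\<forall>n\<ge>1. \<forall>z. kernel.ret (spread_out F L) R n z \<le> C / real L ^ ?d / (real n)\<^sup>2) \<and>
    2 * c0 * (C / real L ^ ?d) \<le> kernel.ret (spread_out F L) R 2 0"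
    by (rule eventually_sequentiallyI[of L0])
  then show ?thesis using C(1) c0 by blast
qed

section \<open>The gap between the thresholds\<close>

context percolation_kernel
begin

lemma E_W: "E (W N n x) = p ^ N"
proof -
  have "W N n x = (\<lambda>X. \<Sum>y\<in>reach N x. npaths N n x y X)"
    by (rule ext) (simp add: path_sum_sum[OF finite_reach order_refl, where \<phi> = "\<lambda>_. 1"])
  then have "E (W N n x) = E (\<lambda>X. \<Sum>y\<in>reach N x. npaths N n x y X)" by simp
  also have "\<dots> = (\<Sum>y\<in>reach N x. p ^ N * fpow N (y - x))" by (simp add: Ev_sum[OF cyl_npaths] E_npaths)
  also have "\<dots> = p ^ N" by (simp add: fpow_sum[OF finite_reach order_refl] flip: sum_distrib_left)
  finally show ?thesis .
qed

lemma cyl_W_pos: "cyl n (n + N) (\<lambda>X. of_bool (0 < W N n x X) :: real)"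
  by (rule cyl_comp[OF cyl_path_sum])

lemma P_W_pos: "P {X. 0 < W N 0 0 X} = E (\<lambda>X. of_bool (0 < W N 0 0 X))"
proof -
  have "{X. 0 < W N 0 0 X} \<in> sets (bern pe)"
    using measurable_sets[OF measurable_W, of "{0<..}" N 0 0] by (simp add: vimage_def)
  then show ?thesis by (simp add: measure_eq_Ev)
qed

lemma P_W_pos_tendsto: "(\<lambda>N. P {X. 0 < W N 0 0 X}) \<longlonglongrightarrow> P surv"
proof -
  have eq: "surv = (\<Inter>N. {X. 0 < W N 0 0 X})" by (auto simp: surv_def)
  have "{X. 0 < W N 0 0 X} \<in> sets (bern pe)" for N
    using measurable_sets[OF measurable_W, of "{0<..}" N 0 0] by (simp add: vimage_def)
  then show ?thesis unfolding eq
    by (intro bern.finite_Lim_measure_decseq) (auto simp: decseq_def intro: W_pos_antimono)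
qed

lemma P_surv_ge:
  assumes "1 \<le> m" and c: "\<And>N. c \<le> E (\<lambda>X. of_bool (0 < W (N * m) 0 0 X))"
  shows "c \<le> P surv"
proof (rule LIMSEQ_le_const[OF P_W_pos_tendsto])
  have "{X. 0 < W (N * m) 0 0 X} \<subseteq> {X. 0 < W N 0 0 X}" for N
    using assms(1) by (auto intro: W_pos_antimono[of "N * m"])
  moreover have "{X. 0 < W N 0 0 X} \<in> sets (bern pe)" for N
    using measurable_sets[OF measurable_W, of "{0<..}" N 0 0] by (simp add: vimage_def)
  ultimately have "P {X. 0 < W (N * m) 0 0 X} \<le> P {X. 0 < W N 0 0 X}" for N
    by (intro bern.finite_measure_mono)
  then show "\<exists>M. \<forall>N\<ge>M. c \<le> P {X. 0 < W N 0 0 X}" using c unfolding P_W_pos by (meson order_trans)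
qed

text \<open>First moment: the expected number of paths \<open>p ^ N\<close> tends to zero.\<close>

lemma P_surv_subcritical:
  assumes "p < 1" shows "P surv = 0"
proof -
  have "P {X. 0 < W N 0 0 X} \<le> p ^ N" for N
  proof -
    have le: "of_bool (0 < W N 0 0 X) \<le> W N 0 0 X" for X
    proof -
      obtain k where "W N 0 0 X = real k" using path_sum_Nats[of "\<lambda>_. 1" N 0 0 X] Nats_cases by auto
      then show ?thesis by (cases k) auto
    qed
    have "E (\<lambda>X. of_bool (0 < W N 0 0 X)) \<le> E (W N 0 0)" by (rule Ev_mono[OF cyl_W_pos cyl_path_sum le])
    then show ?thesis by (simp add: P_W_pos E_W)
  qed
  moreover have "(\<lambda>N. p ^ N) \<longlonglongrightarrow> 0" using assms p_nonneg by (intro LIMSEQ_power_zero) auto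
  ultimately have "P surv \<le> 0" by (intro LIMSEQ_le[OF P_W_pos_tendsto]) auto
  then show ?thesis by (simp add: measure_le_0_iff)
qed

end

context transient_kernel
begin

lemma p_max_ge: "1 / \<epsilon> \<le> p_max f"
  unfolding p_max_def
proof (rule cINF_greatest)
  show "{z. f z \<noteq> 0} \<noteq> {}" using f_sum by (force intro: sum.neutral)
  show "1 / \<epsilon> \<le> 1 / f z" if "z \<in> {z. f z \<noteq> 0}" for z
    using that f_nonneg[of z] f_le[of z] eps by (intro divide_left_mono) (auto simp: order_less_le)
qed

text \<open>Hypothesis \<open>mc\<close> takes the block length so large that 3/100 of
  \<open>t\<close>, with \<open>t\<close> at least \<open>(m - 1) * c0 * \<epsilon>\<close>, covers
  \<open>(harm m + 3) * \<epsilon>\<close>. Hypotheses \<open>e1\<close> to \<open>e4\<close> ask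
  \<open>\<epsilon>\<close> to be small in terms of \<open>m\<close> and \<open>c0\<close>.\<close>

lemma p_crit_less_p_crit2:
  assumes m: "2 \<le> m" and c0: "0 < c0" and mc: "harm m + 3 \<le> 3 / 100 * (real m - 1) * c0"
    and low: "2 * c0 * \<epsilon> \<le> ret 2 0" and e1: "2 * (16 ^ m)\<^sup>2 * \<epsilon> \<le> 1" and e2: "\<epsilon> \<le> c0"
    and e3: "\<epsilon> * ((1 + 2 * real m + 19 * 16 ^ m * (1 + 3 * real m) + 4 * (1 + 2 * real m) * (2 * real m * 48 ^ m))
        * (harm m + 2) + 19 * 16 ^ m * real m * (1 + harm m)) \<le> real m"
    and e4: "200 * (2 * (16 ^ m)\<^sup>2 + 100 ^ m) * \<epsilon> < c0"
  shows "p_crit f < p_crit2 f"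
proof -
  let ?A = "(16::real) ^ m"
  define t where "t = excess 1 m 0"
  have A1: "1 \<le> ?A" by simp
  have Ae: "?A * \<epsilon> \<le> 1"
  proof -
    have "?A * 1 \<le> ?A * ?A" by (intro mult_left_mono) auto
    then have "?A * \<epsilon> \<le> ?A\<^sup>2 * \<epsilon>" using eps by (intro mult_right_mono) (auto simp: power2_eq_square)
    moreover have "0 \<le> ?A\<^sup>2 * \<epsilon>" using eps by simp
    ultimately show ?thesis using e1 by linarith
  qed
  have t_le: "t \<le> ?A * \<epsilon>"
  proof -
    have "(8::real) ^ 1 \<le> 8 ^ m" using m by (intro power_increasing) auto
    then have "8 * 2 ^ m \<le> (8 * 2 :: real) ^ m" unfolding power_mult_distrib by simp
    then have "8 * 2 ^ m * \<epsilon> \<le> ?A * \<epsilon>" using eps by (intro mult_right_mono) auto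
    then show ?thesis using excess_upper[of m] unfolding t_def by linarith
  qed
  \<comment> \<open>In \<open>excess_lower\<close> the square of \<open>ret 1 0\<close> is at most
    \<open>\<epsilon>^2\<close> and so takes away at most half of
    \<open>2 * c0 * \<epsilon>\<close>.\<close>
  have t_ge: "(real m - 1) * (c0 * \<epsilon>) \<le> t"
  proof -
    have r1: "0 \<le> ret 1 0" "ret 1 0 \<le> \<epsilon>" using ret_nonneg ret_le[of 1 0] by auto
    then have "(ret 1 0)\<^sup>2 \<le> \<epsilon>\<^sup>2" by (intro power_mono)
    also have "\<dots> \<le> c0 * \<epsilon>" using e2 eps by (simp add: power2_eq_square)
    finally have "c0 * \<epsilon> \<le> ret 2 0 - (ret 1 0)\<^sup>2" using low by linarith
    then have "real (m - 1) * (c0 * \<epsilon>) \<le> real (m - 1) * (ret 2 0 - (ret 1 0)\<^sup>2)" by (intro mult_left_mono) auto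
    also have "\<dots> \<le> t" using excess_lower[of "m - 1"] m unfolding t_def by simp
    finally show ?thesis using m by (simp add: of_nat_diff)
  qed
  have ce: "0 < c0 * \<epsilon>" using c0 eps by simp
  have t_ge1: "c0 * \<epsilon> \<le> t"
  proof -
    have "1 * (c0 * \<epsilon>) \<le> (real m - 1) * (c0 * \<epsilon>)" using m ce by (intro mult_right_mono) auto
    then show ?thesis using t_ge by linarith
  qed
  have t0: "0 < t" and t1: "t \<le> 1" using t_ge1 ce t_le Ae by linarith+
  have t2: "t\<^sup>2 \<le> ?A\<^sup>2 * \<epsilon>\<^sup>2" using t_le t0 power_mono[of t "?A * \<epsilon>" 2] by (simp add: power_mult_distrib)
  have eA2: "?A\<^sup>2 * \<epsilon>\<^sup>2 \<le> \<epsilon> / 2"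
    using mult_right_mono[OF e1, of "\<epsilon> / 2"] eps by (simp add: power2_eq_square mult_ac)
  have mpos: "0 < real m" "1 \<le> m" using m by auto
  have base: "1 \<le> 1 + c * t / real m" "1 + c * t / real m \<le> 2" if "0 \<le> c" "c \<le> 1" for c
  proof -
    show "1 \<le> 1 + c * t / real m" using that t0 by simp
    have "c * t \<le> 1 * 1" using that t0 t1 by (intro mult_mono) auto
    also have "\<dots> \<le> real m" using m by simp
    finally show "1 + c * t / real m \<le> 2" using mpos by simp
  qed
  have pf: "p * f s \<le> 1" if "0 \<le> p" "p \<le> 2" for p s
  proof -
    have "p * f s \<le> 2 * \<epsilon>" using that f_le f_nonneg eps by (intro mult_mono) auto
    then show ?thesis using eps by linarith
  qed
  \<comment> \<open>53/100 exceeds the 1/2 of the survival condition by 3/100, which pays for the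
    Green tail. The 56/100 in \<open>p2\<close> stays below the 58/100 of the fractional moment,
    which leaves 1/100 for the errors in \<open>disorder\<close> after halving.\<close>
  define p1 where "p1 = 1 + 53 / 100 * t / real m"
  define p2 where "p2 = 1 + 56 / 100 * t / real m"
  have p12: "p1 < p2" using t0 mpos by (simp add: p1_def p2_def field_simps)
  have p1: "1 \<le> p1" "p1 \<le> 2" and p2: "1 \<le> p2" "p2 \<le> 2" unfolding p1_def p2_def by (rule base; simp)+
  have "2 \<le> 1 / \<epsilon>" using eps by (simp add: pos_le_divide_eq)
  then have pm2: "2 \<le> p_max f" using p_max_ge by linarith
  have blk: "block f R \<epsilon> p m" if "1 \<le> p" "p \<le> 2" for p
    using that mpos Ae pf[of p] by unfold_locales auto
  have "p_crit f \<le> p1"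
  proof -
    interpret b: block f R \<epsilon> p1 m by (rule blk[OF p1])
    have "0 \<le> 53 / 100 * t / real m" using t0 by simp
    then have pm: "1 + 53 / 100 * t \<le> p1 ^ m"
      using Bernoulli_inequality[of "53 / 100 * t / real m" m] mpos by (simp add: p1_def)
    have "1 / p1 ^ m \<le> 1 / (1 + 53 / 100 * t)" using pm t0 by (intro divide_left_mono) auto
    also have "\<dots> \<le> 1 - 53 / 100 * t + (53 / 100 * t)\<^sup>2"
    proof -
      have "1 \<le> (1 - 53 / 100 * t + (53 / 100 * t)\<^sup>2) * (1 + 53 / 100 * t)"
      proof -
        have "(1 - 53 / 100 * t + (53 / 100 * t)\<^sup>2) * (1 + 53 / 100 * t) = 1 + (53 / 100 * t) ^ 3"
          by (simp add: algebra_simps power2_eq_square power3_eq_cube)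
        then show ?thesis using t0 by simp
      qed
      then show ?thesis using t0 by (simp add: pos_divide_le_eq)
    qed
    finally have 1: "1 / p1 ^ m \<le> 1 - 53 / 100 * t + (53 / 100 * t)\<^sup>2" .
    have 2: "(53 / 100 * t)\<^sup>2 \<le> t\<^sup>2 / 2" by (simp add: power_mult_distrib power2_eq_square)
    have "(harm m + 3) * \<epsilon> \<le> 3 / 100 * (real m - 1) * c0 * \<epsilon>" using mc eps by (intro mult_right_mono) auto
    also have "\<dots> \<le> 3 / 100 * t" using mult_left_mono[OF t_ge, of "3 / 100"] by (simp add: mult_ac)
    finally have 3: "(harm m + 2) * \<epsilon> + \<epsilon> \<le> 3 / 100 * t" by (simp add: algebra_simps)
    have "1 / p1 ^ m + excess 1 m 0 / 2 + (?A * \<epsilon>)\<^sup>2 / 2 \<le> 1 - (harm m + 2) * \<epsilon>"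
      using 1 2 3 t2 eA2 eps unfolding t_def[symmetric] power_mult_distrib by linarith
    then obtain c where c: "0 < c" "\<And>N. c \<le> b.E (\<lambda>X. of_bool (0 < b.W (N * m) 0 0 X))"
      using b.survival e3 unfolding b.Dc_def b.c3_def by blast
    have "0 < b.P b.surv" using b.P_surv_ge[OF mpos(2) c(2)] c(1) by linarith
    then have "0 < measure (perc_measure f p1) percolation" by (simp add: b.measure_percolation)
    then show ?thesis unfolding p_crit_def using p1 pm2
      by (intro cInf_lower bdd_belowI[of _ 0]) auto
  qed
  moreover have "p2 \<le> p_crit2 f"
  proof -
    have neq: "growth_rate f p \<noteq> ereal (ln p)" if p: "0 < p" "p < p2" for p
    proof (cases "p < 1")
      case True
      interpret percolation_kernel f R p using p True pf[of p] by unfold_locales auto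
      show ?thesis by (rule growth_rate_neq) (simp add: P_surv_subcritical[OF True])
    next
      case False
      then have p': "1 \<le> p" "p \<le> 2" using p p2 by auto
      interpret b: block f R \<epsilon> p m by (rule blk[OF p'])
      have "p ^ m \<le> p2 ^ m" using p' p by (intro power_mono) auto
      also have "\<dots> \<le> exp (56 / 100 * t)"
        unfolding p2_def using mpos t0 by (intro exp_ge_one_plus_x_over_n_power_n) auto
      also have "\<dots> \<le> 1 + 56 / 100 * t + (56 / 100 * t)\<^sup>2" using t0 t1 by (intro exp_bound) auto
      also have "\<dots> \<le> 1 + 56 / 100 * t + t\<^sup>2" by (simp add: power_mult_distrib power2_eq_square)
      finally have pm: "p ^ m \<le> 1 + 56 / 100 * t + t\<^sup>2" .
      have "(2 * ?A\<^sup>2 + 100 ^ m) * \<epsilon> * \<epsilon> < c0 / 200 * \<epsilon>" using e4 eps by (intro mult_strict_right_mono) (linarith, simp)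
      then have "2 * (?A\<^sup>2 * \<epsilon>\<^sup>2) + 100 ^ m * \<epsilon>\<^sup>2 < c0 * \<epsilon> / 200" by (simp add: power2_eq_square algebra_simps)
      then have small: "2 * t\<^sup>2 + 100 ^ m * \<epsilon>\<^sup>2 < t / 100" using t2 t_ge1 t0 by linarith
      show ?thesis
        by (rule b.growth_rate_neq, rule b.AE_W_le[OF mpos(2) p(1)], rule b.disorder[OF t_def t1 pm small])
    qed
    show ?thesis
    proof (cases "{p. 0 < p \<and> p \<le> p_max f \<and> growth_rate f p = ereal (ln p)} = {}")
      \<comment> \<open>By convention an empty set gives \<open>p_max f\<close>, which is at least 2
        and hence at least \<open>p2\<close>.\<close>
      case True
      then show ?thesis using p2 pm2 by (simp add: p_crit2_def)
    next
      case False
      then have "p2 \<le> Inf {p. 0 < p \<and> p \<le> p_max f \<and> growth_rate f p = ereal (ln p)}"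
        using neq by (intro cInf_greatest) (auto simp: not_less[symmetric])
      then show ?thesis unfolding p_crit2_def Let_def if_not_P[OF False] .
    qed
  qed
  ultimately show ?thesis using p12 by linarith
qed

end

text \<open>A sublinear bound suffices against the linear growth in the choice of \<open>m\<close>;
  it follows by telescoping square roots.\<close>

lemma harm_le_sqrt: "harm m \<le> 2 * sqrt (real m)"
proof (induction m)
  case (Suc m)
  let ?a = "sqrt (real m)" and ?b = "sqrt (real (Suc m))"
  have b: "0 < ?b" "?a \<le> ?b" by auto
  have "1 = (?b - ?a) * (?b + ?a)" by (simp add: algebra_simps)
  also have "\<dots> \<le> (?b - ?a) * (?b + ?b)" using b by (intro mult_left_mono) auto
  finally have 1: "1 \<le> 2 * (?b - ?a) * ?b" by (simp add: algebra_simps)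
  have "inverse (real (Suc m)) \<le> 1 / ?b"
    unfolding inverse_eq_divide using b real_le_lsqrt[of "real (Suc m)" "real (Suc m)"]
    by (intro divide_left_mono) (auto simp: power2_eq_square)
  also have "\<dots> \<le> 2 * (?b - ?a)" using 1 b(1) by (subst pos_divide_le_eq)
  finally show ?case using Suc by (simp add: harm_Suc)
qed (simp add: harm_def)

text \<open>The block length depends on \<open>c0\<close> alone, and \<open>\<epsilon>0\<close> on
  \<open>c0\<close> and the block length, uniformly over kernels. A family of kernels with fixed
  \<open>c0\<close> and \<open>\<epsilon>\<close> tending to zero is therefore eventually
  covered.\<close>

lemma gap_threshold:
  assumes c0: "0 < c0"
  shows "\<exists>\<epsilon>0>0. \<forall>(f :: int ^ 'd::finite \<Rightarrow> real) R \<epsilon>. 0 < \<epsilon> \<longrightarrow> \<epsilon> < \<epsilon>0 \<longrightarrow> kernel f R \<longrightarrow> (\<forall>s. f s \<le> \<epsilon>) \<longrightarrow>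
    (\<forall>n\<ge>1. \<forall>z. kernel.ret f R n z \<le> \<epsilon> / (real n)\<^sup>2) \<longrightarrow> 2 * c0 * \<epsilon> \<le> kernel.ret f R 2 0 \<longrightarrow> p_crit f < p_crit2 f"
proof -
  have "\<forall>\<^sub>F m in sequentially. 2 * sqrt (real m) + 3 \<le> 3 / 100 * (real m - 1) * c0"
    using c0 by real_asymp
  then have "\<forall>\<^sub>F m in sequentially. 2 \<le> m \<and> 2 * sqrt (real m) + 3 \<le> 3 / 100 * (real m - 1) * c0"
    by (intro eventually_conj eventually_ge_at_top)
  then obtain m where m: "2 \<le> m" "2 * sqrt (real m) + 3 \<le> 3 / 100 * (real m - 1) * c0"
    by (auto simp: eventually_sequentially)
  then have mc: "harm m + 3 \<le> 3 / 100 * (real m - 1) * c0" using harm_le_sqrt[of m] by linarith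
  let ?A = "(16::real) ^ m"
  define K where "K = (1 + 2 * real m + 19 * 16 ^ m * (1 + 3 * real m) + 4 * (1 + 2 * real m) * (2 * real m * 48 ^ m))
        * (harm m + 2) + 19 * 16 ^ m * real m * (1 + harm m)"
  have H: "0 \<le> (harm m :: real)" by (simp add: harm_nonneg)
  have K: "0 < K" unfolding K_def using m H by (intro add_pos_nonneg mult_pos_pos) auto
  define \<epsilon>0 where "\<epsilon>0 = Min {1 / 4, 1 / (2 * ?A\<^sup>2), c0, real m / K, c0 / (200 * (2 * ?A\<^sup>2 + 100 ^ m))}"
  have Q: "0 < 200 * (2 * ?A\<^sup>2 + 100 ^ m)" by (intro mult_pos_pos add_pos_pos) auto
  have "0 < \<epsilon>0" unfolding \<epsilon>0_def using c0 K m Q by auto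
  moreover have "p_crit f < p_crit2 f"
    if e: "0 < \<epsilon>" "\<epsilon> < \<epsilon>0" and k: "kernel f R" and fl: "\<forall>s. f s \<le> \<epsilon>"
      and rl: "\<forall>n\<ge>1. \<forall>z. kernel.ret f R n z \<le> \<epsilon> / (real n)\<^sup>2" and low: "2 * c0 * \<epsilon> \<le> kernel.ret f R 2 0"
    for f :: "int ^ 'd \<Rightarrow> real" and R \<epsilon>
  proof -
    have b: "\<epsilon> < 1 / 4" "\<epsilon> < 1 / (2 * ?A\<^sup>2)" "\<epsilon> < c0" "\<epsilon> < real m / K" "\<epsilon> < c0 / (200 * (2 * ?A\<^sup>2 + 100 ^ m))"
      using e(2) by (auto simp: \<epsilon>0_def)
    interpret kernel f R by (rule k)
    interpret transient_kernel f R \<epsilon> using e(1) b(1) fl rl by unfold_locales auto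
    show ?thesis
    proof (rule p_crit_less_p_crit2[OF m(1) c0 mc low])
      show "2 * ?A\<^sup>2 * \<epsilon> \<le> 1" using b(2) by (simp add: pos_less_divide_eq mult_ac)
      show "\<epsilon> \<le> c0" using b(3) by simp
      show "\<epsilon> * ((1 + 2 * real m + 19 * 16 ^ m * (1 + 3 * real m) + 4 * (1 + 2 * real m) * (2 * real m * 48 ^ m))
        * (harm m + 2) + 19 * 16 ^ m * real m * (1 + harm m)) \<le> real m"
        using b(4) K unfolding K_def[symmetric] by (simp add: pos_less_divide_eq)
      show "200 * (2 * ?A\<^sup>2 + 100 ^ m) * \<epsilon> < c0" using b(5) Q by (simp add: pos_less_divide_eq mult.commute)
    qed
  qed
  ultimately show ?thesis by blast
qed

theorem corollary2p9:
  fixes F :: "real ^ 'd::finite \<Rightarrow> real"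
  assumes "CARD('d) > 4"
    and "\<And>x. F x \<ge> 0"
    and "continuous_on UNIV F"
    and "compact (closure {x. F x \<noteq> 0})"
    and "integral\<^sup>L lborel F = 1"
    and "\<And>i x. F (reflect i x) = F x"
  shows "\<forall>\<^sub>F L in sequentially. p_crit2 (spread_out F L) > p_crit (spread_out F L)"
proof -
  let ?d = "CARD('d)"
  have "4 \<le> ?d" using assms(1) by simp
  then obtain C c0 where C: "0 < C" "0 < c0" and ker: "\<forall>\<^sub>F L in sequentially. \<exists>R. kernel (spread_out F L) R \<and>
    (\<forall>s. spread_out F L s \<le> C / real L ^ ?d) \<and>
    (\<forall>n\<ge>1. \<forall>z. kernel.ret (spread_out F L) R n z \<le> C / real L ^ ?d / (real n)\<^sup>2) \<and>
    2 * c0 * (C / real L ^ ?d) \<le> kernel.ret (spread_out F L) R 2 0"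
    using spread_out_kernel[of F] assms(2-5) by blast
  obtain \<epsilon>0 where \<epsilon>0: "0 < \<epsilon>0" and gap: "\<And>(f :: int ^ 'd \<Rightarrow> real) R \<epsilon>. 0 < \<epsilon> \<Longrightarrow> \<epsilon> < \<epsilon>0 \<Longrightarrow> kernel f R \<Longrightarrow> \<forall>s. f s \<le> \<epsilon> \<Longrightarrow>
    \<forall>n\<ge>1. \<forall>z. kernel.ret f R n z \<le> \<epsilon> / (real n)\<^sup>2 \<Longrightarrow> 2 * c0 * \<epsilon> \<le> kernel.ret f R 2 0 \<Longrightarrow> p_crit f < p_crit2 f"
    using gap_threshold[OF C(2)] by blast
  have "(\<lambda>L. C / real L ^ ?d) \<longlonglongrightarrow> 0"
    using filterlim_compose[OF tendsto_divide_0[OF tendsto_const filterlim_at_top_imp_at_infinity[OF filterlim_pow_at_top[OF _ filterlim_ident]]] filterlim_real_sequentially, of ?d C]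
    by simp
  then have "\<forall>\<^sub>F L in sequentially. C / real L ^ ?d < \<epsilon>0" using \<epsilon>0 by (rule order_tendstoD)
  then show ?thesis using ker eventually_gt_at_top[of 0]
  proof eventually_elim
    case (elim L)
    then obtain R where R: "kernel (spread_out F L) R" "\<forall>s. spread_out F L s \<le> C / real L ^ ?d"
      "\<forall>n\<ge>1. \<forall>z. kernel.ret (spread_out F L) R n z \<le> C / real L ^ ?d / (real n)\<^sup>2"
      "2 * c0 * (C / real L ^ ?d) \<le> kernel.ret (spread_out F L) R 2 0" by blast
    show ?case by (rule gap[OF _ elim(1) R]) (use C elim in simp)
  qed
qed

end
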